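(* Let $\Omega\in\overline{\mathfrak D}(\mathbb R^3)$ be a polyhedral domain and let $\mathbf B\in C^0(\overline\Omega)$ be a continuous magnetic field. Then the function $\Lambda:x\mapsto E(\mathbf B_x,\Pi_x)$ is lower semi-continuous on $\overline\Omega$.
   Context: **Cones and corner domains.** A cone in $\mathbb R^n$ is an open set $\Pi$ with $\rho x\in\Pi$ for all $\rho>0$, $x\in\Pi$; its section is $\Pi\cap\mathbb S^{n-1}$ ($\mathbb S^0=\{-1,1\}$), and the cone with section $\mathbb S^{n-1}$ is understood to be $\mathbb R^n$. Classes $\mathfrak P_n$ (cones of $\mathbb R^n$) and $\mathfrak D(M)$ (open subsets of $M$) are defined recursively. $\mathfrak P_0=\{\{0\}\}$; $\mathfrak D(\mathbb S^0)$ consists of all (nonempty) subsets of $\mathbb S^0$, so $\mathfrak P_1=\{\mathbb R,\mathbb R_+,\mathbb R_-\}$. For $n\ge1$: (1) $\Pi\in\mathfrak P_n$ iff its section belongs to $\mathfrak D(\mathbb S^{n-1})$; (2) for $M=\mathbb R^n$ or $\mathbb S^n$, a bounded connected open $\Omega\subset M$ belongs to $\mathfrak D(M)$ iff for every $x\in\overline\Omega$ there are a cone $\Pi_x\in\mathfrak P_n$ (the tangent cone at $x$) and a $C^\infty$ diffeomorphism $\mathrm U^x$ from a neighborhood $\mathcal U_x$ of $x$ in $M$ onto a neighborhood $\mathcal V_x$ of $0$ in $\mathbb R^n$ with $\mathrm U^x(\mathcal U_x\cap\Omega)=\mathcal V_x\cap\Pi_x$ and $\mathrm U^x(\mathcal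 U_x\cap\partial\Omega)=\mathcal V_x\cap\partial\Pi_x$, whose differential at $x$ is the identity (the tangent space of $M$ at $x$ being identified with $\mathbb R^n$). A cone in $\mathfrak P_n$ is polyhedral, written $\Pi\in\overline{\mathfrak P}_n$, if its boundary is contained in a finite union of hyperplanes; $\Omega\in\mathfrak D(M)$ is a polyhedral domain, written $\Omega\in\overline{\mathfrak D}(M)$, if all its tangent cones are polyhedral. **Energies.** $\mathbf B_x=\mathbf B(x)$ is the constant field frozen at $x$. For a constant field $\mathbf B$ and a cone $\Pi\in\overline{\mathfrak P}_3$, $E(\mathbf B,\Pi)$ is the bottom of the spectrum of the Neumann realization $H(\mathbf A,\Pi)$ of $(-i\nabla+\mathbf A)^2$ on $\Pi$ (the self-adjoint operator of the form $\int_\Pi|(-i\nabla+\mathbf A)f|^2$ with domain $\{f\in L^2(\Pi):(-i\nabla+\mathbf A)f\in L^2(\Pi)\}$), where $\mathbf A$ is any linear potential with $\operatorname{curl}\mathbf A=\mathbf B$ (the value does not depend on the choice). *)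

theory Defs
  imports "HOL-Analysis.Analysis"
begin

section \<open>Smooth maps and diffeomorphisms\<close>

primrec Ck_on :: "nat \<Rightarrow> 'a::euclidean_space set \<Rightarrow> ('a \<Rightarrow> 'b::euclidean_space) \<Rightarrow> bool" where
  "Ck_on 0 S f \<longleftrightarrow> continuous_on S f"
| "Ck_on (Suc k) S f \<longleftrightarrow>
     (\<forall>x\<in>S. f differentiable (at x)) \<and> (\<forall>v. Ck_on k S (\<lambda>x. frechet_derivative f (at x) v))"

text \<open>Intended for open \<open>S\<close> only.\<close>

definition smooth_on :: "'a::euclidean_space set \<Rightarrow> ('a \<Rightarrow> 'b::euclidean_space) \<Rightarrow> bool" where
  "smooth_on S f \<longleftrightarrow> (\<forall>k. Ck_on k S f)"

text \<open>Smoothness on an arbitrary subset of a Euclidean space, by local smooth extension. On a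
  relatively open subset of an embedded submanifold (here: a sphere) this is the usual
  \<open>C\<^sup>\<infinity>\<close> notion, and on open sets it agrees with \<^const>\<open>smooth_on\<close>.\<close>

definition smooth_map :: "'a::euclidean_space set \<Rightarrow> ('a \<Rightarrow> 'b::euclidean_space) \<Rightarrow> bool" where
  "smooth_map X f \<longleftrightarrow>
     (\<forall>x\<in>X. \<exists>N F. open N \<and> x \<in> N \<and> smooth_on N F \<and> (\<forall>y\<in>N \<inter> X. F y = f y))"

definition diffeomorphism ::
  "'a::euclidean_space set \<Rightarrow> 'b::euclidean_space set \<Rightarrow> ('a \<Rightarrow> 'b) \<Rightarrow> ('b \<Rightarrow> 'a) \<Rightarrow> bool" where
  "diffeomorphism X Y f g \<longleftrightarrow> homeomorphism X Y f g \<and> smooth_map X f \<and> smooth_map Y g"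


section \<open>Cones and corner domains\<close>

definition open_cone :: "'a::euclidean_space set \<Rightarrow> bool" where
  "open_cone C \<longleftrightarrow> open C \<and> (\<forall>\<rho>>0. \<forall>x\<in>C. \<rho> *\<^sub>R x \<in> C)"

text \<open>The open cones whose section lies in the given class \<open>\<D>\<close>. Both the whole space and the
  punctured space have the full sphere as section; by convention only the whole space counts.\<close>

definition cones_over :: "'a::euclidean_space set set \<Rightarrow> 'a set set" where
  "cones_over \<D> = {C. open_cone C \<and> C \<inter> sphere 0 1 \<in> \<D> \<and> (sphere 0 1 \<subseteq> C \<longrightarrow> C = UNIV)}"

text \<open>The manifold \<open>M\<close> is an embedded closed submanifold of \<open>'m\<close>, the model space of its
  charts is \<open>'n\<close>. The set \<open>Fr x\<close> consists of the admissible identifications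
  \<open>J : 'n \<rightarrow> T\<^sub>xM \<subseteq> 'm\<close>, and the differential of the chart at \<open>x\<close> is the identity
  under \<open>J\<close>, that is, it is the inverse of \<open>J\<close> on \<open>T\<^sub>xM\<close>. The derivative \<open>D\<close> within a
  piece of \<open>M\<close> is only determined on \<open>T\<^sub>xM\<close>.\<close>

definition is_tangent_cone ::
  "'m::euclidean_space set \<Rightarrow> ('m \<Rightarrow> ('n::euclidean_space \<Rightarrow> 'm) set) \<Rightarrow> 'n set set \<Rightarrow>
   'm set \<Rightarrow> 'm \<Rightarrow> 'n set \<Rightarrow> bool" where
  "is_tangent_cone M Fr \<PP> \<Omega> x C \<longleftrightarrow>
     C \<in> \<PP> \<and>
     (\<exists>N V U U' D J.
        openin (top_of_set M) N \<and> x \<in> N \<and> open V \<and> 0 \<in> V \<and>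
        diffeomorphism N V U U' \<and> U x = 0 \<and>
        (U has_derivative D) (at x within N) \<and> J \<in> Fr x \<and> (\<forall>v. D (J v) = v) \<and>
        U ` (N \<inter> \<Omega>) = V \<inter> C \<and>
        U ` (N \<inter> (top_of_set M frontier_of \<Omega>)) = V \<inter> frontier C)"

definition corner_domains ::
  "'m::euclidean_space set \<Rightarrow> ('m \<Rightarrow> ('n::euclidean_space \<Rightarrow> 'm) set) \<Rightarrow> 'n set set \<Rightarrow>
   'm set set" where
  "corner_domains M Fr \<PP> =
     {\<Omega>. openin (top_of_set M) \<Omega> \<and> \<Omega> \<noteq> {} \<and> bounded \<Omega> \<and> connected \<Omega> \<and>
          (\<forall>x \<in> top_of_set M closure_of \<Omega>. \<exists>C. is_tangent_cone M Fr \<PP> \<Omega> x C)}"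

definition space_frames :: "'a::euclidean_space \<Rightarrow> ('a \<Rightarrow> 'a) set" where
  "space_frames x = {id}"

text \<open>For the unit sphere, \<open>T\<^sub>xM\<close> is the orthogonal complement of \<open>x\<close>; it has no canonical
  coordinates, so every linear isometry onto it is admitted.\<close>

definition sphere_frames :: "'m::euclidean_space \<Rightarrow> ('n::euclidean_space \<Rightarrow> 'm) set" where
  "sphere_frames x = {J. linear J \<and> (\<forall>v. norm (J v) = norm v) \<and> range J = {v. x \<bullet> v = 0}}"

text \<open>The recursion, up to dimension three. The dimension is carried by the type, so each level
  is a constant of its own; \<open>\<real>\<^sup>1\<close> is \<^typ>\<open>real\<close>.\<close>

definition corner_S0 :: "real set set" where
  "corner_S0 = {\<omega>. \<omega> \<noteq> {} \<and> \<omega> \<subseteq> sphere 0 1}"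

definition cones_R1 :: "real set set" where
  "cones_R1 = cones_over corner_S0"

definition corner_S1 :: "(real^2) set set" where
  "corner_S1 = corner_domains (sphere 0 1) sphere_frames cones_R1"

definition cones_R2 :: "(real^2) set set" where
  "cones_R2 = cones_over corner_S1"

definition corner_S2 :: "(real^3) set set" where
  "corner_S2 = corner_domains (sphere 0 1) sphere_frames cones_R2"

definition cones_R3 :: "(real^3) set set" where
  "cones_R3 = cones_over corner_S2"

definition corner_R3 :: "(real^3) set set" where
  "corner_R3 = corner_domains UNIV space_frames cones_R3"

abbreviation tangent_cone_R3 :: "(real^3) set \<Rightarrow> real^3 \<Rightarrow> (real^3) set \<Rightarrow> bool" where
  "tangent_cone_R3 \<equiv> is_tangent_cone UNIV space_frames cones_R3"

definition hyperplane :: "'a::euclidean_space set \<Rightarrow> bool" where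
  "hyperplane h \<longleftrightarrow> (\<exists>a b. a \<noteq> 0 \<and> h = {x. a \<bullet> x = b})"

definition polyhedral_cones_R3 :: "(real^3) set set" where
  "polyhedral_cones_R3 =
     {C \<in> cones_R3. \<exists>H. finite H \<and> (\<forall>h\<in>H. hyperplane h) \<and> frontier C \<subseteq> \<Union>H}"

definition polyhedral_domains_R3 :: "(real^3) set set" where
  "polyhedral_domains_R3 =
     {\<Omega> \<in> corner_R3. \<forall>x \<in> closure \<Omega>. \<forall>C. tangent_cone_R3 \<Omega> x C \<longrightarrow> C \<in> polyhedral_cones_R3}"

lemma cones_R1_eq: "cones_R1 = {UNIV, {0<..}, {..<0}}"
proof -
  have sph: "sphere (0::real) 1 = {-1, 1}"
    by (auto simp: sphere_def dist_real_def)
  have pos: "x \<in> C \<longleftrightarrow> 1 \<in> C" if "open_cone C" "x > 0" for x :: real and C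
  proof
    assume "x \<in> C"
    with that have "(1/x) *\<^sub>R x \<in> C" unfolding open_cone_def by (meson zero_less_divide_1_iff)
    then show "1 \<in> C" using that by simp
  next
    assume "1 \<in> C"
    with that have "x *\<^sub>R 1 \<in> C" unfolding open_cone_def by blast
    then show "x \<in> C" by simp
  qed
  have neg: "x \<in> C \<longleftrightarrow> -1 \<in> C" if "open_cone C" "x < 0" for x :: real and C
  proof
    assume "x \<in> C"
    moreover have "1 / (-x) > 0" using that by simp
    ultimately have "(1 / (-x)) *\<^sub>R x \<in> C" using that unfolding open_cone_def by blast
    then show "-1 \<in> C" using that by simp
  next
    assume "-1 \<in> C"
    moreover have "-x > 0" using that by simp
    ultimately have "(-x) *\<^sub>R (-1) \<in> C" using that unfolding open_cone_def by blast
    then show "x \<in> C" by simp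
  qed
  have zero: "C = UNIV" if C: "open_cone C" "0 \<in> C" for C :: "real set"
  proof -
    obtain e where e: "e > 0" "ball 0 e \<subseteq> C"
      using C unfolding open_cone_def by (meson open_contains_ball)
    then have "e/2 \<in> C" "-(e/2) \<in> C" by (auto simp: subset_eq dist_real_def)
    then have "1 \<in> C" "-1 \<in> C" using pos[OF C(1), of "e/2"] neg[OF C(1), of "-(e/2)"] e by auto
    then have "x \<in> C" for x
      using pos[OF C(1), of x] neg[OF C(1), of x] C(2) by (metis linorder_less_linear)
    then show ?thesis by auto
  qed
  show ?thesis
  proof (intro set_eqI iffI)
    fix C assume "C \<in> cones_R1"
    then have C: "open_cone C" and ne: "C \<inter> {-1, 1} \<noteq> {}" and full: "{-1, 1} \<subseteq> C \<longrightarrow> C = UNIV"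
      by (auto simp: cones_R1_def cones_over_def corner_S0_def sph)
    show "C \<in> {UNIV, {0<..}, {..<0}}"
    proof (cases "C = UNIV")
      case False
      then have z: "0 \<notin> C" using zero[OF C] by blast
      consider "1 \<in> C" "-1 \<notin> C" | "-1 \<in> C" "1 \<notin> C" using ne full False by auto
      then show ?thesis
      proof cases
        case 1
        then have "x \<in> C \<longleftrightarrow> 0 < x" for x
          using pos[OF C, of x] neg[OF C, of x] z by (metis linorder_less_linear less_asym)
        then have "C = {0<..}" by auto
        then show ?thesis by simp
      next
        case 2
        then have "x \<in> C \<longleftrightarrow> x < 0" for x
          using pos[OF C, of x] neg[OF C, of x] z by (metis linorder_less_linear less_asym)
        then have "C = {..<0}" by auto
        then show ?thesis by simp
      qed
    qed simp
  next
    fix C :: "real set" assume "C \<in> {UNIV, {0<..}, {..<0}}"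
    then show "C \<in> cones_R1"
      by (auto simp: cones_R1_def cones_over_def corner_S0_def sph open_cone_def mult_pos_neg)
  qed
qed


section \<open>The Neumann magnetic Laplacian on an open set\<close>

text \<open>Elements of \<open>L\<^sup>2\<close> are represented by functions on the whole space, of which only the
  restriction to \<open>S\<close> matters; functions equal almost everywhere on \<open>S\<close> are not identified.\<close>

definition L2 :: "(real^3) set \<Rightarrow> (real^3 \<Rightarrow> complex) set" where
  "L2 S = {f. f \<in> borel_measurable (lebesgue_on S) \<and>
              integrable (lebesgue_on S) (\<lambda>x. (cmod (f x))\<^sup>2)}"

definition L2_inner :: "(real^3) set \<Rightarrow> (real^3 \<Rightarrow> complex) \<Rightarrow> (real^3 \<Rightarrow> complex) \<Rightarrow> complex" where
  "L2_inner S f g = (LINT x|lebesgue_on S. f x * cnj (g x))"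

definition L2_norm :: "(real^3) set \<Rightarrow> (real^3 \<Rightarrow> complex) \<Rightarrow> real" where
  "L2_norm S f = sqrt (LINT x|lebesgue_on S. (cmod (f x))\<^sup>2)"

definition partial :: "3 \<Rightarrow> (real^3 \<Rightarrow> 'b::real_normed_vector) \<Rightarrow> real^3 \<Rightarrow> 'b" where
  "partial j f x = frechet_derivative f (at x) (axis j 1)"

definition curl :: "(real^3 \<Rightarrow> real^3) \<Rightarrow> real^3 \<Rightarrow> real^3" where
  "curl A x = vector [partial 2 A x $ 3 - partial 3 A x $ 2,
                      partial 3 A x $ 1 - partial 1 A x $ 3,
                      partial 1 A x $ 2 - partial 2 A x $ 1]"

definition test_functions :: "(real^3) set \<Rightarrow> (real^3 \<Rightarrow> complex) set" where
  "test_functions S =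
     {\<phi>. smooth_on UNIV \<phi> \<and> (\<exists>K. compact K \<and> K \<subseteq> S \<and> (\<forall>x. x \<notin> K \<longrightarrow> \<phi> x = 0))}"

text \<open>\<open>(-i\<nabla> + A) f = g\<close> in the sense of distributions on \<open>S\<close>: the pairing is bilinear, so moving
  \<open>-i\<partial>\<^sub>j\<close> onto the test function gives \<open>+i\<partial>\<^sub>j\<close>.\<close>

definition weak_mgrad ::
  "(real^3 \<Rightarrow> real^3) \<Rightarrow> (real^3) set \<Rightarrow> (real^3 \<Rightarrow> complex) \<Rightarrow> (3 \<Rightarrow> real^3 \<Rightarrow> complex) \<Rightarrow> bool" where
  "weak_mgrad A S f g \<longleftrightarrow>
     (\<forall>\<phi>\<in>test_functions S. \<forall>j.
        (LINT x|lebesgue_on S. f x * (\<i> * partial j \<phi> x + of_real (A x $ j) * \<phi> x)) =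
        (LINT x|lebesgue_on S. g j x * \<phi> x))"

definition form_domain :: "(real^3 \<Rightarrow> real^3) \<Rightarrow> (real^3) set \<Rightarrow> (real^3 \<Rightarrow> complex) set" where
  "form_domain A S = {f \<in> L2 S. \<exists>g. (\<forall>j. g j \<in> L2 S) \<and> weak_mgrad A S f g}"

text \<open>On the form domain, determined up to almost everywhere equality on \<open>S\<close>.\<close>

definition mgrad ::
  "(real^3 \<Rightarrow> real^3) \<Rightarrow> (real^3) set \<Rightarrow> (real^3 \<Rightarrow> complex) \<Rightarrow> 3 \<Rightarrow> real^3 \<Rightarrow> complex" where
  "mgrad A S f = (SOME g. (\<forall>j. g j \<in> L2 S) \<and> weak_mgrad A S f g)"

definition mform ::
  "(real^3 \<Rightarrow> real^3) \<Rightarrow> (real^3) set \<Rightarrow> (real^3 \<Rightarrow> complex) \<Rightarrow> (real^3 \<Rightarrow> complex) \<Rightarrow> complex" where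
  "mform A S u v = (\<Sum>j\<in>UNIV. L2_inner S (mgrad A S u j) (mgrad A S v j))"

text \<open>The graph of the operator \<open>H(A, S)\<close> associated with the form: \<open>u\<close> is in its domain and
  \<open>H u = w\<close> almost everywhere on \<open>S\<close>.\<close>

definition neumann_op ::
  "(real^3 \<Rightarrow> real^3) \<Rightarrow> (real^3) set \<Rightarrow> (real^3 \<Rightarrow> complex) \<Rightarrow> (real^3 \<Rightarrow> complex) \<Rightarrow> bool" where
  "neumann_op A S u w \<longleftrightarrow>
     u \<in> form_domain A S \<and> w \<in> L2 S \<and> (\<forall>v\<in>form_domain A S. mform A S u v = L2_inner S w v)"

text \<open>\<open>H - z\<close> is a bijection from the domain of \<open>H\<close> onto \<open>L\<^sup>2(S)\<close> with bounded inverse; the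
  lower bound in the first conjunct gives both injectivity and boundedness of the inverse.\<close>

definition neumann_resolvent_set :: "(real^3 \<Rightarrow> real^3) \<Rightarrow> (real^3) set \<Rightarrow> complex set" where
  "neumann_resolvent_set A S =
     {z. (\<exists>c. \<forall>u w. neumann_op A S u w \<longrightarrow> L2_norm S u \<le> c * L2_norm S (\<lambda>x. w x - z * u x)) \<and>
         (\<forall>g\<in>L2 S. \<exists>u w. neumann_op A S u w \<and> (AE x in lebesgue_on S. w x - z * u x = g x))}"

definition neumann_spectrum :: "(real^3 \<Rightarrow> real^3) \<Rightarrow> (real^3) set \<Rightarrow> complex set" where
  "neumann_spectrum A S = - neumann_resolvent_set A S"

definition spectrum_bottom :: "(real^3 \<Rightarrow> real^3) \<Rightarrow> (real^3) set \<Rightarrow> real" where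
  "spectrum_bottom A S = Inf (Re ` neumann_spectrum A S)"

lemma linear_potential_exists: "\<exists>A. linear A \<and> (\<forall>x. curl A x = b)"
proof (intro exI conjI allI)
  let ?A = "\<lambda>x. (1/2) *\<^sub>R cross3 b x"
  show l: "linear ?A"
    by (rule linearI) (simp_all add: cross_add_right cross_mult_right scaleR_add_right)
  show "curl ?A x = b" for x
    using linear_imp_has_derivative[OF l, of "at x"]
    by (simp add: curl_def partial_def frechet_derivative_at[symmetric] cross3_def axis_def
        vec_eq_iff forall_3)
qed

text \<open>By gauge invariance the ground energy below does not depend on the chosen potential.\<close>

definition linear_potential :: "real^3 \<Rightarrow> real^3 \<Rightarrow> real^3" where
  "linear_potential b = (SOME A. linear A \<and> (\<forall>x. curl A x = b))"

definition ground_energy :: "real^3 \<Rightarrow> (real^3) set \<Rightarrow> real" where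
  "ground_energy b C = spectrum_bottom (linear_potential b) C"


section \<open>Lower semicontinuity\<close>

definition lower_semicontinuous_on :: "'a::topological_space set \<Rightarrow> ('a \<Rightarrow> real) \<Rightarrow> bool" where
  "lower_semicontinuous_on S f \<longleftrightarrow> (\<forall>x\<in>S. \<forall>a<f x. \<forall>\<^sub>F y in at x within S. a < f y)"

end

(* The bottom of the Neumann spectrum is the infimum of the Rayleigh quotient of the magnetic form.
   Near x the domain is, through the chart at x, a perturbation of the tangent cone at x.
   Since that polyhedral cone is regular open, it is exactly conic near each point q of its closure,
   and for y close to x the tangent cone at y is the local cone at q = U(y) up to a linear map close
   to the identity, where U is the chart. Dilations fix the cone at x and move q to infinity, so an
   almost minimizer on the cone at y, cut off to a ball of fixed radius R, can be transplanted into
   the cone at x. A gauge change centred on the ball makes the difference of the potentials of size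
   R times the error in the field and in the linear map. Averaging over the position of the cutoff
   shows that some position costs only O(1/R^2) in energy. Hence the energy at x is at most the
   energy at y plus an error that is small when first R is large and then y is close to x. *)

theory Submission
  imports Defs
begin

section \<open>Smooth functions and bumps\<close>

text \<open>Only tangent cones are compared; no operator on the domain itself occurs. The obstacle
  is that the ball on which the cone at x coincides with the local cone at q can shrink as y tends
  to x, because q approaches the lower-dimensional strata, while the cutoff needs a fixed radius R.
  Dilating the position of the domain, and not the field, removes this conflict: the radius of
  coincidence becomes arbitrary, and the large translation it brings in is harmless because a
  constant vector added to the potential is a gauge. So R is fixed before y, and closeness of y to x
  serves the field and the linear map alone. Linearizing charts yields inclusions into closures of
  cones only. Regular openness makes them exact; it has to be extracted from the recursive
  definition, since a crack would destroy it. The argument runs on pairs of a square integrable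
  function and a weak gradient, which survive cutoff, gauge and affine changes on open sets. The
  spectrum, defined through the resolvent, is reached by a contraction argument for complex
  parameters left of the infimum and by Cauchy-Schwarz at the infimum.\<close>

lemma Ck_on_cong:
  assumes "open S" "\<And>x. x \<in> S \<Longrightarrow> f x = g x" "Ck_on k S f"
  shows "Ck_on k S g"
  using assms(2,3)
proof (induction k arbitrary: f g)
  case 0
  then show ?case by (metis Ck_on.simps(1) continuous_on_cong)
next
  case (Suc k)
  have der: "(g has_derivative frechet_derivative f (at x)) (at x)" if "x \<in> S" for x
    using Suc.prems that assms(1)
    by (auto intro: has_derivative_transform_within_open simp: frechet_derivative_works)
  then have eq: "frechet_derivative g (at x) = frechet_derivative f (at x)" if "x \<in> S" for x
    using that frechet_derivative_at by metis
  show ?case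
    using Suc.IH[of "\<lambda>x. frechet_derivative f (at x) v" "\<lambda>x. frechet_derivative g (at x) v" for v] der eq Suc.prems
    unfolding Ck_on.simps differentiable_def by metis
qed

text \<open>\<open>Ck_on\<close> refers to the chosen \<open>frechet_derivative\<close>; this rule
  accepts any formula for the derivative, so that a closure property below becomes an induction on
  \<open>k\<close> with its own differentiation rule.\<close>

lemma Ck_on_SucI:
  assumes "open S" "\<And>x. x \<in> S \<Longrightarrow> (f has_derivative f' x) (at x)" "\<And>v. Ck_on k S (\<lambda>x. f' x v)"
  shows "Ck_on (Suc k) S f"
proof -
  have "frechet_derivative f (at x) = f' x" if "x \<in> S" for x
    using assms(2)[OF that] frechet_derivative_at by metis
  moreover have "Ck_on k S (\<lambda>x. frechet_derivative f (at x) v)" for v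
    by (rule Ck_on_cong[OF assms(1) _ assms(3)[of v]]) (simp add: calculation)
  ultimately show ?thesis using assms(2) by (auto simp: differentiable_def)
qed

lemma Ck_on_SucD: "Ck_on (Suc k) S f \<Longrightarrow> Ck_on k S f"
proof (induction k arbitrary: f)
  case 0
  then show ?case
    by (auto intro!: continuous_at_imp_continuous_on differentiable_imp_continuous_within)
qed simp

lemma Ck_on_subset: "Ck_on k S f \<Longrightarrow> T \<subseteq> S \<Longrightarrow> Ck_on k T f"
  by (induction k arbitrary: f) (auto intro: continuous_on_subset)

lemma Ck_on_const: "open S \<Longrightarrow> Ck_on k S (\<lambda>x. c)"
proof (induction k arbitrary: c)
  case (Suc k)
  show ?case by (rule Ck_on_SucI[where f' = "\<lambda>x v. 0"]) (use Suc in auto)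
qed simp

lemma Ck_on_bounded_linear:
  assumes "open S" "bounded_linear h" "Ck_on k S f"
  shows "Ck_on k S (\<lambda>x. h (f x))"
  using assms(3)
proof (induction k arbitrary: f)
  case 0
  then show ?case using assms bounded_linear.continuous_on by auto
next
  case (Suc k)
  show ?case
    by (rule Ck_on_SucI[where f' = "\<lambda>x v. h (frechet_derivative f (at x) v)"])
      (use Suc assms in \<open>auto intro!: bounded_linear.has_derivative[OF assms(2)] simp: frechet_derivative_works\<close>)
qed

lemma Ck_on_add:
  assumes "open S" "Ck_on k S f" "Ck_on k S g"
  shows "Ck_on k S (\<lambda>x. f x + g x)"
  using assms(2,3)
proof (induction k arbitrary: f g)
  case 0
  then show ?case by (auto intro: continuous_intros)
next
  case (Suc k)
  show ?case
    by (rule Ck_on_SucI[where f' = "\<lambda>x v. frechet_derivative f (at x) v + frechet_derivative g (at x) v"])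
      (use Suc assms in \<open>auto intro!: has_derivative_add simp: frechet_derivative_works\<close>)
qed

lemma Ck_on_bilinear:
  assumes "open S" "bounded_bilinear h" "Ck_on k S f" "Ck_on k S g"
  shows "Ck_on k S (\<lambda>x. h (f x) (g x))"
  using assms(3,4)
proof (induction k arbitrary: f g)
  case 0
  then show ?case using bounded_bilinear.continuous_on[OF assms(2)] by auto
next
  case (Suc k)
  \<comment> \<open>The product rule leaves the undifferentiated factors in place, so they are
    needed at the lower order \<open>k\<close> as well.\<close>
  note ck = Ck_on_SucD[OF Suc.prems(1)] Ck_on_SucD[OF Suc.prems(2)]
  show ?case
    by (rule Ck_on_SucI[where f' = "\<lambda>x v. h (f x) (frechet_derivative g (at x) v)
          + h (frechet_derivative f (at x) v) (g x)"])
      (use Suc assms ck in \<open>auto intro!: bounded_bilinear.FDERIV[OF assms(2)] Ck_on_add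
        simp: frechet_derivative_works\<close>)
qed

lemma Ck_on_linear:
  assumes "open S" "bounded_linear h"
  shows "Ck_on k S h"
proof (cases k)
  case 0
  then show ?thesis using assms linear_continuous_on by auto
next
  case (Suc j)
  show ?thesis unfolding Suc
    by (rule Ck_on_SucI[where f' = "\<lambda>x. h"])
      (use assms in \<open>auto intro: bounded_linear_imp_has_derivative Ck_on_const\<close>)
qed

lemma Ck_on_compose_affine:
  assumes "bounded_linear h" "Ck_on k UNIV f"
  shows "Ck_on k UNIV (\<lambda>x. f (h x + c))"
  using assms(2)
proof (induction k arbitrary: f)
  case 0
  then show ?case
    using continuous_on_compose2[of UNIV f UNIV "\<lambda>x. h x + c"]
      linear_continuous_on[OF assms(1), of UNIV] by (simp add: continuous_on_add)
next
  case (Suc k)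
  have d: "((\<lambda>x. f (h x + c)) has_derivative (\<lambda>v. frechet_derivative f (at (h x + c)) (h v))) (at x)" for x
  proof -
    have 1: "((\<lambda>x. h x + c) has_derivative h) (at x)"
      using bounded_linear_imp_has_derivative[OF assms(1)] by (auto intro!: derivative_eq_intros)
    have 2: "(f has_derivative frechet_derivative f (at (h x + c))) (at (h x + c))"
      using Suc.prems by (simp add: frechet_derivative_works)
    show ?thesis
      using diff_chain_at[OF 1 2] by (simp add: o_def)
  qed
  show ?case
    by (rule Ck_on_SucI[where f' = "\<lambda>x v. frechet_derivative f (at (h x + c)) (h v)"])
      (use d Suc in auto)
qed

lemma cis_has_derivative: "(cis has_derivative (\<lambda>t. t *\<^sub>R (\<i> * cis y))) (at y)"
proof -
  have "((\<lambda>b. exp (\<i> * complex_of_real b)) has_derivative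
      (\<lambda>t. exp (\<i> * complex_of_real y) * (\<i> * complex_of_real t))) (at y)"
    using diff_chain_at[OF bounded_linear_imp_has_derivative[OF
        bounded_linear_compose[OF bounded_linear_mult_right[of \<i>] bounded_linear_of_real]]
        DERIV_exp[unfolded has_field_derivative_def]] by (simp add: o_def)
  then show ?thesis by (simp add: scaleR_conv_of_real mult_ac flip: cis_conv_exp)
qed

text \<open>Differentiation reproduces \<open>cis (\<eta> x)\<close> next to a derivative of \<eta>,
  so the induction closes on this one function once \<eta> is smooth of every order.\<close>

lemma Ck_on_cis:
  assumes "open S" "\<And>k. Ck_on k S (\<eta> :: 'a::euclidean_space \<Rightarrow> real)"
  shows "Ck_on k S (\<lambda>x. cis (\<eta> x))"
proof (induction k)
  case 0
  have "continuous_on S \<eta>" using assms(2)[of 0] by simp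
  then show ?case by (auto simp: cis_conv_exp intro!: continuous_intros)
next
  case (Suc k)
  have d: "((\<lambda>x. cis (\<eta> x)) has_derivative (\<lambda>v. frechet_derivative \<eta> (at x) v *\<^sub>R (\<i> * cis (\<eta> x)))) (at x)"
    if "x \<in> S" for x
  proof -
    have 1: "(\<eta> has_derivative frechet_derivative \<eta> (at x)) (at x)"
      using assms(2)[of "Suc 0"] that by (simp add: frechet_derivative_works)
    show ?thesis using diff_chain_at[OF 1 cis_has_derivative] by (simp add: o_def)
  qed
  show ?case
  proof (rule Ck_on_SucI[OF assms(1) d])
    fix v
    have "Ck_on k S (\<lambda>x. frechet_derivative \<eta> (at x) v)"
      using assms(2)[of "Suc k"] by simp
    moreover have "Ck_on k S (\<lambda>x. \<i> * cis (\<eta> x))"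
      by (rule Ck_on_bounded_linear[OF assms(1) bounded_linear_mult_right Suc])
    ultimately show "Ck_on k S (\<lambda>x. frechet_derivative \<eta> (at x) v *\<^sub>R (\<i> * cis (\<eta> x)))"
      by (rule Ck_on_bilinear[OF assms(1) bounded_bilinear_scaleR])
  qed
qed

text \<open>For \<open>t > 0\<close> these are \<open>p (1/t) exp (- 1/t)\<close>, a family closed under differentiation.\<close>

definition flat :: "real poly \<Rightarrow> real \<Rightarrow> real" where
  "flat p t = (if t > 0 then poly p (1/t) * exp (- (1/t)) else 0)"

text \<open>Exponential decay beats every power. Under s = 1/t this is the flatness of
  \<open>flat p\<close> at 0 from the right.\<close>

lemma poly_exp_limit: "((\<lambda>s. poly p s * exp (- s)) \<longlongrightarrow> 0) at_top" for p :: "real poly"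
proof (induction p)
  case (pCons a p)
  have "((\<lambda>s::real. poly p s * s * exp (-s)) \<longlongrightarrow> 0) at_top"
  proof -
    have "((\<lambda>s::real. \<Sum>i\<le>degree p. coeff p i * (s ^ Suc i / exp s)) \<longlongrightarrow> (\<Sum>i\<le>degree p. coeff p i * 0)) at_top"
      by (intro tendsto_intros tendsto_power_div_exp_0)
    moreover have "(\<Sum>i\<le>degree p. coeff p i * (s ^ Suc i / exp s)) = poly p s * s * exp (-s)" for s
      by (simp add: poly_altdef sum_distrib_left exp_minus divide_inverse mult_ac)
    ultimately show ?thesis by simp
  qed
  moreover have "((\<lambda>s::real. a * exp (-s)) \<longlongrightarrow> a * 0) at_top"
    by (intro tendsto_intros) (simp add: filterlim_compose[OF exp_at_bot filterlim_uminus_at_bot_at_top])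
  ultimately have "((\<lambda>s::real. a * exp (-s) + poly p s * s * exp (-s)) \<longlongrightarrow> 0) at_top"
    using tendsto_add by fastforce
  then show ?case by (simp add: algebra_simps)
qed simp

text \<open>With s = 1/t one has d/dt = - s^2 d/ds, which sends p(s) exp(-s) to s^2 (p(s) - p'(s))
  exp(-s); \<open>monom 1 2\<close> is the factor s^2.\<close>

lemma flat_has_derivative:
  "(flat p has_field_derivative flat (monom 1 2 * (p - pderiv p)) t) (at t)"
proof -
  consider "t > 0" | "t < 0" | "t = 0" by linarith
  then show ?thesis
  proof cases
    case 1
    have inv: "((\<lambda>t. 1/t) has_field_derivative (- ((1/t)^2))) (at t)"
      using 1 by (auto intro!: derivative_eq_intros simp: power2_eq_square)
    have "((\<lambda>t. poly p (1/t) * exp (- (1/t))) has_field_derivative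
        (poly p (1/t) * (exp (- (1/t)) * (- (- ((1/t)^2))))
        + poly (pderiv p) (1/t) * (- ((1/t)^2)) * exp (- (1/t)))) (at t)"
      by (rule DERIV_mult'[OF DERIV_chain2[OF poly_DERIV inv] DERIV_chain2[OF DERIV_exp DERIV_minus[OF inv]]])
    moreover have "poly p (1/t) * (exp (- (1/t)) * (- (- ((1/t)^2))))
        + poly (pderiv p) (1/t) * (- ((1/t)^2)) * exp (- (1/t)) = flat (monom 1 2 * (p - pderiv p)) t"
    proof -
      have "c * (e * (- (- (s^2)))) + d * (- (s^2)) * e = s^2 * (c - d) * e" for c d e s :: real
        by (simp add: algebra_simps)
      moreover have "flat (monom 1 2 * (p - pderiv p)) t
          = (1/t)^2 * (poly p (1/t) - poly (pderiv p) (1/t)) * exp (- (1/t))"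
        using 1 by (simp only: flat_def poly_monom poly_mult poly_diff if_True mult_1)
      ultimately show ?thesis by simp
    qed
    ultimately have "((\<lambda>t. poly p (1/t) * exp (- (1/t))) has_field_derivative
        flat (monom 1 2 * (p - pderiv p)) t) (at t)" by simp
    moreover have "\<forall>\<^sub>F s in nhds t. flat p s = poly p (1/s) * exp (- (1/s))"
      using eventually_nhds_in_open[of "{0<..}" t] 1
      by (auto elim!: eventually_mono simp: flat_def)
    ultimately show ?thesis using DERIV_cong_ev[OF refl _ refl] by fast
  next
    case 2
    have "\<forall>\<^sub>F s in nhds t. flat p s = 0"
      using eventually_nhds_in_open[of "{..<0}" t] 2
      by (auto elim!: eventually_mono simp: flat_def)
    moreover have "((\<lambda>s. 0) has_field_derivative flat (monom 1 2 * (p - pderiv p)) t) (at t)"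
      using 2 by (simp add: flat_def)
    ultimately show ?thesis using DERIV_cong_ev[OF refl _ refl] by fast
  next
    case 3
    have r: "((\<lambda>h. flat p h / h) \<longlongrightarrow> 0) (at_right 0)"
    proof -
      \<comment> \<open>For h > 0 the quotient \<open>flat p h / h\<close> is s p(s) exp(-s) with s
        = 1/h, and s p(s) is \<open>pCons 0 p\<close>.\<close>
      have "((\<lambda>h. poly (pCons 0 p) (inverse h) * exp (- inverse h)) \<longlongrightarrow> 0) (at_right (0::real))"
        by (rule filterlim_compose[OF poly_exp_limit filterlim_inverse_at_top_right])
      then show ?thesis
        by (rule Lim_transform_eventually)
          (auto simp: eventually_at_filter flat_def field_simps)
    qed
    have l: "((\<lambda>h. flat p h / h) \<longlongrightarrow> 0) (at_left 0)"
      by (rule Lim_transform_eventually[OF tendsto_const]) (auto simp: eventually_at_filter flat_def)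
    show ?thesis
      using r l filterlim_split_at[of "\<lambda>h. flat p h / h" "nhds 0" 0] 3
      by (auto simp: DERIV_def flat_def)
  qed
qed

lemma Ck_on_flat: "Ck_on k UNIV (flat p)"
proof (induction k arbitrary: p)
  case 0
  then show ?case
    by (auto intro!: continuous_at_imp_continuous_on DERIV_isCont[OF flat_has_derivative])
next
  case (Suc k)
  show ?case
  proof (rule Ck_on_SucI)
    show "(flat p has_derivative (\<lambda>v. flat (monom 1 2 * (p - pderiv p)) x * v)) (at x)" for x
      using flat_has_derivative has_field_derivative_def by blast
    show "Ck_on k UNIV (\<lambda>x. flat (monom 1 2 * (p - pderiv p)) x * v)" for v
      by (rule Ck_on_bounded_linear[OF _ bounded_linear_mult_left Suc]) simp
  qed simp
qed

section \<open>Bumps supported on boxes\<close>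

definition smooth_step :: "real \<Rightarrow> real" where "smooth_step = flat 1"

lemma smooth_step_eq: "smooth_step t = (if t > 0 then exp (- (1/t)) else 0)"
  by (simp add: smooth_step_def flat_def)

lemma smooth_step_bounds: "0 \<le> smooth_step t" "smooth_step t \<le> 1"
  by (auto simp: smooth_step_eq)

text \<open>The parameter \<open>n\<close> sharpens the bump: for every n > 0 it is positive exactly
  on the open box, and it tends to the indicator of the box as n grows, because
  \<open>smooth_step\<close> tends to 1 only at infinity.\<close>

definition box_bump :: "real \<Rightarrow> real^3 \<Rightarrow> real^3 \<Rightarrow> real^3 \<Rightarrow> real" where
  "box_bump n a b x = (\<Prod>i\<in>UNIV. smooth_step (n * (x $ i - a $ i)) * smooth_step (n * (b $ i - x $ i)))"

lemma Ck_on_prod: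
  assumes "open S" "finite I" "\<And>i. i \<in> I \<Longrightarrow> Ck_on k S (f i :: _ \<Rightarrow> real)"
  shows "Ck_on k S (\<lambda>x. \<Prod>i\<in>I. f i x)"
  using assms(2,3)
  by (induction I) (auto intro!: Ck_on_const[OF assms(1)] Ck_on_bilinear[OF assms(1) bounded_bilinear_mult])

lemma Ck_on_box_bump: "Ck_on k UNIV (box_bump n a b)"
  unfolding box_bump_def
proof (intro Ck_on_prod Ck_on_bilinear[OF _ bounded_bilinear_mult])
  fix i
  have "Ck_on k UNIV (\<lambda>x::real^3. smooth_step (n * x $ i + (- n * a $ i)))"
    unfolding smooth_step_def
    by (rule Ck_on_compose_affine[OF _ Ck_on_flat])
       (intro bounded_linear_const_mult bounded_linear_vec_nth)
  then show "Ck_on k UNIV (\<lambda>x::real^3. smooth_step (n * (x $ i - a $ i)))"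
    by (simp add: algebra_simps)
  have "Ck_on k UNIV (\<lambda>x::real^3. smooth_step (- n * x $ i + (n * b $ i)))"
    unfolding smooth_step_def
    by (rule Ck_on_compose_affine[OF _ Ck_on_flat])
       (intro bounded_linear_const_mult bounded_linear_vec_nth)
  then show "Ck_on k UNIV (\<lambda>x::real^3. smooth_step (n * (b $ i - x $ i)))"
    by (simp add: algebra_simps)
qed auto

lemma box_bump_bounds: "0 \<le> box_bump n a b x" "box_bump n a b x \<le> 1"
  unfolding box_bump_def
  by (auto intro!: prod_nonneg prod_le_1 mult_le_one smooth_step_bounds mult_nonneg_nonneg)

lemma box_bump_pos: "n > 0 \<Longrightarrow> box_bump n a b x > 0 \<longleftrightarrow> x \<in> box a b"
proof -
  assume n: "n > 0"
  have "box_bump n a b x > 0 \<longleftrightarrow> (\<forall>i. smooth_step (n * (x $ i - a $ i)) * smooth_step (n * (b $ i - x $ i)) \<noteq> 0)"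
    using box_bump_bounds(1)[of n a b x] by (auto simp: box_bump_def less_le)
  also have "\<dots> \<longleftrightarrow> x \<in> box a b"
    using n by (auto simp: smooth_step_eq mem_box_cart zero_less_mult_iff)
  finally show ?thesis .
qed

lemma box_bump_eq_0: "n > 0 \<Longrightarrow> x \<notin> box a b \<Longrightarrow> box_bump n a b x = 0"
  using box_bump_pos[of n a b x] box_bump_bounds(1)[of n a b x] by linarith

lemma box_bump_tendsto: "(\<lambda>n. box_bump (real (Suc n)) a b x) \<longlonglongrightarrow> indicator (box a b) x"
proof (cases "x \<in> box a b")
  case False
  then show ?thesis by (simp add: box_bump_eq_0)
next
  case True
  have *: "(\<lambda>n. smooth_step (real (Suc n) * c)) \<longlonglongrightarrow> 1" if "c > 0" for c
  proof -
    have "(\<lambda>n. exp (- (inverse (real (Suc n)) * (1/c)))) \<longlonglongrightarrow> exp (- (0 * (1/c)))"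
      by (intro tendsto_intros LIMSEQ_inverse_real_of_nat)
    moreover have "exp (- (inverse (real (Suc n)) * (1/c))) = smooth_step (real (Suc n) * c)" for n
      using that by (simp add: smooth_step_eq divide_inverse del: of_nat_Suc)
    ultimately show ?thesis by simp
  qed
  have "(\<lambda>n. box_bump (real (Suc n)) a b x) \<longlonglongrightarrow> (\<Prod>i\<in>(UNIV::3 set). 1 * 1)"
    unfolding box_bump_def using True
    by (intro tendsto_prod tendsto_mult *) (auto simp: mem_box_cart)
  then show ?thesis using True by simp
qed

section \<open>Hermitian forms and square integrable functions\<close>

lemma complex_quadratic_discriminant:
  fixes w :: complex
  assumes "\<And>c. 0 \<le> P + 2 * Re (cnj c * w) + (cmod c)\<^sup>2 * Q" and "0 \<le> Q"
  shows "(cmod w)\<^sup>2 \<le> P * Q"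
proof -
  \<comment> \<open>Taking c = - t w aligns the phases, so that a real quadratic polynomial in t
    remains.\<close>
  have *: "0 \<le> P - 2 * t * (cmod w)\<^sup>2 + t\<^sup>2 * (cmod w)\<^sup>2 * Q" for t :: real
  proof -
    have "Re (cnj (- (of_real t * w)) * w) = - t * (cmod w)\<^sup>2"
      unfolding cmod_power2 by (simp add: power2_eq_square algebra_simps)
    then show ?thesis
      using assms(1)[of "- (of_real t * w)"] by (simp add: norm_mult power_mult_distrib)
  qed
  show ?thesis
  proof (cases "Q = 0")
    case True
    then show ?thesis
      \<comment> \<open>With Q = 0 the polynomial is affine in t; this t gives it the value -1
        unless w = 0.\<close>
      using *[of "(P + 1) / (2 * (cmod w)\<^sup>2)"] by (cases "w = 0") auto
  next
    case False
    then show ?thesis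
      using *[of "1 / Q"] assms(2) by (simp add: field_simps power2_eq_square)
  qed
qed

text \<open>A positive Hermitian form on a set closed under \<open>u + c v\<close>, written \<open>comb c u v\<close>. No vector
  space axioms are needed, since only the values of the form matter.\<close>

locale hermitian_form =
  fixes V :: "'v set" and comb :: "complex \<Rightarrow> 'v \<Rightarrow> 'v \<Rightarrow> 'v" and a :: "'v \<Rightarrow> 'v \<Rightarrow> complex"
  assumes comb_closed: "u \<in> V \<Longrightarrow> v \<in> V \<Longrightarrow> comb c u v \<in> V"
    and form_comb: "u \<in> V \<Longrightarrow> v \<in> V \<Longrightarrow> w \<in> V \<Longrightarrow> a (comb c u v) w = a u w + c * a v w"
    and hermitian: "u \<in> V \<Longrightarrow> v \<in> V \<Longrightarrow> a u v = cnj (a v u)"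
    and nonneg: "u \<in> V \<Longrightarrow> 0 \<le> Re (a u u)"
begin

definition sq :: "'v \<Rightarrow> real" where "sq u = Re (a u u)"

definition gap :: "'v \<Rightarrow> 'v \<Rightarrow> real" where "gap u v = sqrt (sq (comb (-1) u v))"

lemma form_comb_right:
  assumes "u \<in> V" "v \<in> V" "w \<in> V"
  shows "a u (comb c v w) = a u v + cnj c * a u w"
  using assms hermitian[of u "comb c v w"] hermitian[of v u] hermitian[of w u]
  by (simp add: comb_closed form_comb)

lemma form_self: "u \<in> V \<Longrightarrow> a u u = of_real (sq u)"
  using hermitian[of u u] by (simp add: sq_def complex_eq_iff)

lemma sq_comb:
  assumes "u \<in> V" "v \<in> V"
  shows "sq (comb c u v) = sq u + 2 * Re (cnj c * a u v) + (cmod c)\<^sup>2 * sq v"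
proof -
  have "a (comb c u v) (comb c u v) = a u u + cnj c * a u v + c * cnj (a u v) + c * cnj c * a v v"
    using assms hermitian[of v u] by (simp add: comb_closed form_comb form_comb_right algebra_simps)
  moreover have "c * cnj c * a v v = of_real ((cmod c)\<^sup>2 * sq v)"
    using form_self[OF assms(2)] by (simp add: complex_norm_square[symmetric])
  ultimately show ?thesis unfolding sq_def by (simp add: sq_def[symmetric])
qed

lemma sq_diff:
  assumes "u \<in> V" "v \<in> V"
  shows "sq (comb (-1) u v) = sq u - 2 * Re (a u v) + sq v"
  using sq_comb[OF assms, of "-1"] by simp

lemma sq_nonneg: "u \<in> V \<Longrightarrow> 0 \<le> sq u"
  using nonneg by (simp add: sq_def)

lemma cauchy_schwarz:
  assumes "u \<in> V" "v \<in> V"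
  shows "(cmod (a u v))\<^sup>2 \<le> sq u * sq v"
  using complex_quadratic_discriminant[of "sq u" "a u v" "sq v"] assms
    sq_comb[OF assms] sq_nonneg[OF comb_closed[OF assms]] sq_nonneg by metis

lemma cauchy_schwarz_sqrt:
  assumes "u \<in> V" "v \<in> V"
  shows "cmod (a u v) \<le> sqrt (sq u) * sqrt (sq v)"
  using real_le_rsqrt[OF cauchy_schwarz[OF assms]] by (simp add: real_sqrt_mult)

lemma gap_triangle:
  assumes "u \<in> V" "v \<in> V" "w \<in> V"
  shows "gap u w \<le> gap u v + gap v w"
proof -
  let ?p = "comb (-1) u v" and ?q = "comb (-1) v w"
  have pq: "?p \<in> V" "?q \<in> V" using assms comb_closed by auto
  have "a ?p ?q = a u v - a u w - a v v + a v w"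
    using assms pq by (simp add: form_comb form_comb_right)
  \<comment> \<open>Without vector space axioms \<open>comb (-1) u w\<close> need not be the sum of
    \<open>?p\<close> and \<open>?q\<close>; the values of the form nevertheless expand as if it
    were.\<close>
  then have "sq (comb (-1) u w) = sq ?p + 2 * Re (a ?p ?q) + sq ?q"
    using assms by (simp add: sq_diff form_self)
  also have "\<dots> \<le> sq ?p + 2 * (sqrt (sq ?p) * sqrt (sq ?q)) + sq ?q"
    using cauchy_schwarz_sqrt[OF pq] complex_Re_le_cmod[of "a ?p ?q"] by linarith
  also have "\<dots> = (gap u v + gap v w)\<^sup>2"
    using sq_nonneg pq by (simp add: gap_def power2_sum)
  finally show ?thesis
    unfolding gap_def[of u w]
    using sq_nonneg pq by (intro real_le_lsqrt) (auto simp: gap_def)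
qed

lemma gap_commute: "u \<in> V \<Longrightarrow> v \<in> V \<Longrightarrow> gap u v = gap v u"
  using hermitian[of u v] by (simp add: gap_def sq_diff)

lemma gap_nonneg: "u \<in> V \<Longrightarrow> v \<in> V \<Longrightarrow> 0 \<le> gap u v"
  using sq_nonneg comb_closed by (simp add: gap_def)

text \<open>Cauchy-Schwarz makes the form continuous in its first slot with respect to the
  semimetric \<open>gap\<close>.\<close>

lemma form_tendsto:
  assumes "\<And>n. X n \<in> V" "u \<in> V" "v \<in> V" "(\<lambda>n. gap (X n) u) \<longlonglongrightarrow> 0"
  shows "(\<lambda>n. a (X n) v) \<longlonglongrightarrow> a u v"
proof -
  have "(\<lambda>n. gap (X n) u * sqrt (sq v)) \<longlonglongrightarrow> 0 * sqrt (sq v)"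
    by (intro tendsto_intros assms)
  moreover have "norm (a (X n) v - a u v) \<le> gap (X n) u * sqrt (sq v)" for n
    using cauchy_schwarz_sqrt[of "comb (-1) (X n) u" v] assms comb_closed
    by (simp add: form_comb gap_def)
  ultimately have "(\<lambda>n. a (X n) v - a u v) \<longlonglongrightarrow> 0"
    using Lim_null_comparison by (metis (no_types, lifting) always_eventually mult_zero_left)
  then show ?thesis using Lim_null by blast
qed

end

locale complete_form = hermitian_form +
  assumes nonempty: "V \<noteq> {}"
    and complete: "(\<And>n::nat. X n \<in> V) \<Longrightarrow> (\<And>e. e > 0 \<Longrightarrow> \<exists>N. \<forall>m\<ge>N. \<forall>n\<ge>N. gap (X m) (X n) < e)
      \<Longrightarrow> \<exists>u\<in>V. (\<lambda>n. gap (X n) u) \<longlonglongrightarrow> 0"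
begin

text \<open>Direct method: J u = a u u - 2 Re (l u) is bounded below, the parallelogram identity
  makes minimizing sequences Cauchy, and the vanishing first variation at the limit is the claimed
  identity. The functional is antilinear, to match the second slot of the form.\<close>

lemma riesz:
  assumes l: "\<And>c u v. u \<in> V \<Longrightarrow> v \<in> V \<Longrightarrow> l (comb c u v) = l u + cnj c * l v"
    and K: "\<And>v. v \<in> V \<Longrightarrow> cmod (l v) \<le> K * sqrt (sq v)"
  shows "\<exists>u\<in>V. \<forall>v\<in>V. a u v = l v"
proof -
  define J where "J u = sq u - 2 * Re (l u)" for u
  have J_ge: "J u \<ge> - K\<^sup>2" if "u \<in> V" for u
  proof -
    have "J u \<ge> (sqrt (sq u))\<^sup>2 - 2 * (K * sqrt (sq u))"
      using K[OF that] complex_Re_le_cmod[of "l u"] sq_nonneg[OF that] by (simp add: J_def)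
    also have "(sqrt (sq u))\<^sup>2 - 2 * (K * sqrt (sq u)) = (sqrt (sq u) - K)\<^sup>2 - K\<^sup>2"
      by (simp add: power2_diff)
    finally show ?thesis by (smt (verit) zero_le_power2)
  qed
  define m where "m = Inf (J ` V)"
  have bdd: "bdd_below (J ` V)" using J_ge by (meson bdd_belowI2)
  have m_le: "m \<le> J u" if "u \<in> V" for u
    unfolding m_def using bdd that by (simp add: cInf_lower)
  have "\<exists>u\<in>V. J u < m + 1 / real (Suc n)" for n
  proof -
    have "Inf (J ` V) < m + 1 / real (Suc n)" by (simp add: m_def)
    then show ?thesis using cInf_less_iff[of "J ` V"] bdd nonempty by auto
  qed
  then obtain X where X: "\<And>n. X n \<in> V" "\<And>n. J (X n) < m + 1 / real (Suc n)" by metis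
  \<comment> \<open>Parallelogram identity at the midpoint, written as u + (v - u)/2: the midpoint
    costs at least \<open>m\<close>, so two near minimizers are close to each other.\<close>
  have gap_le: "sq (comb (-1) u v) \<le> 2 * ((J u - m) + (J v - m))" if uv: "u \<in> V" "v \<in> V" for u v
  proof -
    define d where "d = comb (-1) v u"
    have d: "d \<in> V" using uv comb_closed d_def by auto
    have "sq (comb (1/2) u d) = sq u + Re (a u d) + sq d / 4"
      using sq_comb[OF uv(1) d, of "1/2"] by (simp add: power2_eq_square)
    moreover have "Re (a u d) = Re (a u v) - sq u"
      using uv by (simp add: d_def form_comb_right form_self)
    moreover have "sq d = sq v - 2 * Re (a u v) + sq u"
      using uv hermitian[of u v] by (simp add: d_def sq_diff)
    moreover have "Re (l (comb (1/2) u d)) = (Re (l u) + Re (l v)) / 2"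
      using arg_cong[OF l[OF uv(1) d, of "1/2"], of Re] arg_cong[OF l[OF uv(2,1), of "-1"], of Re]
      by (simp add: d_def[symmetric] field_simps)
    ultimately have "J (comb (1/2) u d) = (J u + J v) / 2 - sq d / 4"
      by (simp add: J_def field_simps)
    moreover have "sq (comb (-1) u v) = sq d"
      using uv hermitian[of u v] by (simp add: d_def sq_diff)
    ultimately show ?thesis
      using m_le[OF comb_closed[OF uv(1) d, of "1/2"]] by (simp add: field_simps)
  qed
  have "\<exists>N. \<forall>i\<ge>N. \<forall>j\<ge>N. gap (X i) (X j) < e" if "e > 0" for e
  proof -
    have "0 < e\<^sup>2 / 4" using that by simp
    from nat_approx_posE[OF this] obtain N where N: "1 / real (Suc N) < e\<^sup>2 / 4" by metis
    have *: "J (X i) - m < e\<^sup>2 / 4" if "i \<ge> N" for i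
    proof -
      have "1 / real (Suc i) \<le> 1 / real (Suc N)" using that by (simp add: frac_le)
      then show ?thesis using X(2)[of i] N by linarith
    qed
    have "gap (X i) (X j) < e" if "i \<ge> N" "j \<ge> N" for i j
      unfolding gap_def
      using gap_le[OF X(1) X(1), of i j] *[OF that(1)] *[OF that(2)] \<open>e > 0\<close>
      by (intro real_less_lsqrt) auto
    then show ?thesis by blast
  qed
  then have "\<exists>u\<in>V. (\<lambda>n. gap (X n) u) \<longlonglongrightarrow> 0" by (rule complete[OF X(1)])
  then obtain u where u: "u \<in> V" "(\<lambda>n. gap (X n) u) \<longlonglongrightarrow> 0" by (elim bexE)
  have "a u v = l v" if v: "v \<in> V" for v
  proof -
    \<comment> \<open>Along X n + c v the excess of J over \<open>m\<close> is a nonnegative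
      quadratic in the complex number c; its discriminant bounds the first variation by the distance
      to the infimum.\<close>
    have "(cmod (a (X n) v - l v))\<^sup>2 \<le> (J (X n) - m) * sq v" for n
    proof (rule complex_quadratic_discriminant)
      fix c
      show "0 \<le> J (X n) - m + 2 * Re (cnj c * (a (X n) v - l v)) + (cmod c)\<^sup>2 * sq v"
        using m_le[OF comb_closed[OF X(1) v, of c n]] sq_comb[OF X(1) v, of c n] l[OF X(1) v, of c n]
        by (simp add: J_def algebra_simps)
    qed (use sq_nonneg v in auto)
    then have "(cmod (a (X n) v - l v))\<^sup>2 \<le> 1 / real (Suc n) * sq v" for n
      using X(2)[of n] sq_nonneg[OF v] by (smt (verit) mult_right_mono)
    moreover have "(\<lambda>n. 1 / real (Suc n) * sq v) \<longlonglongrightarrow> 0 * sq v"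
      by (intro tendsto_intros LIMSEQ_Suc lim_1_over_n)
    moreover have "(\<lambda>n. (cmod (a (X n) v - l v))\<^sup>2) \<longlonglongrightarrow> (cmod (a u v - l v))\<^sup>2"
      by (intro tendsto_intros form_tendsto X u v)
    ultimately have "(cmod (a u v - l v))\<^sup>2 \<le> 0"
      using LIMSEQ_le by (metis (no_types, lifting) mult_zero_left)
    then show ?thesis by simp
  qed
  then show ?thesis using u(1) by blast
qed

text \<open>Banach's fixed point argument: F sends x to the Riesz representative of
  \<open>l x\<close> and contracts the gap with factor \<theta>; a fixed point solves the equation
  with the unknown on both sides. Equality of points is replaced by equality of all values of the
  form, since the gap is only a semimetric.\<close>

lemma riesz_perturbed:
  assumes l: "\<And>x c u v. x \<in> V \<Longrightarrow> u \<in> V \<Longrightarrow> v \<in> V \<Longrightarrow> l x (comb c u v) = l x u + cnj c * l x v"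
    and K: "\<And>x v. x \<in> V \<Longrightarrow> v \<in> V \<Longrightarrow> cmod (l x v) \<le> K x * sqrt (sq v)"
    and contr: "\<And>x y v. x \<in> V \<Longrightarrow> y \<in> V \<Longrightarrow> v \<in> V \<Longrightarrow> cmod (l x v - l y v) \<le> \<theta> * gap x y * sqrt (sq v)"
    and \<theta>: "0 \<le> \<theta>" "\<theta> < 1"
  shows "\<exists>u\<in>V. \<forall>v\<in>V. a u v = l u v"
proof -
  have "\<exists>u\<in>V. \<forall>v\<in>V. a u v = l x v" if "x \<in> V" for x
    using riesz[of "l x" "K x"] l K that by blast
  then obtain F where F: "\<And>x. x \<in> V \<Longrightarrow> F x \<in> V" "\<And>x v. x \<in> V \<Longrightarrow> v \<in> V \<Longrightarrow> a (F x) v = l x v"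
    by metis
  have F_gap: "gap (F x) (F y) \<le> \<theta> * gap x y" if xy: "x \<in> V" "y \<in> V" for x y
  proof -
    let ?d = "comb (-1) (F x) (F y)"
    have d: "?d \<in> V" using F xy comb_closed by auto
    have "sq ?d = Re (l x ?d - l y ?d)"
      using form_comb[OF F(1)[OF xy(1)] F(1)[OF xy(2)] d, of "-1"] F(2)[OF _ d] xy by (simp add: sq_def)
    also have "\<dots> \<le> \<theta> * gap x y * gap (F x) (F y)"
      using contr[OF xy d] complex_Re_le_cmod order_trans by (fastforce simp: gap_def)
    finally have "(gap (F x) (F y))\<^sup>2 \<le> \<theta> * gap x y * gap (F x) (F y)"
      using sq_nonneg[OF d] by (simp add: gap_def)
    then show ?thesis
      using gap_nonneg[OF F(1)[OF xy(1)] F(1)[OF xy(2)]] gap_nonneg[OF xy] \<theta>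
      by (cases "gap (F x) (F y) = 0") (simp_all add: power2_eq_square)
  qed
  obtain x0 where x0: "x0 \<in> V" using nonempty by blast
  define X where "X n = (F ^^ n) x0" for n
  have X: "X n \<in> V" for n by (induction n) (auto simp: X_def x0 F)
  have XS: "X (Suc n) = F (X n)" for n by (simp add: X_def)
  define D where "D = gap (X 0) (X 1)"
  have D: "0 \<le> D" using gap_nonneg X by (simp add: D_def)
  have step: "gap (X n) (X (Suc n)) \<le> \<theta> ^ n * D" for n
  proof (induction n)
    case (Suc n)
    then show ?case
      using F_gap[OF X X, of n "Suc n"] \<theta> XS mult_left_mono[OF Suc \<theta>(1)] by (simp add: mult.assoc)
  qed (simp add: D_def)
  have far: "gap (X n) (X (n + k)) \<le> \<theta> ^ n * (D / (1 - \<theta>))" for n k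
  proof -
    have "gap (X n) (X (n + k)) \<le> D * (\<Sum>i<k. \<theta> ^ (n + i))"
    proof (induction k)
      case 0
      then show ?case using X sq_diff[OF X X, of n n] by (simp add: gap_def form_self)
    next
      case (Suc k)
      then show ?case
        using gap_triangle[of "X n" "X (n + k)" "X (n + Suc k)"] X step[of "n + k"]
        by (simp add: algebra_simps)
    qed
    also have "\<dots> = \<theta> ^ n * (D * (\<Sum>i<k. \<theta> ^ i))"
      by (simp add: power_add sum_distrib_left mult_ac)
    also have "\<dots> \<le> \<theta> ^ n * (D * (1 / (1 - \<theta>)))"
      using D \<theta> geometric_sums[of \<theta>] sum_le_suminf[of "\<lambda>i. \<theta> ^ i" "{..<k}"]
      by (intro mult_left_mono) (auto simp: sums_iff)
    finally show ?thesis by simp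
  qed
  have lim: "(\<lambda>n. \<theta> ^ n * (D / (1 - \<theta>))) \<longlonglongrightarrow> 0"
    using tendsto_mult[OF LIMSEQ_power_zero[of \<theta>] tendsto_const[of "D / (1 - \<theta>)"]] \<theta> by simp
  have "\<exists>N. \<forall>i\<ge>N. \<forall>j\<ge>N. gap (X i) (X j) < e" if "e > 0" for e
  proof -
    obtain N where N: "\<And>n. n \<ge> N \<Longrightarrow> \<theta> ^ n * (D / (1 - \<theta>)) < e"
      using order_tendstoD(2)[OF lim \<open>e > 0\<close>] by (auto simp: eventually_sequentially)
    have *: "gap (X i) (X j) < e" if "i \<ge> N" "i \<le> j" for i j
      using far[of i "j - i"] N[of i] that by simp
    have "gap (X i) (X j) < e" if "i \<ge> N" "j \<ge> N" for i j
      using *[of i j] *[of j i] that gap_commute[OF X X, of i j] by (metis linorder_le_cases)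
    then show ?thesis by blast
  qed
  then have "\<exists>u\<in>V. (\<lambda>n. gap (X n) u) \<longlonglongrightarrow> 0" by (rule complete[OF X])
  then obtain u where u: "u \<in> V" "(\<lambda>n. gap (X n) u) \<longlonglongrightarrow> 0" by (elim bexE)
  \<comment> \<open>The iterates converge to F u as well as to u, so u and F u have the same form
    against every v.\<close>
  have uF: "(\<lambda>n. gap (X (Suc n)) (F u)) \<longlonglongrightarrow> 0"
  proof (rule tendsto_sandwich[OF _ _ tendsto_const])
    show "\<forall>\<^sub>F n in sequentially. 0 \<le> gap (X (Suc n)) (F u)"
      using gap_nonneg X F u by auto
    show "\<forall>\<^sub>F n in sequentially. gap (X (Suc n)) (F u) \<le> \<theta> * gap (X n) u"
      using F_gap X u XS by auto
    show "(\<lambda>n. \<theta> * gap (X n) u) \<longlonglongrightarrow> 0"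
      using tendsto_mult[OF tendsto_const u(2)] by simp
  qed
  have "a u v = l u v" if v: "v \<in> V" for v
  proof -
    have "(\<lambda>n. a (X (Suc n)) v) \<longlonglongrightarrow> a u v"
      using LIMSEQ_Suc[OF form_tendsto[OF X u(1) v u(2)]] .
    moreover have "(\<lambda>n. a (X (Suc n)) v) \<longlonglongrightarrow> a (F u) v"
      using form_tendsto[OF X F(1)[OF u(1)] v uF] .
    ultimately show ?thesis using LIMSEQ_unique F(2)[OF u(1) v] by metis
  qed
  then show ?thesis using u(1) by blast
qed

end

section \<open>Square integrable functions and their completeness\<close>

definition square_integrable :: "'a measure \<Rightarrow> ('a \<Rightarrow> complex) \<Rightarrow> bool" where
  "square_integrable M f \<longleftrightarrow> f \<in> borel_measurable M \<and> integrable M (\<lambda>x. (cmod (f x))\<^sup>2)"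

definition sqnorm :: "'a measure \<Rightarrow> ('a \<Rightarrow> complex) \<Rightarrow> real" where
  "sqnorm M f = (LINT x|M. (cmod (f x))\<^sup>2)"

definition inner2 :: "'a measure \<Rightarrow> ('a \<Rightarrow> complex) \<Rightarrow> ('a \<Rightarrow> complex) \<Rightarrow> complex" where
  "inner2 M f g = (LINT x|M. f x * cnj (g x))"

lemma square_integrable_measurable: "square_integrable M f \<Longrightarrow> f \<in> borel_measurable M"
  by (simp add: square_integrable_def)

lemma cmod_add_squared_le: "(cmod (a + b))\<^sup>2 \<le> 2 * (cmod a)\<^sup>2 + 2 * (cmod b)\<^sup>2"
  using norm_triangle_ineq[of a b] power_mono[OF norm_triangle_ineq norm_ge_zero, of a b 2]
    sum_squares_bound[of "cmod a" "cmod b"] by (simp add: power2_sum)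

lemma square_integrable_add:
  assumes "square_integrable M f" "square_integrable M g"
  shows "square_integrable M (\<lambda>x. f x + g x)"
proof -
  have [measurable]: "f \<in> borel_measurable M" "g \<in> borel_measurable M"
    using assms by (auto simp: square_integrable_def)
  have "integrable M (\<lambda>x. 2 * (cmod (f x))\<^sup>2 + 2 * (cmod (g x))\<^sup>2)"
    using assms by (auto simp: square_integrable_def)
  then have "integrable M (\<lambda>x. (cmod (f x + g x))\<^sup>2)"
    by (rule Bochner_Integration.integrable_bound) (auto intro!: AE_I2 cmod_add_squared_le simp: abs_le_iff)
  then show ?thesis by (simp add: square_integrable_def)
qed

lemma square_integrable_bounded_mult:
  assumes "square_integrable M f" "h \<in> borel_measurable M" "\<And>x. cmod (h x) \<le> B"
  shows "square_integrable M (\<lambda>x. h x * f x)"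
proof -
  have [measurable]: "f \<in> borel_measurable M" "h \<in> borel_measurable M"
    using assms by (auto simp: square_integrable_def)
  have "integrable M (\<lambda>x. B\<^sup>2 * (cmod (f x))\<^sup>2)"
    using assms by (auto simp: square_integrable_def)
  moreover have "(cmod (h x * f x))\<^sup>2 \<le> B\<^sup>2 * (cmod (f x))\<^sup>2" for x
    using power_mono[OF assms(3)[of x] norm_ge_zero, of 2]
    by (simp add: norm_mult power_mult_distrib mult_right_mono)
  ultimately have "integrable M (\<lambda>x. (cmod (h x * f x))\<^sup>2)"
    using Bochner_Integration.integrable_bound[of M "\<lambda>x. B\<^sup>2 * (cmod (f x))\<^sup>2" "\<lambda>x. (cmod (h x * f x))\<^sup>2"]
    by auto
  then show ?thesis by (simp add: square_integrable_def)
qed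

lemma square_integrable_cmult: "square_integrable M f \<Longrightarrow> square_integrable M (\<lambda>x. c * f x)"
  using square_integrable_bounded_mult[of M f "\<lambda>_. c" "cmod c"] by simp

lemma square_integrable_sum:
  "finite I \<Longrightarrow> (\<And>i. i \<in> I \<Longrightarrow> square_integrable M (f i)) \<Longrightarrow> square_integrable M (\<lambda>x. \<Sum>i\<in>I. f i x)"
  by (induction I rule: finite_induct) (auto intro: square_integrable_add simp: square_integrable_def[of M "\<lambda>x. 0"])

lemma square_integrable_mult:
  assumes "square_integrable M f" "square_integrable M g"
  shows "integrable M (\<lambda>x. f x * g x)"
proof -
  have [measurable]: "f \<in> borel_measurable M" "g \<in> borel_measurable M"
    using assms by (auto simp: square_integrable_def)
  have "integrable M (\<lambda>x. (cmod (f x))\<^sup>2 + (cmod (g x))\<^sup>2)"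
    using assms by (auto simp: square_integrable_def)
  then show ?thesis
  proof (rule Bochner_Integration.integrable_bound)
    have "cmod (f x * g x) \<le> (cmod (f x))\<^sup>2 + (cmod (g x))\<^sup>2" for x
      using sum_squares_bound[of "cmod (f x)" "cmod (g x)"]
        mult_nonneg_nonneg[OF norm_ge_zero[of "f x"] norm_ge_zero[of "g x"]]
      unfolding norm_mult by linarith
    then show "AE x in M. norm (f x * g x) \<le> norm ((cmod (f x))\<^sup>2 + (cmod (g x))\<^sup>2)"
      by (intro AE_I2) (metis abs_ge_self order_trans real_norm_def)
  qed auto
qed

lemma square_integrable_cnj: "square_integrable M f \<Longrightarrow> square_integrable M (\<lambda>x. cnj (f x))"
  by (auto simp: square_integrable_def intro: measurable_compose[OF _ borel_measurable_continuous_onI] continuous_intros)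

lemma integrable_inner2: "square_integrable M f \<Longrightarrow> square_integrable M g \<Longrightarrow> integrable M (\<lambda>x. f x * cnj (g x))"
  by (intro square_integrable_mult square_integrable_cnj)

lemma sqnorm_nonneg: "0 \<le> sqnorm M f"
  by (simp add: sqnorm_def)

lemma inner2_self: "inner2 M f f = of_real (sqnorm M f)"
  unfolding inner2_def sqnorm_def
  by (simp add: complex_norm_square[symmetric] flip: of_real_power integral_complex_of_real)

lemma inner2_hermitian: "inner2 M f g = cnj (inner2 M g f)"
  using Bochner_Integration.integral_cnj[of M "\<lambda>x. g x * cnj (f x)"] by (simp add: inner2_def mult.commute)

lemma inner2_add_cmult:
  assumes "square_integrable M f" "square_integrable M g" "square_integrable M h"
  shows "inner2 M (\<lambda>x. f x + c * g x) h = inner2 M f h + c * inner2 M g h"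
  using assms unfolding inner2_def
  by (simp add: distrib_right mult.assoc integrable_inner2 Bochner_Integration.integral_add)

interpretation L2_form: hermitian_form "{f. square_integrable M f}" "\<lambda>c f g x. f x + c * g x" "inner2 M" for M
  by unfold_locales
    (auto intro: square_integrable_add square_integrable_cmult inner2_add_cmult inner2_hermitian
      simp: inner2_self sqnorm_nonneg)

lemma L2_form_sq: "L2_form.sq M f = sqnorm M f"
  by (simp add: L2_form.sq_def inner2_self)

lemma inner2_cauchy_schwarz:
  assumes "square_integrable M f" "square_integrable M g"
  shows "cmod (inner2 M f g) \<le> sqrt (sqnorm M f) * sqrt (sqnorm M g)"
  using L2_form.cauchy_schwarz_sqrt[of f M g] assms by (simp add: L2_form_sq)

lemma inner2_tendsto:
  assumes "\<And>n. square_integrable M (X n)" "square_integrable M f" "square_integrable M g"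
    and "(\<lambda>n. sqnorm M (\<lambda>x. X n x - f x)) \<longlonglongrightarrow> 0"
  shows "(\<lambda>n. inner2 M (X n) g) \<longlonglongrightarrow> inner2 M f g"
  using L2_form.form_tendsto[of X M f g] tendsto_real_sqrt[OF assms(4)] assms(1-3)
  by (simp add: L2_form.gap_def L2_form_sq)

text \<open>Riesz-Fischer: a fast subsequence converges almost everywhere, and Fatou's lemma turns
  the Cauchy bound into convergence in norm to the pointwise limit.\<close>

lemma L2_complete:
  fixes X :: "nat \<Rightarrow> 'a \<Rightarrow> complex"
  assumes X: "\<And>n. square_integrable M (X n)"
    and cauchy: "\<And>e. e > 0 \<Longrightarrow> \<exists>N. \<forall>m\<ge>N. \<forall>n\<ge>N. sqnorm M (\<lambda>x. X m x - X n x) < e"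
  shows "\<exists>f. square_integrable M f \<and> (\<lambda>n. sqnorm M (\<lambda>x. X n x - f x)) \<longlonglongrightarrow> 0"
proof -
  have [measurable]: "X n \<in> borel_measurable M" for n
    using X square_integrable_measurable by auto
  have diff: "square_integrable M (\<lambda>x. X m x - X n x)" for m n
    using square_integrable_add[OF X[of m] square_integrable_cmult[OF X[of n], of "-1"]] by simp
  have nn: "(\<integral>\<^sup>+x. ennreal ((cmod (X m x - X n x))\<^sup>2) \<partial>M) = ennreal (sqnorm M (\<lambda>x. X m x - X n x))" for m n
    unfolding sqnorm_def using diff[of m n]
    by (intro nn_integral_eq_integral) (auto simp: square_integrable_def)
  obtain N where N: "\<And>k m n. m \<ge> N k \<Longrightarrow> n \<ge> N k \<Longrightarrow> sqnorm M (\<lambda>x. X m x - X n x) < (1/4) ^ k"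
    using cauchy[of "(1/4) ^ k" for k] by (metis zero_less_divide_1_iff zero_less_numeral zero_less_power)
  \<comment> \<open>The partial sums of N make \<open>r\<close> monotone and keep \<open>r k\<close>
    above \<open>N k\<close>; the summand k drives it to infinity.\<close>
  define r where "r k = (\<Sum>i\<le>k. N i) + k" for k
  have r_mono: "r k \<le> r (Suc k)" for k by (simp add: r_def)
  have r_ge: "r k \<ge> N k" "r k \<ge> k" for k by (auto simp: r_def sum.atMost_Suc_shift intro: trans_le_add1 member_le_sum)
  let ?d = "\<lambda>k x. cmod (X (r (Suc k)) x - X (r k) x)"
  have small: "sqnorm M (\<lambda>x. X (r (Suc k)) x - X (r k) x) < (1/4) ^ k" for k
    using N[of k "r (Suc k)" "r k"] r_ge r_mono order_trans by blast
  \<comment> \<open>The weight 2^k is still beaten by 4^(-k). Afterwards it turns summable squares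
    into absolute convergence through d \<le> 2^k d^2 + 2^(-k).\<close>
  have "(\<integral>\<^sup>+x. (\<Sum>k. ennreal (2 ^ k * (?d k x)\<^sup>2)) \<partial>M) = (\<Sum>k. \<integral>\<^sup>+x. ennreal (2 ^ k * (?d k x)\<^sup>2) \<partial>M)"
    by (rule nn_integral_suminf) measurable
  also have "\<dots> \<le> (\<Sum>k. ennreal ((1/2) ^ k))"
  proof (intro suminf_le allI)
    fix k
    have "(\<integral>\<^sup>+x. ennreal (2 ^ k * (?d k x)\<^sup>2) \<partial>M) = ennreal (2 ^ k) * ennreal (sqnorm M (\<lambda>x. X (r (Suc k)) x - X (r k) x))"
      by (subst nn[symmetric]) (simp add: ennreal_mult' nn_integral_cmult)
    also have "\<dots> \<le> ennreal (2 ^ k * (1/4) ^ k)"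
      using small[of k] by (simp add: ennreal_mult'[symmetric] ennreal_leI)
    finally show "(\<integral>\<^sup>+x. ennreal (2 ^ k * (?d k x)\<^sup>2) \<partial>M) \<le> ennreal ((1/2) ^ k)"
      by (simp add: power_mult_distrib[symmetric])
  qed auto
  also have "\<dots> < \<infinity>"
    using summable_geometric[of "1/2::real"] by (simp add: suminf_ennreal2)
  finally have "AE x in M. (\<Sum>k. ennreal (2 ^ k * (?d k x)\<^sup>2)) \<noteq> \<infinity>"
    by (intro nn_integral_PInf_AE) auto
  then have conv: "AE x in M. convergent (\<lambda>k. X (r k) x)"
  proof eventually_elim
    case (elim x)
    then have "summable (\<lambda>k. 2 ^ k * (?d k x)\<^sup>2)"
      by (intro summable_suminf_not_top) auto
    then have s: "summable (\<lambda>k. 2 ^ k * (?d k x)\<^sup>2 + (1/2) ^ k)"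
      by (intro summable_add summable_geometric) auto
    have "summable (\<lambda>k. X (r (Suc k)) x - X (r k) x)"
    proof (rule summable_norm_cancel, rule summable_comparison_test'[OF s])
      fix k :: nat
      have "?d k x \<le> 2 ^ k * (?d k x)\<^sup>2 + (1/2) ^ k"
      proof -
        have "0 \<le> 2 ^ k * (?d k x - (1/2) ^ k)\<^sup>2" by simp
        also have "\<dots> = 2 ^ k * (?d k x)\<^sup>2 - 2 * ?d k x + (1/2) ^ k"
          by (simp add: power2_diff algebra_simps power_one_over power2_eq_square)
        finally show ?thesis by (smt (verit) norm_ge_zero)
      qed
      then show "norm (norm (X (r (Suc k)) x - X (r k) x)) \<le> 2 ^ k * (?d k x)\<^sup>2 + (1/2) ^ k" by simp
    qed
    then have "convergent (\<lambda>n. (\<Sum>k<n. X (r (Suc k)) x - X (r k) x) + X (r 0) x)"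
      by (intro convergent_add) (auto simp: summable_iff_convergent convergent_const)
    then show ?case using sum_lessThan_telescope[of "\<lambda>k. X (r k) x"] by simp
  qed
  define f where "f x = lim (\<lambda>k. X (r k) x)" for x
  have [measurable]: "f \<in> borel_measurable M"
    unfolding f_def by (rule borel_measurable_lim_metric) simp
  have lim: "AE x in M. (\<lambda>k. X (r k) x) \<longlonglongrightarrow> f x"
    using conv by eventually_elim (simp add: f_def convergent_LIMSEQ_iff)
  \<comment> \<open>Fatou's lemma along the subsequence with \<open>m\<close> held fixed: a bound on
    all late differences passes to the limit \<open>f\<close>.\<close>
  have bound: "(\<integral>\<^sup>+x. ennreal ((cmod (X m x - f x))\<^sup>2) \<partial>M) \<le> ennreal e"
    if "\<And>n. n \<ge> K \<Longrightarrow> sqnorm M (\<lambda>x. X m x - X n x) \<le> e" for m e K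
  proof -
    have "(\<integral>\<^sup>+x. ennreal ((cmod (X m x - f x))\<^sup>2) \<partial>M)
        = (\<integral>\<^sup>+x. liminf (\<lambda>k. ennreal ((cmod (X m x - X (r k) x))\<^sup>2)) \<partial>M)"
    proof (rule nn_integral_cong_AE, use lim in eventually_elim)
      case (elim x)
      then have "(\<lambda>k. ennreal ((cmod (X m x - X (r k) x))\<^sup>2)) \<longlonglongrightarrow> ennreal ((cmod (X m x - f x))\<^sup>2)"
        by (intro tendsto_intros)
      then show ?case using lim_imp_Liminf by (metis sequentially_bot)
    qed
    also have "\<dots> \<le> liminf (\<lambda>k. \<integral>\<^sup>+x. ennreal ((cmod (X m x - X (r k) x))\<^sup>2) \<partial>M)"
      by (rule nn_integral_liminf) measurable
    also have "\<dots> \<le> ennreal e"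
    proof -
      have "\<forall>\<^sub>F k in sequentially. (\<integral>\<^sup>+x. ennreal ((cmod (X m x - X (r k) x))\<^sup>2) \<partial>M) \<le> ennreal e"
        unfolding nn using that r_ge(2) by (intro eventually_sequentiallyI[of K] ennreal_leI) (meson order_trans)
      then show ?thesis
        by (intro order_trans[OF Liminf_le_Limsup Limsup_bounded]) auto
    qed
    finally show ?thesis .
  qed
  have sqd: "square_integrable M (\<lambda>x. X (N 0) x - f x)"
  proof -
    have "(\<integral>\<^sup>+x. ennreal ((cmod (X (N 0) x - f x))\<^sup>2) \<partial>M) \<le> ennreal 1"
      using N[of 0 "N 0"] by (intro bound[of "N 0"]) (auto intro: less_imp_le)
    then show ?thesis
      unfolding square_integrable_def
      by (intro conjI integrableI_nonneg) (auto elim: le_less_trans simp: ennreal_1)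
  qed
  have f: "square_integrable M f"
    using square_integrable_add[OF X[of "N 0"] square_integrable_cmult[OF sqd, of "-1"]] by simp
  have fd: "square_integrable M (\<lambda>x. X n x - f x)" for n
    using square_integrable_add[OF X[of n] square_integrable_cmult[OF f, of "-1"]] by simp
  have "(\<lambda>n. sqnorm M (\<lambda>x. X n x - f x)) \<longlonglongrightarrow> 0"
  proof (rule LIMSEQ_I)
    fix e :: real assume e: "e > 0"
    obtain K where K: "\<And>m n. m \<ge> K \<Longrightarrow> n \<ge> K \<Longrightarrow> sqnorm M (\<lambda>x. X m x - X n x) < e / 2"
      using cauchy[of "e/2"] e by auto
    have "sqnorm M (\<lambda>x. X m x - f x) \<le> e / 2" if "m \<ge> K" for m
    proof -
      have "ennreal (sqnorm M (\<lambda>x. X m x - f x)) = (\<integral>\<^sup>+x. ennreal ((cmod (X m x - f x))\<^sup>2) \<partial>M)"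
        unfolding sqnorm_def using fd[of m]
        by (intro nn_integral_eq_integral[symmetric]) (auto simp: square_integrable_def)
      also have "\<dots> \<le> ennreal (e / 2)"
        using K[OF that] by (intro bound[of K]) (auto intro: less_imp_le)
      finally show ?thesis using e by simp
    qed
    then have "norm (sqnorm M (\<lambda>x. X n x - f x) - 0) < e" if "n \<ge> K" for n
      using e sqnorm_nonneg[of M "\<lambda>x. X n x - f x"] that by fastforce
    then show "\<exists>K. \<forall>n\<ge>K. norm (sqnorm M (\<lambda>x. X n x - f x) - 0) < e" by blast
  qed
  with f show ?thesis by blast
qed

section \<open>The fundamental lemma of the calculus of variations\<close>

text \<open>Boxes form an intersection-stable generator of the Borel sets, and the sets over which a
  Borel version of u integrates to zero form a Dynkin system. So every Borel set gets integral zero,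
  which forces u to vanish almost everywhere.\<close>

lemma AE_zero_if_box_integrals_zero_real:
  fixes u :: "'a::euclidean_space \<Rightarrow> real"
  assumes u: "integrable lebesgue u" and outside: "\<And>x. x \<notin> box c d \<Longrightarrow> u x = 0"
    and zero: "\<And>a b. (LINT x:box a b|lebesgue. u x) = 0"
  shows "AE x in lebesgue. u x = 0"
proof -
  obtain v where v[measurable]: "v \<in> borel_measurable lborel" and uv: "AE x in lborel. u x = v x"
    using completion_ex_borel_measurable_real[of u lborel] u by auto
  have uv': "AE x in lebesgue. u x = v x" using uv by (rule AE_completion)
  have "integrable lebesgue v"
    by (rule integrable_cong_AE_imp[OF u measurable_completion[OF v] uv'])
  then have int: "integrable lborel v" by (simp add: integrable_completion)
  have set_int: "set_integrable lborel A v" if "A \<in> sets borel" for A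
    using int that integrable_mult_indicator[of A lborel v] by (simp add: set_integrable_def)
  have box0: "(LINT x:box a b|lborel. v x) = 0" for a b
  proof -
    have "(LINT x:box a b|lebesgue. u x) = (LINT x:box a b|lebesgue. v x)"
      unfolding set_lebesgue_integral_def
    proof (rule integral_cong_AE)
      show "(\<lambda>x. indicat_real (box a b) x *\<^sub>R u x) \<in> borel_measurable lebesgue"
        using integrable_mult_indicator[of "box a b" lebesgue u] u by auto
      show "(\<lambda>x. indicat_real (box a b) x *\<^sub>R v x) \<in> borel_measurable lebesgue"
        by (rule measurable_completion) auto
      show "AE x in lebesgue. indicat_real (box a b) x *\<^sub>R u x = indicat_real (box a b) x *\<^sub>R v x"
        using uv' by eventually_elim simp
    qed
    then show ?thesis
      using zero[of a b] by (simp add: set_lebesgue_integral_def integral_completion)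
  qed
  \<comment> \<open>Complements in the Dynkin argument require the integral over the whole space;
    vanishing outside one box supplies it.\<close>
  have UNIV0: "(LINT x:UNIV|lborel. v x) = 0"
  proof -
    have "(LINT x:UNIV|lborel. v x) = (LINT x:box c d|lborel. v x)"
      unfolding set_lebesgue_integral_def
    proof (intro integral_cong_AE)
      show "AE x in lborel. indicator UNIV x *\<^sub>R v x = indicator (box c d) x *\<^sub>R v x"
        using uv by eventually_elim (use outside in \<open>auto simp: indicator_def\<close>)
    qed auto
    then show ?thesis using box0 by simp
  qed
  have "(LINT x:A|lborel. v x) = 0" if "A \<in> sets borel" for A
  proof -
    have "Int_stable (range (\<lambda>(a, b). box a b :: 'a set))"
      by (auto simp: Int_stable_def box_Int_box)
    moreover have "range (\<lambda>(a, b). box a b :: 'a set) \<subseteq> Pow UNIV" by simp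
    moreover have "A \<in> sigma_sets UNIV (range (\<lambda>(a, b). box a b :: 'a set))"
      using that borel_eq_box by (metis sets_measure_of subset_UNIV Pow_UNIV)
    ultimately show ?thesis
    proof (induction rule: sigma_sets_induct_disjoint)
      case (basic A)
      then show ?case using box0 by auto
    next
      case empty
      then show ?case by (simp add: set_lebesgue_integral_def)
    next
      case (compl A)
      then have [measurable]: "A \<in> sets borel" by (simp add: borel_eq_box)
      have "(LINT x:UNIV|lborel. v x) = (LINT x:A|lborel. v x) + (LINT x:UNIV - A|lborel. v x)"
        by (subst set_integral_Un[symmetric]) (auto intro: set_int)
      then show ?case using compl UNIV0 by simp
    next
      case (union A)
      then have A: "A i \<in> sets borel" for i by (auto simp: borel_eq_box)
      have "(LINT x:(\<Union>i. A i)|lborel. v x) = (\<Sum>i. (LINT x:(A i)|lborel. v x))"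
        using A union(1) by (intro lebesgue_integral_countable_add)
          (auto simp: disjoint_family_on_def intro: set_int)
      then show ?case using union by simp
    qed
  qed
  then have "AE x in lborel. v x = 0"
    by (intro density_unique_real[OF int]) auto
  then have "AE x in lebesgue. v x = 0" by (rule AE_completion)
  with uv' show ?thesis by eventually_elim simp
qed

lemma AE_zero_if_box_integrals_zero:
  fixes u :: "'a::euclidean_space \<Rightarrow> complex"
  assumes u: "integrable lebesgue u" and outside: "\<And>x. x \<notin> box c d \<Longrightarrow> u x = 0"
    and zero: "\<And>a b. (LINT x:box a b|lebesgue. u x) = 0"
  shows "AE x in lebesgue. u x = 0"
proof -
  have i: "integrable lebesgue (\<lambda>x. indicator (box a b) x *\<^sub>R u x)" for a b
    using u by (intro integrable_mult_indicator) auto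
  have "AE x in lebesgue. Re (u x) = 0"
  proof (rule AE_zero_if_box_integrals_zero_real[of _ c d])
    show "(LINT x:box a b|lebesgue. Re (u x)) = 0" for a b
      using arg_cong[OF zero[of a b], of Re] integral_Re[OF i[of a b]]
      by (simp add: set_lebesgue_integral_def)
  qed (use u outside in auto)
  moreover have "AE x in lebesgue. Im (u x) = 0"
  proof (rule AE_zero_if_box_integrals_zero_real[of _ c d])
    show "(LINT x:box a b|lebesgue. Im (u x)) = 0" for a b
      using arg_cong[OF zero[of a b], of Im] integral_Im[OF i[of a b]]
      by (simp add: set_lebesgue_integral_def)
  qed (use u outside in auto)
  ultimately show ?thesis by eventually_elim (simp add: complex_eq_iff)
qed

lemma L2_iff: "f \<in> L2 S \<longleftrightarrow> square_integrable (lebesgue_on S) f"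
  by (simp add: L2_def square_integrable_def)

lemma L2_norm_eq: "L2_norm S f = sqrt (sqnorm (lebesgue_on S) f)"
  by (simp add: L2_norm_def sqnorm_def)

lemma L2_inner_eq: "L2_inner S f g = inner2 (lebesgue_on S) f g"
  by (simp add: L2_inner_def inner2_def)

lemma square_integrable_continuous:
  fixes f :: "'a::euclidean_space \<Rightarrow> complex"
  assumes "continuous_on UNIV f" "compact K" "\<And>x. x \<notin> K \<Longrightarrow> f x = 0" "S \<in> sets lebesgue"
  shows "square_integrable (lebesgue_on S) f"
proof -
  have [measurable]: "f \<in> borel_measurable borel"
    by (rule borel_measurable_continuous_onI[OF assms(1)])
  obtain B where B: "\<And>x. x \<in> K \<Longrightarrow> cmod (f x) \<le> B"
    using compact_imp_bounded[OF compact_continuous_image[OF continuous_on_subset[OF assms(1)] assms(2)]]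
    by (auto simp: bounded_iff)
  have "integrable lborel (\<lambda>x. B\<^sup>2 * indicator K x :: real)"
    using assms(2) emeasure_compact_finite[of K]
    by (intro integrable_mult_right) (auto intro!: integrable_real_indicator borel_compact)
  moreover have "norm ((cmod (f x))\<^sup>2) \<le> norm (B\<^sup>2 * indicator K x :: real)" for x
    using B[of x] assms(3)[of x] by (cases "x \<in> K") (auto intro: power_mono)
  ultimately have "integrable lborel (\<lambda>x. (cmod (f x))\<^sup>2)"
    using Bochner_Integration.integrable_bound[of lborel "\<lambda>x. B\<^sup>2 * indicator K x :: real" "\<lambda>x. (cmod (f x))\<^sup>2"]
    by auto
  then have "integrable lebesgue (\<lambda>x. (cmod (f x))\<^sup>2)"
    by (simp add: integrable_completion)
  then have "integrable (lebesgue_on S) (\<lambda>x. (cmod (f x))\<^sup>2)"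
    using assms(4) integrable_mult_indicator[of S lebesgue "\<lambda>x. (cmod (f x))\<^sup>2"]
    by (simp add: integrable_restrict_space)
  moreover have "f \<in> borel_measurable (lebesgue_on S)"
    by (intro measurable_restrict_space1 measurable_completion) simp
  ultimately show ?thesis by (simp add: square_integrable_def)
qed

lemma smooth_on_imp_continuous: "smooth_on UNIV f \<Longrightarrow> continuous_on UNIV f"
  unfolding smooth_on_def by (metis Ck_on.simps(1))

lemma smooth_on_imp_differentiable: "smooth_on UNIV f \<Longrightarrow> f differentiable (at x)"
  unfolding smooth_on_def by (metis Ck_on.simps(2) UNIV_I)

lemma smooth_on_frechet: "smooth_on UNIV f \<Longrightarrow> smooth_on UNIV (\<lambda>x. frechet_derivative f (at x) v)"
  unfolding smooth_on_def by (metis Ck_on.simps(2))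

lemma smooth_on_partial: "smooth_on UNIV f \<Longrightarrow> smooth_on UNIV (partial j f)"
  unfolding partial_def by (rule smooth_on_frechet)

lemma partial_eq_0_outside:
  assumes "closed K" "\<And>x. x \<notin> K \<Longrightarrow> f x = 0" "x \<notin> K"
  shows "partial j f x = 0"
proof -
  have "(f has_derivative (\<lambda>_. 0)) (at x)"
    by (rule has_derivative_transform_within_open[of "\<lambda>_. 0" _ _ _ "-K"]) (use assms in auto)
  then show ?thesis unfolding partial_def using frechet_derivative_at by metis
qed

lemma partial_mult:
  fixes f g :: "real^3 \<Rightarrow> complex"
  assumes "f differentiable (at x)" "g differentiable (at x)"
  shows "partial j (\<lambda>x. f x * g x) x = f x * partial j g x + partial j f x * g x"
proof -
  have "((\<lambda>x. f x * g x) has_derivative (\<lambda>v. f x * frechet_derivative g (at x) v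
      + frechet_derivative f (at x) v * g x)) (at x)"
    using assms by (intro has_derivative_mult) (auto simp: frechet_derivative_works)
  from frechet_derivative_at[OF this, symmetric] show ?thesis unfolding partial_def by simp
qed

lemma smooth_on_mult:
  fixes f g :: "real^3 \<Rightarrow> complex"
  shows "smooth_on UNIV f \<Longrightarrow> smooth_on UNIV g \<Longrightarrow> smooth_on UNIV (\<lambda>x. f x * g x)"
  unfolding smooth_on_def by (intro allI Ck_on_bilinear[OF _ bounded_bilinear_mult]) auto

text \<open>The multiplier moves a test function from T to S: the product is supported in
  \<open>K \<inter> F\<close>, which lies in S even where T does not.\<close>

lemma test_functions_mult:
  assumes "\<phi> \<in> test_functions T" "smooth_on UNIV \<psi>" "closed F" "\<And>x. x \<notin> F \<Longrightarrow> \<psi> x = 0" "T \<inter> F \<subseteq> S"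
  shows "(\<lambda>x. \<psi> x * \<phi> x) \<in> test_functions S"
proof -
  obtain K where K: "compact K" "K \<subseteq> T" "\<And>x. x \<notin> K \<Longrightarrow> \<phi> x = 0" and s: "smooth_on UNIV \<phi>"
    using assms(1) by (auto simp: test_functions_def)
  have "compact (K \<inter> F)" "K \<inter> F \<subseteq> S" "\<And>x. x \<notin> K \<inter> F \<Longrightarrow> \<psi> x * \<phi> x = 0"
    using K assms(3-5) compact_Int_closed by auto
  then show ?thesis using smooth_on_mult[OF assms(2) s] by (auto simp: test_functions_def)
qed

lemma smooth_box_bump: "smooth_on UNIV (\<lambda>x. complex_of_real (box_bump n a b x))"
  unfolding smooth_on_def
  by (auto intro!: Ck_on_bounded_linear[OF _ bounded_linear_of_real Ck_on_box_bump])

lemma box_bump_test_function: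
  assumes "n > 0" "cbox a b \<subseteq> S"
  shows "(\<lambda>x. complex_of_real (box_bump n a b x)) \<in> test_functions S"
proof -
  have "box_bump n a b x = 0" if "x \<notin> cbox a b" for x
    using that box_subset_cbox[of a b] assms(1) by (intro box_bump_eq_0) auto
  then show ?thesis
    using assms smooth_box_bump by (auto simp: test_functions_def intro!: exI[of _ "cbox a b"])
qed

text \<open>Bumps converge boundedly to the indicator of a box, so h integrates to zero over every
  open box whose closed box lies in S. A countable cover of S by closed boxes then gives the claim
  from the case of a single box.\<close>

lemma fundamental_lemma:
  assumes S: "open S" and h: "square_integrable (lebesgue_on S) h"
    and zero: "\<And>\<phi>. \<phi> \<in> test_functions S \<Longrightarrow> (LINT x|lebesgue_on S. h x * \<phi> x) = 0"
  shows "AE x in lebesgue_on S. h x = 0"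
proof -
  have SL: "S \<in> sets lebesgue" using S by (simp add: lmeasurable_iff_integrable)
  have [measurable]: "h \<in> borel_measurable (lebesgue_on S)" using h by (rule square_integrable_measurable)
  have bump_meas[measurable]: "(\<lambda>x. complex_of_real (box_bump n a b x)) \<in> borel_measurable (lebesgue_on S)" for n a b
    by (intro measurable_restrict_space1 measurable_completion)
       (simp add: borel_measurable_continuous_onI[OF smooth_on_imp_continuous[OF smooth_box_bump]])
  have ind_meas[measurable]: "(\<lambda>x. complex_of_real (indicator (box a b) x)) \<in> borel_measurable (lebesgue_on S)" for a b
    by (intro measurable_restrict_space1 measurable_completion) simp
  \<comment> \<open>On a bounded box square integrability implies integrability; this yields the
    majorant for the dominated convergence below.\<close>
  have hint: "integrable (lebesgue_on S) (\<lambda>x. h x * complex_of_real (indicator (cbox a b) x))" for a b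
  proof (rule square_integrable_mult[OF h])
    have "integrable lebesgue (\<lambda>x. indicator (cbox a b) x :: real)"
      by (subst integrable_completion) (auto intro!: integrable_real_indicator simp: emeasure_lborel_cbox_eq)
    then have "integrable (lebesgue_on S) (\<lambda>x. indicator (cbox a b) x :: real)"
      using SL integrable_mult_indicator[of S lebesgue "indicator (cbox a b) :: _ \<Rightarrow> real"]
      by (simp add: integrable_restrict_space)
    moreover have "(cmod (complex_of_real (indicator (cbox a b) x)))\<^sup>2 = indicator (cbox a b) x" for x
      by (simp add: indicator_def)
    moreover have "(\<lambda>x. complex_of_real (indicator (cbox a b) x)) \<in> borel_measurable (lebesgue_on S)"
      by (intro measurable_restrict_space1 measurable_completion) simp
    ultimately show "square_integrable (lebesgue_on S) (\<lambda>x. complex_of_real (indicator (cbox a b) x))"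
      by (simp add: square_integrable_def)
  qed
  have box0: "(LINT x|lebesgue_on S. h x * complex_of_real (indicator (box a b) x)) = 0"
    if ab: "cbox a b \<subseteq> S" for a b
  proof -
    have "(\<lambda>n. LINT x|lebesgue_on S. h x * complex_of_real (box_bump (real (Suc n)) a b x))
        \<longlonglongrightarrow> (LINT x|lebesgue_on S. h x * complex_of_real (indicator (box a b) x))"
    proof (rule integral_dominated_convergence[where w = "\<lambda>x. cmod (h x * complex_of_real (indicator (cbox a b) x))"])
      show "AE x in lebesgue_on S. (\<lambda>n. h x * complex_of_real (box_bump (real (Suc n)) a b x))
          \<longlonglongrightarrow> h x * complex_of_real (indicator (box a b) x)"
        by (intro AE_I2 tendsto_intros box_bump_tendsto)
      show "AE x in lebesgue_on S. norm (h x * complex_of_real (box_bump (real (Suc n)) a b x))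
          \<le> cmod (h x * complex_of_real (indicator (cbox a b) x))" for n
      proof (rule AE_I2)
        fix x
        show "norm (h x * complex_of_real (box_bump (real (Suc n)) a b x))
          \<le> cmod (h x * complex_of_real (indicator (cbox a b) x))"
          using box_bump_bounds[of "real (Suc n)" a b x] box_bump_eq_0[of "real (Suc n)" x a b]
            box_subset_cbox[of a b]
          by (cases "x \<in> cbox a b") (auto simp: norm_mult mult_left_le subset_eq simp del: of_nat_Suc)
      qed
    qed (use hint in \<open>auto simp del: of_nat_Suc\<close>)
    moreover have "(LINT x|lebesgue_on S. h x * complex_of_real (box_bump (real (Suc n)) a b x)) = 0" for n
      by (rule zero[OF box_bump_test_function[OF _ ab]]) simp
    ultimately show ?thesis by (simp only: LIMSEQ_const_iff)
  qed
  have onbox: "AE x in lebesgue. x \<in> cbox c d \<longrightarrow> h x = 0" if cd: "cbox c d \<subseteq> S" for c d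
  proof -
    let ?u = "\<lambda>x. indicator S x *\<^sub>R (h x * complex_of_real (indicator (box c d) x))"
    have "AE x in lebesgue. ?u x = 0"
    proof (rule AE_zero_if_box_integrals_zero)
      have "integrable (lebesgue_on S) (\<lambda>x. complex_of_real (indicator (box c d) x) * (h x * complex_of_real (indicator (cbox c d) x)))"
        by (rule Bochner_Integration.integrable_bound[OF hint[of c d]
              borel_measurable_times[OF ind_meas borel_measurable_integrable[OF hint]]])
          (auto simp: indicator_def)
      moreover have "complex_of_real (indicator (box c d) x) * (h x * complex_of_real (indicator (cbox c d) x))
          = h x * complex_of_real (indicator (box c d) x)" for x
        using box_subset_cbox[of c d] by (auto simp: indicator_def)
      ultimately have "integrable (lebesgue_on S) (\<lambda>x. h x * complex_of_real (indicator (box c d) x))"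
        by simp
      then show "integrable lebesgue ?u" using SL by (simp add: integrable_restrict_space)
      show "?u x = 0" if "x \<notin> box c d" for x using that by simp
      fix a b
      obtain a' b' where ab': "box a b \<inter> box c d = box a' b'"
        by (rule that[OF box_Int_box])
      show "(LINT x:box a b|lebesgue. ?u x) = 0"
      proof (cases "box a' b' = {}")
        case True
        then have z: "indicator (box a b) x *\<^sub>R ?u x = 0" for x
          using ab' by (auto simp: indicator_def)
        show ?thesis unfolding set_lebesgue_integral_def z by simp
      next
        case False
        then have "cbox a' b' = closure (box a' b')" by (simp add: closure_box)
        also have "\<dots> \<subseteq> closure (box c d)" using ab' by (intro closure_mono) auto
        also have "\<dots> \<subseteq> cbox c d" by (rule closure_minimal[OF box_subset_cbox closed_cbox])
        finally have "cbox a' b' \<subseteq> S" using cd by blast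
        note box0[OF this]
        moreover have "indicator (box a b) x *\<^sub>R ?u x = indicator S x *\<^sub>R (h x * complex_of_real (indicator (box a' b') x))" for x
          using ab' by (auto simp: indicator_def)
        ultimately show ?thesis
          using SL by (simp add: set_lebesgue_integral_def integral_restrict_space)
      qed
    qed
    \<comment> \<open>The previous conclusion sees only the open box; its boundary is a null
      set.\<close>
    moreover have "AE x in lebesgue. x \<notin> cbox c d - box c d"
      using negligible_frontier_interval[of c d] by (intro AE_not_in) (simp add: negligible_iff_null_sets)
    ultimately show ?thesis
      by eventually_elim (use cd in \<open>auto simp: indicator_def split: if_splits\<close>)
  qed
  obtain \<D> where D: "countable \<D>" "\<D> \<subseteq> Pow S" "\<And>X. X \<in> \<D> \<Longrightarrow> \<exists>a b. X = cbox a b" "\<Union>\<D> = S"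
    using open_countable_Union_open_cbox[OF S] by metis
  have "AE x in lebesgue. \<forall>X\<in>\<D>. x \<in> X \<longrightarrow> h x = 0"
  proof (rule AE_ball_countable')
    fix X assume "X \<in> \<D>"
    then show "AE x in lebesgue. x \<in> X \<longrightarrow> h x = 0" using D(3)[of X] D(2) onbox by blast
  qed (rule D(1))
  then have "AE x in lebesgue. x \<in> S \<longrightarrow> h x = 0"
    by eventually_elim (use D(4) in auto)
  then show ?thesis using SL by (simp add: AE_restrict_space_iff)
qed

section \<open>Integration by parts for compactly supported functions\<close>

lemma has_vector_derivative_quotient:
  assumes "(f has_vector_derivative D) (at 0)"
  shows "((\<lambda>t. (f t - f 0) /\<^sub>R t) \<longlongrightarrow> D) (at 0)"
proof (rule LIM_zero_cancel, rule tendsto_norm_zero_cancel)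
  have "((\<lambda>t. norm (f t - f 0 - (t - 0) *\<^sub>R D) / norm (t - 0)) \<longlongrightarrow> 0) (at 0)"
    using assms unfolding has_vector_derivative_def has_derivative_iff_norm by blast
  then show "((\<lambda>t. norm ((f t - f 0) /\<^sub>R t - D)) \<longlongrightarrow> 0) (at 0)"
  proof (rule Lim_transform_eventually)
    have "norm (f t - f 0 - (t - 0) *\<^sub>R D) / norm (t - 0) = norm ((f t - f 0) /\<^sub>R t - D)" if "t \<noteq> 0" for t
    proof -
      have "(f t - f 0) /\<^sub>R t - D = (f t - f 0 - t *\<^sub>R D) /\<^sub>R t"
        using that by (simp add: scaleR_diff_right)
      then show ?thesis by (simp add: divide_inverse_commute)
    qed
    then show "\<forall>\<^sub>F t in at 0. norm (f t - f 0 - (t - 0) *\<^sub>R D) / norm (t - 0) = norm ((f t - f 0) /\<^sub>R t - D)"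
      by (simp add: eventually_at_filter)
  qed
qed

text \<open>Difference quotients of a compactly supported function have integral zero by translation
  invariance, and they converge dominatedly to the partial derivative.\<close>

lemma integral_partial_eq_0:
  assumes "\<phi> \<in> test_functions S"
  shows "integral\<^sup>L lborel (partial j \<phi>) = 0"
proof -
  obtain K where K: "compact K" "\<And>x. x \<notin> K \<Longrightarrow> \<phi> x = 0" and s: "smooth_on UNIV \<phi>"
    using assms by (auto simp: test_functions_def)
  have cont: "continuous_on UNIV \<phi>" "continuous_on UNIV (partial j \<phi>)"
    using s smooth_on_partial smooth_on_imp_continuous by auto
  have [measurable]: "\<phi> \<in> borel_measurable borel" "partial j \<phi> \<in> borel_measurable borel"
    using cont borel_measurable_continuous_onI by auto
  let ?e = "axis j 1 :: real^3"
  obtain R where R: "K \<subseteq> ball 0 R" using bounded_subset_ballD[OF compact_imp_bounded[OF K(1)]] by blast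
  have out: "partial j \<phi> x = 0" if "x \<notin> K" for x
    using partial_eq_0_outside[OF compact_imp_closed[OF K(1)] K(2) that] .
  obtain B where B0: "\<And>x. x \<in> K \<Longrightarrow> cmod (partial j \<phi> x) \<le> B"
    using compact_imp_bounded[OF compact_continuous_image[OF continuous_on_subset[OF cont(2)] K(1)]]
    by (auto simp: bounded_iff)
  have B: "cmod (partial j \<phi> x) \<le> max B 0" for x
    using B0[of x] out[of x] by (cases "x \<in> K") auto
  let ?t = "\<lambda>n. inverse (real (Suc n))"
  let ?D = "\<lambda>n x. (\<phi> (?t n *\<^sub>R ?e + x) - \<phi> x) /\<^sub>R ?t n"
  have line: "((\<lambda>t. \<phi> (t *\<^sub>R ?e + x)) has_vector_derivative partial j \<phi> (t *\<^sub>R ?e + x)) (at t)" for t x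
  proof -
    have 1: "((\<lambda>t. t *\<^sub>R ?e + x) has_derivative (\<lambda>t. t *\<^sub>R ?e)) (at t)"
      by (auto intro!: derivative_eq_intros)
    have 2: "(\<phi> has_derivative frechet_derivative \<phi> (at (t *\<^sub>R ?e + x))) (at (t *\<^sub>R ?e + x))"
      using smooth_on_imp_differentiable[OF s] by (simp add: frechet_derivative_works)
    have "linear (frechet_derivative \<phi> (at (t *\<^sub>R ?e + x)))" using 2 has_derivative_linear by blast
    then show ?thesis
      using diff_chain_at[OF 1 2] by (simp add: has_vector_derivative_def o_def partial_def linear_cmul)
  qed
  have "(\<lambda>n. integral\<^sup>L lborel (?D n)) \<longlonglongrightarrow> integral\<^sup>L lborel (partial j \<phi>)"
  \<comment> \<open>Shifts by at most 1 keep all quotients supported in the ball of radius R + 1,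
    and the mean value inequality bounds them there; one integrable majorant serves all n.\<close>
  proof (rule integral_dominated_convergence[where w = "\<lambda>x. max B 0 * indicator (cball 0 (R + 1)) x"])
    show "integrable lborel (\<lambda>x::real^3. max B 0 * indicator (cball 0 (R + 1)) x)"
      using emeasure_bounded_finite[OF bounded_cball, of "0::real^3" "R + 1"]
      by (intro integrable_mult_right integrable_real_indicator) auto
    show "AE x in lborel. (\<lambda>n. ?D n x) \<longlonglongrightarrow> partial j \<phi> x"
    proof (rule AE_I2)
      fix x
      have "((\<lambda>t. (\<phi> (t *\<^sub>R ?e + x) - \<phi> x) /\<^sub>R t) \<longlongrightarrow> partial j \<phi> x) (at 0)"
        using has_vector_derivative_quotient[OF line[of x 0, simplified scaleR_zero_left add_0]] by simp
      moreover have "filterlim ?t (at 0) sequentially"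
        using LIMSEQ_inverse_real_of_nat by (auto simp: filterlim_at)
      ultimately show "(\<lambda>n. ?D n x) \<longlonglongrightarrow> partial j \<phi> x"
        by (rule filterlim_compose)
    qed
    show "AE x in lborel. norm (?D n x) \<le> max B 0 * indicator (cball 0 (R + 1)) x" for n
    proof (rule AE_I2)
      fix x
      have t: "0 < ?t n" "?t n \<le> 1" by (auto simp: field_simps)
      show "norm (?D n x) \<le> max B 0 * indicator (cball 0 (R + 1)) x"
      proof (cases "x \<in> cball 0 (R + 1)")
        case True
        have "norm (\<phi> (?t n *\<^sub>R ?e + x) - \<phi> (0 *\<^sub>R ?e + x)) \<le> max B 0 * norm (?t n - 0)"
        proof (rule differentiable_bound[of "{0..?t n}" "\<lambda>t. \<phi> (t *\<^sub>R ?e + x)" "\<lambda>t h. h *\<^sub>R partial j \<phi> (t *\<^sub>R ?e + x)"])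
          show "((\<lambda>t. \<phi> (t *\<^sub>R ?e + x)) has_derivative (\<lambda>h. h *\<^sub>R partial j \<phi> (t *\<^sub>R ?e + x))) (at t within {0..?t n})" for t
            using line[of x t] unfolding has_vector_derivative_def by (rule has_derivative_at_withinI)
          show "onorm (\<lambda>h. h *\<^sub>R partial j \<phi> (t *\<^sub>R ?e + x)) \<le> max B 0" for t
            by (rule onorm_bound) (use B in \<open>auto simp: mult.commute intro!: mult_left_mono\<close>)
        qed (use t in auto)
        then have "norm (\<phi> (?t n *\<^sub>R ?e + x) - \<phi> x) \<le> max B 0 * ?t n" using t by simp
        then have "norm (?D n x) \<le> inverse (?t n) * (max B 0 * ?t n)"
          using t unfolding norm_scaleR by (intro mult_mono) auto
        also have "inverse (?t n) * (max B 0 * ?t n) = max B 0" using t by (simp add: field_simps)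
        finally show ?thesis using True by simp
      next
        case False
        have "norm (?t n *\<^sub>R ?e) \<le> 1" using t by (simp add: norm_axis_1)
        then have "R < norm (?t n *\<^sub>R ?e + x)"
          using False norm_triangle_ineq2[of x "- (?t n *\<^sub>R ?e)"] by (simp add: add.commute)
        moreover have "R < norm x" using False by simp
        ultimately have "x \<notin> K" "?t n *\<^sub>R ?e + x \<notin> K" using R by (auto simp: subset_eq)
        then show ?thesis using K(2) by simp
      qed
    qed
  qed auto
  moreover have "integral\<^sup>L lborel (?D n) = 0" for n
  proof -
    have i: "integrable lborel \<phi>"
      using borel_integrable_compact[OF K(1) continuous_on_subset[OF cont(1)]]
      by (rule Bochner_Integration.integrable_cong[THEN iffD1, rotated -1]) (auto simp: indicator_def K(2))
    have "integrable lborel (\<lambda>x. \<phi> (?t n *\<^sub>R ?e + x))"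
      using i by (subst (asm) lborel_distr_plus[symmetric, of "?t n *\<^sub>R ?e"], subst (asm) integrable_distr_eq) auto
    moreover have "(LINT x|lborel. \<phi> (?t n *\<^sub>R ?e + x)) = integral\<^sup>L lborel \<phi>"
      by (subst (2) lborel_distr_plus[symmetric, of "?t n *\<^sub>R ?e"], subst integral_distr) auto
    ultimately show ?thesis using i by simp
  qed
  ultimately show ?thesis by (simp only: LIMSEQ_const_iff)
qed

section \<open>The bottom of the Neumann spectrum\<close>

text \<open>Carrying a weak gradient along with the function replaces the choice made by
  \<open>mgrad\<close>: combinations, limits and transformations act on both components at once. By
  \<open>weak_mgrad_unique\<close> the second component is determined almost everywhere.\<close>

definition magnetic_pairs ::
  "(real^3 \<Rightarrow> real^3) \<Rightarrow> (real^3) set \<Rightarrow> ((real^3 \<Rightarrow> complex) \<times> (3 \<Rightarrow> real^3 \<Rightarrow> complex)) set" where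
  "magnetic_pairs A S = {(f, g). square_integrable (lebesgue_on S) f \<and>
     (\<forall>j. square_integrable (lebesgue_on S) (g j)) \<and> weak_mgrad A S f g}"

definition energy :: "(real^3) set \<Rightarrow> (3 \<Rightarrow> real^3 \<Rightarrow> complex) \<Rightarrow> real" where
  "energy S g = (\<Sum>j\<in>UNIV. sqnorm (lebesgue_on S) (g j))"

definition pair_comb ::
  "complex \<Rightarrow> (real^3 \<Rightarrow> complex) \<times> (3 \<Rightarrow> real^3 \<Rightarrow> complex) \<Rightarrow>
   (real^3 \<Rightarrow> complex) \<times> (3 \<Rightarrow> real^3 \<Rightarrow> complex) \<Rightarrow>
   (real^3 \<Rightarrow> complex) \<times> (3 \<Rightarrow> real^3 \<Rightarrow> complex)" where
  "pair_comb c p q = (\<lambda>x. fst p x + c * fst q x, \<lambda>j x. snd p j x + c * snd q j x)"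

text \<open>The sesquilinear form of H + t, read off the gradients that the pairs carry.\<close>

definition shifted_form ::
  "(real^3) set \<Rightarrow> real \<Rightarrow> (real^3 \<Rightarrow> complex) \<times> (3 \<Rightarrow> real^3 \<Rightarrow> complex) \<Rightarrow>
   (real^3 \<Rightarrow> complex) \<times> (3 \<Rightarrow> real^3 \<Rightarrow> complex) \<Rightarrow> complex" where
  "shifted_form S t p q = (\<Sum>j\<in>UNIV. inner2 (lebesgue_on S) (snd p j) (snd q j))
     + of_real t * inner2 (lebesgue_on S) (fst p) (fst q)"

lemma energy_nonneg: "0 \<le> energy S g"
  unfolding energy_def by (simp add: sum_nonneg sqnorm_nonneg)

lemma sqnorm_cong_AE:
  assumes "f \<in> borel_measurable M" "g \<in> borel_measurable M" "AE x in M. f x = g x"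
  shows "sqnorm M f = sqnorm M g"
  unfolding sqnorm_def using assms
  by (intro integral_cong_AE) (auto elim: eventually_mono)

lemma inner2_cong_AE:
  assumes "square_integrable M f" "square_integrable M g" "square_integrable M h" "AE x in M. f x = g x"
  shows "inner2 M f h = inner2 M g h"
  unfolding inner2_def using assms(4)
  by (intro integral_cong_AE borel_measurable_integrable integrable_inner2 assms)
    (auto elim: eventually_mono)

lemma integral_mult_eq_inner2: "(LINT x|M. f x * g x) = inner2 M f (\<lambda>x. cnj (g x))"
  by (simp add: inner2_def)

locale magnetic_domain =
  fixes A :: "real^3 \<Rightarrow> real^3" and S :: "(real^3) set"
  assumes open_domain: "open S" and continuous_potential: "continuous_on UNIV A"
begin

abbreviation M where "M \<equiv> lebesgue_on S"

lemma domain_lebesgue: "S \<in> sets lebesgue"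
  using open_domain by (simp add: lmeasurable_iff_integrable)

text \<open>The transpose of -i d_j + A_j for the bilinear pairing: the derivative changes its sign
  and no conjugation enters.\<close>

definition adj :: "(real^3 \<Rightarrow> complex) \<Rightarrow> 3 \<Rightarrow> real^3 \<Rightarrow> complex" where
  "adj \<phi> j x = \<i> * partial j \<phi> x + of_real (A x $ j) * \<phi> x"

lemma square_integrable_test:
  assumes "\<phi> \<in> test_functions S"
  shows "square_integrable M \<phi>" "square_integrable M (adj \<phi> j)" "square_integrable M (partial j \<phi>)"
proof -
  obtain K where K: "compact K" "\<And>x. x \<notin> K \<Longrightarrow> \<phi> x = 0" and s: "smooth_on UNIV \<phi>"
    using assms by (auto simp: test_functions_def)
  have c: "continuous_on UNIV \<phi>" "continuous_on UNIV (partial j \<phi>)"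
    using s smooth_on_partial smooth_on_imp_continuous by auto
  have out: "partial j \<phi> x = 0" if "x \<notin> K" for x
    using partial_eq_0_outside[OF compact_imp_closed[OF K(1)] K(2) that] .
  show "square_integrable M \<phi>"
    by (rule square_integrable_continuous[OF c(1) K domain_lebesgue])
  show "square_integrable M (partial j \<phi>)"
    by (rule square_integrable_continuous[OF c(2) K(1) out domain_lebesgue])
  show "square_integrable M (adj \<phi> j)"
  proof (rule square_integrable_continuous[OF _ K(1) _ domain_lebesgue])
    show "continuous_on UNIV (adj \<phi> j)"
      unfolding adj_def by (intro continuous_intros c continuous_potential)
    show "adj \<phi> j x = 0" if "x \<notin> K" for x
      using out[OF that] K(2)[OF that] by (simp add: adj_def)
  qed
qed

lemma weak_mgrad_iff:
  "weak_mgrad A S f g \<longleftrightarrow> (\<forall>\<phi>\<in>test_functions S. \<forall>j.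
     inner2 M f (\<lambda>x. cnj (adj \<phi> j x)) = inner2 M (g j) (\<lambda>x. cnj (\<phi> x)))"
  unfolding weak_mgrad_def adj_def integral_mult_eq_inner2 ..

abbreviation pairs where "pairs \<equiv> magnetic_pairs A S"

lemma pairsD:
  assumes "p \<in> pairs"
  shows "square_integrable M (fst p)" "square_integrable M (snd p j)" "weak_mgrad A S (fst p) (snd p)"
  using assms by (auto simp: magnetic_pairs_def)

lemma pairsI:
  "square_integrable M f \<Longrightarrow> (\<And>j. square_integrable M (g j)) \<Longrightarrow> weak_mgrad A S f g \<Longrightarrow> (f, g) \<in> pairs"
  by (auto simp: magnetic_pairs_def)

lemma pair_comb_in_pairs:
  assumes "p \<in> pairs" "q \<in> pairs"
  shows "pair_comb c p q \<in> pairs"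
  unfolding pair_comb_def
proof (rule pairsI)
  show "weak_mgrad A S (\<lambda>x. fst p x + c * fst q x) (\<lambda>j x. snd p j x + c * snd q j x)"
    using pairsD[OF assms(1)] pairsD[OF assms(2)] square_integrable_test
    by (auto simp: weak_mgrad_iff inner2_add_cmult square_integrable_cnj)
qed (use pairsD[OF assms(1)] pairsD[OF assms(2)] in
  \<open>auto intro!: square_integrable_add square_integrable_cmult\<close>)

lemma shifted_form_self: "shifted_form S t p p = of_real (energy S (snd p) + t * sqnorm M (fst p))"
  by (simp add: shifted_form_def energy_def inner2_self)

lemma shifted_form_hermitian:
  assumes "\<And>p. p \<in> pairs \<Longrightarrow> 0 \<le> energy S (snd p) + t * sqnorm M (fst p)"
  shows "hermitian_form pairs pair_comb (shifted_form S t)"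
proof
  show "shifted_form S t (pair_comb c u v) w = shifted_form S t u w + c * shifted_form S t v w"
    if "u \<in> pairs" "v \<in> pairs" "w \<in> pairs" for c u v w
    using pairsD[OF that(1)] pairsD[OF that(2)] pairsD[OF that(3)]
    by (simp add: shifted_form_def pair_comb_def inner2_add_cmult sum.distrib sum_distrib_left algebra_simps)
  show "shifted_form S t u v = cnj (shifted_form S t v u)" if "u \<in> pairs" "v \<in> pairs" for u v
    using inner2_hermitian[of M "fst u" "fst v"] inner2_hermitian[of M "snd u j" "snd v j" for j]
    by (simp add: shifted_form_def)
qed (use assms in \<open>auto simp: pair_comb_in_pairs shifted_form_self\<close>)

lemma sq_shifted:
  assumes "hermitian_form pairs pair_comb (shifted_form S t)"
  shows "hermitian_form.sq (shifted_form S t) p = energy S (snd p) + t * sqnorm M (fst p)"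
  by (simp add: hermitian_form.sq_def[OF assms] shifted_form_self)

lemma zero_pair: "(\<lambda>x. 0, \<lambda>j x. 0) \<in> pairs"
  by (rule pairsI) (auto simp: weak_mgrad_def square_integrable_def)

text \<open>Each side of the tested identity is an inner product with a fixed square integrable
  function, hence continuous in the L^2 norm.\<close>

lemma weak_mgrad_limit:
  assumes p: "\<And>n. X n \<in> pairs"
    and f: "square_integrable M f" "(\<lambda>n. sqnorm M (\<lambda>x. fst (X n) x - f x)) \<longlonglongrightarrow> 0"
    and g: "\<And>j. square_integrable M (g j)" "\<And>j. (\<lambda>n. sqnorm M (\<lambda>x. snd (X n) j x - g j x)) \<longlonglongrightarrow> 0"
  shows "weak_mgrad A S f g"
  unfolding weak_mgrad_iff
proof (intro ballI allI)
  fix \<phi> j assume \<phi>: "\<phi> \<in> test_functions S"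
  have "(\<lambda>n. inner2 M (fst (X n)) (\<lambda>x. cnj (adj \<phi> j x))) \<longlonglongrightarrow> inner2 M f (\<lambda>x. cnj (adj \<phi> j x))"
    by (rule inner2_tendsto[OF pairsD(1)[OF p] f(1) _ f(2)])
      (intro square_integrable_cnj square_integrable_test \<phi>)
  moreover have "(\<lambda>n. inner2 M (snd (X n) j) (\<lambda>x. cnj (\<phi> x))) \<longlonglongrightarrow> inner2 M (g j) (\<lambda>x. cnj (\<phi> x))"
    by (rule inner2_tendsto[OF pairsD(2)[OF p] g(1) _ g(2)])
      (intro square_integrable_cnj square_integrable_test \<phi>)
  moreover have "inner2 M (fst (X n)) (\<lambda>x. cnj (adj \<phi> j x)) = inner2 M (snd (X n) j) (\<lambda>x. cnj (\<phi> x))" for n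
    using pairsD(3)[OF p[of n]] \<phi> by (simp add: weak_mgrad_iff)
  ultimately show "inner2 M f (\<lambda>x. cnj (adj \<phi> j x)) = inner2 M (g j) (\<lambda>x. cnj (\<phi> x))"
    using LIMSEQ_unique by simp
qed

text \<open>For t > 0 the form controls the L^2 norms of the function and of each gradient
  component. Cauchy sequences therefore converge componentwise, and closedness of the weak gradient
  keeps the limit among the pairs.\<close>

lemma shifted_form_complete:
  assumes t: "t > 0"
  shows "complete_form pairs pair_comb (shifted_form S t)"
proof -
  interpret hermitian_form pairs pair_comb "shifted_form S t"
    using t by (intro shifted_form_hermitian add_nonneg_nonneg mult_nonneg_nonneg energy_nonneg sqnorm_nonneg) auto
  note sq = sq_shifted[OF hermitian_form_axioms]
  have fst_le: "sqnorm M (fst p) \<le> sq p / t" for p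
    using energy_nonneg[of S "snd p"] t by (simp add: sq field_simps)
  have snd_le: "sqnorm M (snd p j) \<le> sq p" for p j
  proof -
    have "sqnorm M (snd p j) \<le> energy S (snd p)"
      unfolding energy_def by (rule member_le_sum) (auto simp: sqnorm_nonneg)
    then show ?thesis using t sqnorm_nonneg[of M "fst p"] by (simp add: sq add_increasing2)
  qed
  show ?thesis
  proof
    show "pairs \<noteq> {}" using zero_pair by blast
    fix X :: "nat \<Rightarrow> (real^3 \<Rightarrow> complex) \<times> (3 \<Rightarrow> real^3 \<Rightarrow> complex)"
    assume X: "\<And>n. X n \<in> pairs" and cauchy: "\<And>e. e > 0 \<Longrightarrow> \<exists>N. \<forall>m\<ge>N. \<forall>n\<ge>N. gap (X m) (X n) < e"
    have cauchy': "\<exists>N. \<forall>m\<ge>N. \<forall>n\<ge>N. sq (pair_comb (-1) (X m) (X n)) < e" if "e > 0" for e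
    proof -
      obtain N where N: "\<And>m n. m \<ge> N \<Longrightarrow> n \<ge> N \<Longrightarrow> gap (X m) (X n) < sqrt e"
        using cauchy[of "sqrt e"] \<open>e > 0\<close> by auto
      then have "sq (pair_comb (-1) (X m) (X n)) < e" if "m \<ge> N" "n \<ge> N" for m n
        using N[OF that] by (simp add: gap_def)
      then show ?thesis by blast
    qed
    have "\<exists>f. square_integrable M f \<and> (\<lambda>n. sqnorm M (\<lambda>x. fst (X n) x - f x)) \<longlonglongrightarrow> 0"
    proof (rule L2_complete[OF pairsD(1)[OF X]])
      fix e :: real assume "e > 0"
      then obtain N where N: "\<And>m n. m \<ge> N \<Longrightarrow> n \<ge> N \<Longrightarrow> sq (pair_comb (-1) (X m) (X n)) < e * t"
        using cauchy'[of "e * t"] t by auto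
      have "sqnorm M (\<lambda>x. fst (X m) x - fst (X n) x) < e" if "m \<ge> N" "n \<ge> N" for m n
      proof -
        have "sqnorm M (fst (pair_comb (-1) (X m) (X n))) < e"
          using fst_le[of "pair_comb (-1) (X m) (X n)"] N[OF that] t
            divide_strict_right_mono[OF N[OF that] t] by simp
        then show ?thesis by (simp add: pair_comb_def)
      qed
      then show "\<exists>N. \<forall>m\<ge>N. \<forall>n\<ge>N. sqnorm M (\<lambda>x. fst (X m) x - fst (X n) x) < e" by blast
    qed
    then obtain f where f: "square_integrable M f" "(\<lambda>n. sqnorm M (\<lambda>x. fst (X n) x - f x)) \<longlonglongrightarrow> 0"
      by (elim exE conjE)
    have "\<exists>g. square_integrable M g \<and> (\<lambda>n. sqnorm M (\<lambda>x. snd (X n) j x - g x)) \<longlonglongrightarrow> 0" for j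
    proof (rule L2_complete[OF pairsD(2)[OF X]])
      fix e :: real assume "e > 0"
      then obtain N where N: "\<And>m n. m \<ge> N \<Longrightarrow> n \<ge> N \<Longrightarrow> sq (pair_comb (-1) (X m) (X n)) < e"
        using cauchy'[of e] by auto
      have "sqnorm M (\<lambda>x. snd (X m) j x - snd (X n) j x) < e" if "m \<ge> N" "n \<ge> N" for m n
        using snd_le[of "pair_comb (-1) (X m) (X n)" j] N[OF that]
        by (simp add: pair_comb_def)
      then show "\<exists>N. \<forall>m\<ge>N. \<forall>n\<ge>N. sqnorm M (\<lambda>x. snd (X m) j x - snd (X n) j x) < e" by blast
    qed
    then have "\<exists>g. \<forall>j. square_integrable M (g j) \<and> (\<lambda>n. sqnorm M (\<lambda>x. snd (X n) j x - g j x)) \<longlonglongrightarrow> 0"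
      by (intro choice allI)
    then obtain g where g: "\<And>j. square_integrable M (g j)"
      "\<And>j. (\<lambda>n. sqnorm M (\<lambda>x. snd (X n) j x - g j x)) \<longlonglongrightarrow> 0" by auto
    have fg: "(f, g) \<in> pairs"
      by (intro pairsI f g weak_mgrad_limit[OF X f g])
    have "(\<lambda>n. sq (pair_comb (-1) (X n) (f, g))) \<longlonglongrightarrow> (\<Sum>j\<in>(UNIV::3 set). 0) + t * 0"
      unfolding sq energy_def pair_comb_def using f g
      by (intro tendsto_intros) auto
    then have "(\<lambda>n. gap (X n) (f, g)) \<longlonglongrightarrow> 0"
      unfolding gap_def using tendsto_real_sqrt[of _ 0] by simp
    then show "\<exists>u\<in>pairs. (\<lambda>n. gap (X n) u) \<longlonglongrightarrow> 0" using fg by blast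
  qed
qed

lemma weak_mgrad_unique:
  assumes "(f, g) \<in> pairs" "(f, h) \<in> pairs"
  shows "AE x in M. g j x = h j x"
proof -
  have sq: "square_integrable M (g j)" "square_integrable M (h j)"
    using assms by (auto simp: magnetic_pairs_def)
  have d: "square_integrable M (\<lambda>x. g j x - h j x)"
    using square_integrable_add[OF sq(1) square_integrable_cmult[OF sq(2), of "-1"]] by simp
  have "AE x in M. g j x - h j x = 0"
  proof (rule fundamental_lemma[OF open_domain d])
    fix \<phi> assume \<phi>: "\<phi> \<in> test_functions S"
    have "(LINT x|M. (g j x - h j x) * \<phi> x) = (LINT x|M. g j x * \<phi> x) - (LINT x|M. h j x * \<phi> x)"
      using square_integrable_mult[OF sq(1) square_integrable_test(1)[OF \<phi>]]
        square_integrable_mult[OF sq(2) square_integrable_test(1)[OF \<phi>]]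
      by (simp add: left_diff_distrib)
    also have "\<dots> = 0"
      using assms \<phi> by (auto simp: magnetic_pairs_def weak_mgrad_def)
    finally show "(LINT x|M. (g j x - h j x) * \<phi> x) = 0" .
  qed
  then show ?thesis by simp
qed

lemma form_domain_iff: "f \<in> form_domain A S \<longleftrightarrow> (\<exists>g. (f, g) \<in> pairs)"
  by (auto simp: form_domain_def magnetic_pairs_def L2_iff)

lemma mgrad_pairs:
  assumes "f \<in> form_domain A S"
  shows "(f, mgrad A S f) \<in> pairs"
proof -
  have "\<exists>g. (\<forall>j. g j \<in> L2 S) \<and> weak_mgrad A S f g" using assms by (auto simp: form_domain_def)
  from someI_ex[OF this] show ?thesis
    using assms by (auto simp: mgrad_def magnetic_pairs_def L2_iff form_domain_def)
qed

text \<open>Weak gradients are unique almost everywhere, so the arbitrary choice inside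
  \<open>mgrad\<close> does not affect the form.\<close>

lemma mform_eq:
  assumes "p \<in> pairs" "q \<in> pairs"
  shows "mform A S (fst p) (fst q) = shifted_form S 0 p q"
proof -
  have p: "(fst p, mgrad A S (fst p)) \<in> pairs" and q: "(fst q, mgrad A S (fst q)) \<in> pairs"
    using assms form_domain_iff mgrad_pairs by (metis prod.collapse)+
  have "inner2 M (mgrad A S (fst p) j) (mgrad A S (fst q) j) = inner2 M (snd p j) (snd q j)" for j
  proof -
    note sqs = pairsD(2)[OF p, of j] pairsD(2)[OF q, of j] pairsD(2)[OF assms(1), of j] pairsD(2)[OF assms(2), of j]
    have "inner2 M (mgrad A S (fst p) j) (mgrad A S (fst q) j) = inner2 M (snd p j) (mgrad A S (fst q) j)"
      using sqs weak_mgrad_unique[OF p, of "snd p" j] assms(1) by (intro inner2_cong_AE) auto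
    also have "\<dots> = cnj (inner2 M (mgrad A S (fst q) j) (snd p j))" by (rule inner2_hermitian)
    also have "inner2 M (mgrad A S (fst q) j) (snd p j) = inner2 M (snd q j) (snd p j)"
      using sqs weak_mgrad_unique[OF q, of "snd q" j] assms(2) by (intro inner2_cong_AE) auto
    also have "cnj \<dots> = inner2 M (snd p j) (snd q j)" by (rule inner2_hermitian[symmetric])
    finally show ?thesis .
  qed
  then show ?thesis by (simp add: mform_def shifted_form_def L2_inner_eq)
qed

lemma neumann_op_iff:
  assumes "p \<in> pairs"
  shows "neumann_op A S (fst p) w \<longleftrightarrow> square_integrable M w \<and>
    (\<forall>q\<in>pairs. shifted_form S 0 p q = inner2 M w (fst q))"
proof -
  have "fst p \<in> form_domain A S" using assms form_domain_iff by (metis prod.collapse)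
  moreover have "(\<forall>v\<in>form_domain A S. mform A S (fst p) v = inner2 M w v) \<longleftrightarrow>
      (\<forall>q\<in>pairs. mform A S (fst p) (fst q) = inner2 M w (fst q))"
    using form_domain_iff by force
  ultimately show ?thesis
    using mform_eq[OF assms] by (auto simp: neumann_op_def L2_iff L2_inner_eq)
qed

lemma neumann_op_pair:
  assumes "neumann_op A S u w"
  obtains p where "p \<in> pairs" "fst p = u"
  using assms form_domain_iff by (auto simp: neumann_op_def)

section \<open>Rayleigh quotients and the resolvent set\<close>

definition form_bound :: "real \<Rightarrow> bool" where
  "form_bound m \<longleftrightarrow> (\<forall>p\<in>pairs. m * sqnorm M (fst p) \<le> energy S (snd p))"

text \<open>The real number \<open>- s\<close> is taken so far to the left that the disc of radius \<open>m + s\<close> around it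
  contains \<open>z\<close>; then \<open>H - z\<close> is a contractive perturbation of \<open>H + s\<close>.\<close>

lemma resolvent_of_form_bound:
  assumes bound: "form_bound m" and z: "Re z < m"
  shows "z \<in> neumann_resolvent_set A S"
proof -
  \<comment> \<open>The condition |z + s| < m + s unfolds to (Im z)^2 < (m - Re z)(m + Re z + 2 s);
    this quotient measures how large s has to be.\<close>
  define r where "r = (Im z)\<^sup>2 / (m - Re z)"
  have r: "0 \<le> r" using z by (simp add: r_def)
  define s where "s = r + \<bar>m\<bar> + \<bar>Re z\<bar> + 1"
  have s: "s > 0" "m + s > 0" "Re z + s \<ge> 0"
    using r unfolding s_def by linarith+
  have zs: "cmod (z + of_real s) < m + s"
  proof -
    have "(Im z)\<^sup>2 = (m - Re z) * r" using z by (simp add: r_def)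
    also have "\<dots> < (m - Re z) * (m + Re z + 2 * s)"
    proof (rule mult_strict_left_mono)
      show "r < m + Re z + 2 * s" using r unfolding s_def by (simp add: abs_if)
    qed (use z in simp)
    finally have "(Re z + s)\<^sup>2 + (Im z)\<^sup>2 < (m + s)\<^sup>2"
      by (simp add: power2_eq_square algebra_simps)
    then show ?thesis using s by (simp add: cmod_def real_less_lsqrt)
  qed
  interpret complete_form pairs pair_comb "shifted_form S s" by (rule shifted_form_complete[OF s(1)])
  note sq = sq_shifted[OF hermitian_form_axioms]
  have coercive: "(m + s) * sqnorm M (fst p) \<le> sq p" if "p \<in> pairs" for p
    using bound that by (auto simp: form_bound_def sq algebra_simps)
  have coercive': "sqrt (sqnorm M (fst p)) \<le> sqrt (sq p) / sqrt (m + s)" if "p \<in> pairs" for p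
    using coercive[OF that] s by (simp add: real_sqrt_divide[symmetric] pos_le_divide_eq mult.commute)
  have "\<exists>u w. neumann_op A S u w \<and> (AE x in M. w x - z * u x = g x)" if g: "g \<in> L2 S" for g
  proof -
    have g: "square_integrable M g" using g by (simp add: L2_iff)
    \<comment> \<open>The equation H u - z u = g is read as (H + s) u = g + (z + s) u, with the
      unknown on both sides.\<close>
    define l where "l p q = inner2 M (\<lambda>x. g x + (z + of_real s) * fst p x) (fst q)" for p q :: "(real^3 \<Rightarrow> complex) \<times> (3 \<Rightarrow> real^3 \<Rightarrow> complex)"
    let ?\<theta> = "cmod (z + of_real s) / (m + s)"
    have lsq: "square_integrable M (\<lambda>x. g x + (z + of_real s) * fst p x)" if "p \<in> pairs" for p
      using g pairsD(1)[OF that] by (intro square_integrable_add square_integrable_cmult)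
    have "\<exists>u\<in>pairs. \<forall>v\<in>pairs. shifted_form S s u v = l u v"
    proof (rule riesz_perturbed[where \<theta> = ?\<theta> and
          K = "\<lambda>p. sqrt (sqnorm M (\<lambda>x. g x + (z + of_real s) * fst p x)) / sqrt (m + s)"])
      fix x c u v assume xuv: "x \<in> pairs" "u \<in> pairs" "v \<in> pairs"
      show "l x (pair_comb c u v) = l x u + cnj c * l x v"
        using inner2_add_cmult[OF pairsD(1)[OF xuv(2)] pairsD(1)[OF xuv(3)] lsq[OF xuv(1)], of c]
          inner2_hermitian[of M "\<lambda>y. g y + (z + of_real s) * fst x y"]
        by (simp add: l_def pair_comb_def)
    next
      fix x v assume xv: "x \<in> pairs" "v \<in> pairs"
      have "cmod (l x v) \<le> sqrt (sqnorm M (\<lambda>y. g y + (z + of_real s) * fst x y)) * sqrt (sqnorm M (fst v))"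
        unfolding l_def by (rule inner2_cauchy_schwarz[OF lsq[OF xv(1)] pairsD(1)[OF xv(2)]])
      also have "\<dots> \<le> sqrt (sqnorm M (\<lambda>y. g y + (z + of_real s) * fst x y)) * (sqrt (sq v) / sqrt (m + s))"
        using coercive'[OF xv(2)] by (intro mult_left_mono) (auto simp: sqnorm_nonneg)
      finally show "cmod (l x v) \<le> sqrt (sqnorm M (\<lambda>y. g y + (z + of_real s) * fst x y)) / sqrt (m + s) * sqrt (sq v)"
        by simp
    next
      fix x y v assume xyv: "x \<in> pairs" "y \<in> pairs" "v \<in> pairs"
      let ?d = "pair_comb (-1) x y"
      have d: "?d \<in> pairs" using xyv by (simp add: pair_comb_in_pairs)
      have "l x v = inner2 M g (fst v) + (z + of_real s) * inner2 M (fst x) (fst v)"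
        "l y v = inner2 M g (fst v) + (z + of_real s) * inner2 M (fst y) (fst v)"
        using g xyv[THEN pairsD(1)] by (simp_all add: l_def inner2_add_cmult)
      moreover have "inner2 M (fst ?d) (fst v) = inner2 M (fst x) (fst v) - inner2 M (fst y) (fst v)"
        using inner2_add_cmult[OF xyv[THEN pairsD(1)], of "-1"] by (simp add: pair_comb_def)
      ultimately have "l x v - l y v = (z + of_real s) * inner2 M (fst ?d) (fst v)"
        by (simp add: right_diff_distrib)
      then have "cmod (l x v - l y v) = cmod (z + of_real s) * cmod (inner2 M (fst ?d) (fst v))"
        by (simp add: norm_mult)
      also have "\<dots> \<le> cmod (z + of_real s) * (sqrt (sqnorm M (fst ?d)) * sqrt (sqnorm M (fst v)))"
        by (intro mult_left_mono inner2_cauchy_schwarz pairsD d xyv) auto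
      also have "\<dots> \<le> cmod (z + of_real s) * ((sqrt (sq ?d) / sqrt (m + s)) * (sqrt (sq v) / sqrt (m + s)))"
        using coercive'[OF d] coercive'[OF xyv(3)] sq_nonneg[OF d] s
        by (intro mult_left_mono mult_mono) (auto simp: sqnorm_nonneg)
      also have "\<dots> = ?\<theta> * gap x y * sqrt (sq v)"
        using s by (simp add: gap_def field_simps)
      finally show "cmod (l x v - l y v) \<le> ?\<theta> * gap x y * sqrt (sq v)" .
    qed (use zs s in auto)
    then obtain u where u: "u \<in> pairs" "\<And>v. v \<in> pairs \<Longrightarrow> shifted_form S s u v = l u v" by blast
    let ?w = "\<lambda>x. g x + z * fst u x"
    have "shifted_form S 0 u v = inner2 M ?w (fst v)" if v: "v \<in> pairs" for v
    proof -
      have "shifted_form S 0 u v = l u v - of_real s * inner2 M (fst u) (fst v)"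
        using u(2)[OF v] by (simp add: shifted_form_def algebra_simps)
      also have "\<dots> = inner2 M ?w (fst v)"
        unfolding l_def inner2_add_cmult[OF g pairsD(1)[OF u(1)] pairsD(1)[OF v]]
        by (simp add: distrib_right)
      finally show ?thesis .
    qed
    then have "neumann_op A S (fst u) ?w"
      using g pairsD(1)[OF u(1)] by (auto simp: neumann_op_iff[OF u(1)] intro!: square_integrable_add square_integrable_cmult)
    then show ?thesis by (intro exI[of _ "fst u"] exI[of _ ?w]) auto
  qed
  \<comment> \<open>Pairing (H - z) u with u and taking real parts leaves at least (m - Re z) times
    the squared norm of u; Cauchy-Schwarz does the rest.\<close>
  moreover have "L2_norm S u \<le> 1 / (m - Re z) * L2_norm S (\<lambda>x. w x - z * u x)" if uw: "neumann_op A S u w" for u w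
  proof -
    obtain p where p: "p \<in> pairs" "fst p = u" using neumann_op_pair[OF uw] .
    have w: "square_integrable M w" and eq: "shifted_form S 0 p p = inner2 M w u"
      using neumann_op_iff[OF p(1), of w] uw p by auto
    have u: "square_integrable M u" using pairsD(1)[OF p(1)] p(2) by simp
    have wz: "square_integrable M (\<lambda>x. w x - z * u x)"
      using square_integrable_add[OF w square_integrable_cmult[OF u, of "-z"]] by simp
    have "inner2 M (\<lambda>x. w x - z * u x) u = inner2 M w u - z * inner2 M u u"
      using inner2_add_cmult[OF w u u, of "-z"] by simp
    then have "Re (inner2 M (\<lambda>x. w x - z * u x) u) = energy S (snd p) - Re z * sqnorm M u"
      using eq by (simp add: inner2_self shifted_form_self flip: eq)
    moreover have "m * sqnorm M u \<le> energy S (snd p)"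
      using bound p by (auto simp: form_bound_def)
    ultimately have "(m - Re z) * sqnorm M u \<le> sqrt (sqnorm M (\<lambda>x. w x - z * u x)) * sqrt (sqnorm M u)"
      using inner2_cauchy_schwarz[OF wz u] complex_Re_le_cmod[of "inner2 M (\<lambda>x. w x - z * u x) u"]
      by (simp add: algebra_simps)
    then have "((m - Re z) * sqrt (sqnorm M u)) * sqrt (sqnorm M u) \<le> sqrt (sqnorm M (\<lambda>x. w x - z * u x)) * sqrt (sqnorm M u)"
      using sqnorm_nonneg[of M u] by (simp add: mult.assoc)
    then have "(m - Re z) * sqrt (sqnorm M u) \<le> sqrt (sqnorm M (\<lambda>x. w x - z * u x))"
      using sqnorm_nonneg[of M u] sqnorm_nonneg[of M "\<lambda>x. w x - z * u x"]
      by (cases "sqnorm M u = 0") auto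
    then show ?thesis using z by (simp add: L2_norm_eq field_simps)
  qed
  ultimately show ?thesis unfolding neumann_resolvent_set_def by blast
qed

text \<open>If m were in the resolvent set, a normalized near minimizer p would equal (H - m) u with
  the norm of u bounded by c. Cauchy-Schwarz for the nonnegative form a of H - m gives 1 =
  |a(u,p)|^2 \<le> a(u,u) a(p,p), where a(u,u) is at most c and a(p,p) is as small as
  desired.\<close>

lemma sharp_form_bound_in_spectrum:
  assumes bound: "form_bound m"
    and sharp: "\<And>e. e > 0 \<Longrightarrow> \<exists>p\<in>pairs. sqnorm M (fst p) = 1 \<and> energy S (snd p) < m + e"
  shows "of_real m \<in> neumann_spectrum A S"
proof (rule ccontr)
  assume "of_real m \<notin> neumann_spectrum A S"
  then have res: "of_real m \<in> neumann_resolvent_set A S" by (simp add: neumann_spectrum_def)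
  obtain c where c: "\<And>u w. neumann_op A S u w \<Longrightarrow> L2_norm S u \<le> c * L2_norm S (\<lambda>x. w x - of_real m * u x)"
    using res unfolding neumann_resolvent_set_def by blast
  interpret hermitian_form pairs pair_comb "shifted_form S (- m)"
    using bound by (intro shifted_form_hermitian) (auto simp: form_bound_def)
  note sq = sq_shifted[OF hermitian_form_axioms]
  \<comment> \<open>The tolerance is such that its product with |c| stays below 1, whatever the sign
    or size of c.\<close>
  obtain p where p: "p \<in> pairs" "sqnorm M (fst p) = 1" "energy S (snd p) < m + 1 / (\<bar>c\<bar> + 1)"
    using sharp[of "1 / (\<bar>c\<bar> + 1)"] by (meson abs_ge_zero add_nonneg_pos zero_less_divide_1_iff zero_less_one)
  have fp: "square_integrable M (fst p)" using pairsD(1)[OF p(1)] .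
  obtain u w where uw: "neumann_op A S u w" "AE x in M. w x - of_real m * u x = fst p x"
    using res fp unfolding neumann_resolvent_set_def L2_iff[symmetric] by blast
  obtain q where q: "q \<in> pairs" "fst q = u" using neumann_op_pair[OF uw(1)] .
  have u: "square_integrable M u" using pairsD(1)[OF q(1)] q(2) by simp
  have w: "square_integrable M w" and eq: "\<And>v. v \<in> pairs \<Longrightarrow> shifted_form S 0 q v = inner2 M w (fst v)"
    using neumann_op_iff[OF q(1), of w] uw(1) q by auto
  have wz: "square_integrable M (\<lambda>x. w x - of_real m * u x)"
    using square_integrable_add[OF w square_integrable_cmult[OF u, of "- of_real m"]] by simp
  have form: "shifted_form S (- m) q v = inner2 M (fst p) (fst v)" if v: "v \<in> pairs" for v
  proof -
    have "shifted_form S (- m) q v = inner2 M w (fst v) - of_real m * inner2 M u (fst v)"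
      using eq[OF v] q(2) by (simp add: shifted_form_def algebra_simps)
    also have "\<dots> = inner2 M (\<lambda>x. w x - of_real m * u x) (fst v)"
      using inner2_add_cmult[OF w u pairsD(1)[OF v], of "- of_real m"] by simp
    also have "\<dots> = inner2 M (fst p) (fst v)"
      by (rule inner2_cong_AE[OF wz fp pairsD(1)[OF v] uw(2)])
    finally show ?thesis .
  qed
  have "L2_norm S (\<lambda>x. w x - of_real m * u x) = 1"
    using sqnorm_cong_AE[OF square_integrable_measurable[OF wz] square_integrable_measurable[OF fp] uw(2)] p(2)
    by (simp add: L2_norm_eq)
  then have nu: "sqrt (sqnorm M u) \<le> c" using c[OF uw(1)] by (simp add: L2_norm_eq)
  have "sq q = Re (inner2 M (fst p) u)" using form[OF q(1)] q(2) by (simp add: sq_def)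
  also have "\<dots> \<le> sqrt (sqnorm M (fst p)) * sqrt (sqnorm M u)"
    using inner2_cauchy_schwarz[OF fp u] complex_Re_le_cmod order_trans by blast
  finally have "sq q \<le> c" using nu p(2) by simp
  moreover have "1 = (cmod (shifted_form S (- m) q p))\<^sup>2"
    using form[OF p(1)] p(2) by (simp add: inner2_self)
  ultimately have "1 \<le> sq q * sq p" using cauchy_schwarz[OF q(1) p(1)] by simp
  also have "\<dots> \<le> c * sq p" using \<open>sq q \<le> c\<close> sq_nonneg[OF p(1)] by (rule mult_right_mono)
  also have "\<dots> \<le> \<bar>c\<bar> * (1 / (\<bar>c\<bar> + 1))"
    using p(2,3) sq_nonneg[OF p(1)] by (intro mult_mono) (auto simp: sq)
  also have "\<dots> < 1" by (simp add: field_simps)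
  finally show False by simp
qed

text \<open>The two sides of the tested identity differ by i times the integral of d_j (\<phi>
  \<psi>), which vanishes because the product has compact support in S.\<close>

lemma test_function_pair:
  assumes "\<phi> \<in> test_functions S"
  shows "(\<phi>, \<lambda>j x. - \<i> * partial j \<phi> x + of_real (A x $ j) * \<phi> x) \<in> pairs"
proof (rule pairsI)
  show "square_integrable M \<phi>" using square_integrable_test[OF assms] by blast
  have eq: "- \<i> * partial j \<phi> x + of_real (A x $ j) * \<phi> x = adj \<phi> j x + (- 2 * \<i>) * partial j \<phi> x" for j x
    by (simp add: adj_def)
  show sq: "square_integrable M (\<lambda>x. - \<i> * partial j \<phi> x + of_real (A x $ j) * \<phi> x)" for j
    unfolding eq by (intro square_integrable_add square_integrable_cmult square_integrable_test assms)
  show "weak_mgrad A S \<phi> (\<lambda>j x. - \<i> * partial j \<phi> x + of_real (A x $ j) * \<phi> x)"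
    unfolding weak_mgrad_def
  proof (intro ballI allI)
    fix \<psi> j assume \<psi>: "\<psi> \<in> test_functions S"
    have s: "smooth_on UNIV \<phi>" "smooth_on UNIV \<psi>" using assms \<psi> by (auto simp: test_functions_def)
    obtain K where K: "compact K" "K \<subseteq> S" "\<And>x. x \<notin> K \<Longrightarrow> \<psi> x = 0" using \<psi> by (auto simp: test_functions_def)
    have prod: "(\<lambda>x. \<phi> x * \<psi> x) \<in> test_functions S"
      using smooth_on_mult[OF s] K by (auto simp: test_functions_def intro!: exI[of _ K])
    have "(LINT x|M. \<phi> x * adj \<psi> j x) - (LINT x|M. (- \<i> * partial j \<phi> x + of_real (A x $ j) * \<phi> x) * \<psi> x)
        = (LINT x|M. \<phi> x * adj \<psi> j x - (- \<i> * partial j \<phi> x + of_real (A x $ j) * \<phi> x) * \<psi> x)"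
      by (intro Bochner_Integration.integral_diff[symmetric] square_integrable_mult square_integrable_test assms \<psi> sq)
    also have "\<dots> = (LINT x|M. \<i> * partial j (\<lambda>x. \<phi> x * \<psi> x) x)"
      by (intro Bochner_Integration.integral_cong refl)
        (simp add: adj_def algebra_simps partial_mult[OF s[THEN smooth_on_imp_differentiable]])
    also have "\<dots> = (LINT x|lebesgue. indicator S x *\<^sub>R (\<i> * partial j (\<lambda>x. \<phi> x * \<psi> x) x))"
      by (rule integral_restrict_space) (simp add: domain_lebesgue)
    also have "\<dots> = (LINT x|lebesgue. \<i> * partial j (\<lambda>x. \<phi> x * \<psi> x) x)"
    proof (intro Bochner_Integration.integral_cong refl)
      fix x
      have "partial j (\<lambda>x. \<phi> x * \<psi> x) x = 0" if "x \<notin> S"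
        by (rule partial_eq_0_outside[OF compact_imp_closed[OF K(1)]]) (use K that in auto)
      then show "indicator S x *\<^sub>R (\<i> * partial j (\<lambda>x. \<phi> x * \<psi> x) x) = \<i> * partial j (\<lambda>x. \<phi> x * \<psi> x) x"
        by (auto simp: indicator_def)
    qed
    also have "\<dots> = \<i> * (LINT x|lborel. partial j (\<lambda>x. \<phi> x * \<psi> x) x)"
      using borel_measurable_continuous_onI[OF smooth_on_imp_continuous[OF smooth_on_partial[OF smooth_on_mult[OF s]]], of j]
      by (simp add: integral_completion)
    also have "\<dots> = 0" using integral_partial_eq_0[OF prod] by simp
    finally show "(LINT x|M. \<phi> x * (\<i> * partial j \<psi> x + of_real (A x $ j) * \<psi> x))
        = (LINT x|M. (- \<i> * partial j \<phi> x + of_real (A x $ j) * \<phi> x) * \<psi> x)"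
      by (simp add: adj_def)
  qed
qed

lemma sqnorm_cmult: "sqnorm N (\<lambda>x. c * f x) = (cmod c)\<^sup>2 * sqnorm N f"
  by (simp add: sqnorm_def norm_mult power_mult_distrib)

lemma normalized_pair:
  assumes "p \<in> pairs" "sqnorm M (fst p) > 0"
  shows "\<exists>q\<in>pairs. sqnorm M (fst q) = 1 \<and> energy S (snd q) = energy S (snd p) / sqnorm M (fst p)"
proof -
  let ?c = "complex_of_real (1 / sqrt (sqnorm M (fst p)))"
  have c: "(cmod ?c)\<^sup>2 = 1 / sqnorm M (fst p)" using assms(2) by (simp add: norm_divide power_divide)
  have "pair_comb ?c (\<lambda>x. 0, \<lambda>j x. 0) p \<in> pairs" by (intro pair_comb_in_pairs zero_pair assms)
  moreover have "sqnorm M (\<lambda>x. ?c * f x) = sqnorm M f / sqnorm M (fst p)" for f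
    unfolding sqnorm_cmult c by simp
  ultimately show ?thesis
    using assms(2) by (intro bexI[of _ "pair_comb ?c (\<lambda>x. 0, \<lambda>j x. 0) p"])
      (auto simp: pair_comb_def energy_def sum_divide_distrib simp del: of_real_divide)
qed

lemma nontrivial_pair:
  assumes "S \<noteq> {}"
  shows "\<exists>p\<in>pairs. sqnorm M (fst p) > 0"
proof -
  obtain x a b where x: "x \<in> box a b" "cbox a b \<subseteq> S"
    using open_contains_cbox[of S] assms open_domain by (metis all_not_in_conv)
  let ?\<phi> = "\<lambda>x. complex_of_real (box_bump 1 a b x)"
  have \<phi>: "?\<phi> \<in> test_functions S" using x by (intro box_bump_test_function) auto
  have "sqnorm M ?\<phi> \<noteq> 0"
  proof
    assume "sqnorm M ?\<phi> = 0"
    then have "AE x in M. (cmod (?\<phi> x))\<^sup>2 = 0"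
      using square_integrable_test(1)[OF \<phi>] unfolding sqnorm_def square_integrable_def
      by (intro integral_nonneg_eq_0_iff_AE[THEN iffD1]) auto
    then have "AE x in lebesgue. x \<in> S \<longrightarrow> (cmod (?\<phi> x))\<^sup>2 = 0"
      using domain_lebesgue by (simp add: AE_restrict_space_iff)
    then have "AE x in lebesgue. x \<notin> box a b"
      by eventually_elim (use x(2) box_subset_cbox[of a b] box_bump_pos[of 1 a b] in force)
    then have "negligible (box a b)"
      by (simp add: negligible_iff_null_sets AE_iff_null_sets[symmetric])
    then show False using x(1) by (metis all_not_in_conv negligible_interval(2))
  qed
  then have "sqnorm M ?\<phi> > 0" using sqnorm_nonneg[of M ?\<phi>] by linarith
  then show ?thesis using test_function_pair[OF \<phi>] by force
qed

text \<open>The infimum of the quotients is a form bound, so every complex z with smaller real part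
  is in the resolvent set; near minimizers put the infimum itself into the spectrum. It is thus the
  least real part that occurs there.\<close>

lemma spectrum_bottom_rayleigh:
  assumes "S \<noteq> {}"
  shows "form_bound (spectrum_bottom A S)"
    and "e > 0 \<Longrightarrow> \<exists>p\<in>pairs. sqnorm M (fst p) = 1 \<and> energy S (snd p) < spectrum_bottom A S + e"
proof -
  define Q where "Q = {energy S (snd p) |p. p \<in> pairs \<and> sqnorm M (fst p) = 1}"
  define m where "m = Inf Q"
  have ne: "Q \<noteq> {}"
    using nontrivial_pair[OF assms] normalized_pair unfolding Q_def by blast
  have bdd: "bdd_below Q" by (rule bdd_belowI[of _ 0]) (auto simp: Q_def energy_nonneg)
  have bound: "form_bound m"
    unfolding form_bound_def
  proof
    fix p assume p: "p \<in> pairs"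
    show "m * sqnorm M (fst p) \<le> energy S (snd p)"
    proof (cases "sqnorm M (fst p) = 0")
      case True
      then show ?thesis by (simp add: energy_nonneg)
    next
      case False
      then have pos: "sqnorm M (fst p) > 0" using sqnorm_nonneg[of M "fst p"] by linarith
      obtain q where "q \<in> pairs" "sqnorm M (fst q) = 1" "energy S (snd q) = energy S (snd p) / sqnorm M (fst p)"
        using normalized_pair[OF p pos] by blast
      then have "m \<le> energy S (snd p) / sqnorm M (fst p)"
        unfolding m_def Q_def by (intro cInf_lower bdd[unfolded Q_def] CollectI exI[of _ q]) simp
      then show ?thesis using pos by (simp add: field_simps)
    qed
  qed
  have sharp: "\<exists>p\<in>pairs. sqnorm M (fst p) = 1 \<and> energy S (snd p) < m + e" if "e > 0" for e
  proof -
    have "Inf Q < m + e" using that by (simp add: m_def)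
    then obtain x where "x \<in> Q" "x < m + e" using cInf_less_iff[OF ne bdd] by blast
    then show ?thesis unfolding Q_def by blast
  qed
  have "Inf (Re ` neumann_spectrum A S) = m"
  proof (rule cInf_eq_minimum)
    show "m \<in> Re ` neumann_spectrum A S"
      using sharp_form_bound_in_spectrum[OF bound sharp] by force
    show "m \<le> x" if "x \<in> Re ` neumann_spectrum A S" for x
      using that resolvent_of_form_bound[OF bound] by (force simp: neumann_spectrum_def)
  qed
  then have "spectrum_bottom A S = m" by (simp add: spectrum_bottom_def)
  then show "form_bound (spectrum_bottom A S)"
    and "e > 0 \<Longrightarrow> \<exists>p\<in>pairs. sqnorm M (fst p) = 1 \<and> energy S (snd p) < spectrum_bottom A S + e"
    using bound sharp by auto
qed

end

section \<open>Cutoff, gauge and affine changes\<close>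

lemma indicator_transfer:
  assumes "\<And>x. x \<in> S - T \<union> (T - S) \<Longrightarrow> f x = 0"
  shows "(\<lambda>x. indicator S x *\<^sub>R f x) = (\<lambda>x. indicator T x *\<^sub>R (f x :: 'b::real_vector))"
  using assms by (fastforce simp: indicator_def)

text \<open>Extended by zero, the restrictions of f to S and to T are the same function on the whole
  space.\<close>

lemma square_integrable_transfer:
  assumes "S \<in> sets lebesgue" "T \<in> sets lebesgue" "\<And>x. x \<in> S - T \<union> (T - S) \<Longrightarrow> f x = 0"
    "square_integrable (lebesgue_on S) f"
  shows "square_integrable (lebesgue_on T) f"
proof -
  have "(\<lambda>x. indicator T x *\<^sub>R f x) \<in> borel_measurable lebesgue"
    "integrable lebesgue (\<lambda>x. indicator T x *\<^sub>R (cmod (f x))\<^sup>2)"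
    using assms indicator_transfer[of S T f] indicator_transfer[of S T "\<lambda>x. (cmod (f x))\<^sup>2"]
    by (simp_all add: square_integrable_def integrable_restrict_space borel_measurable_restrict_space_iff
        del: real_scaleR_def)
  then show ?thesis
    using assms(2)
    by (simp add: square_integrable_def integrable_restrict_space borel_measurable_restrict_space_iff)
qed

lemma integral_transfer:
  fixes f :: "'a::euclidean_space \<Rightarrow> 'b::{banach, second_countable_topology}"
  assumes "S \<in> sets lebesgue" "T \<in> sets lebesgue" "\<And>x. x \<in> S - T \<union> (T - S) \<Longrightarrow> f x = 0"
  shows "integral\<^sup>L (lebesgue_on S) f = integral\<^sup>L (lebesgue_on T) f"
  using assms(1,2) indicator_transfer[of S T f, OF assms(3)] by (simp add: integral_restrict_space)

lemma bounded_if_compact_support: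
  fixes h :: "'a::euclidean_space \<Rightarrow> complex"
  assumes "continuous_on UNIV h" "compact F" "\<And>x. x \<notin> F \<Longrightarrow> h x = 0"
  obtains B where "\<And>x. cmod (h x) \<le> B"
proof -
  obtain B where B: "\<And>x. x \<in> F \<Longrightarrow> cmod (h x) \<le> B"
    using compact_imp_bounded[OF compact_continuous_image[OF continuous_on_subset[OF assms(1)] assms(2)]]
    by (auto simp: bounded_iff)
  have "cmod (h x) \<le> max B 0" for x
    using B[of x] assms(3)[of x] by (cases "x \<in> F") auto
  then show ?thesis by (rule that)
qed

lemma measurable_lebesgue_on_continuous:
  fixes h :: "'a::euclidean_space \<Rightarrow> complex"
  shows "continuous_on UNIV h \<Longrightarrow> h \<in> borel_measurable (lebesgue_on S)"
  by (intro measurable_restrict_space1 measurable_completion)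
     (simp add: borel_measurable_continuous_onI)

text \<open>Testing \<psi> f against \<phi> amounts, up to the Leibniz term, to testing f against
  \<psi> \<phi>. Since the two sets agree on F, the latter is a test function on S, whatever the
  sets do elsewhere.\<close>

lemma magnetic_pairs_cutoff:
  assumes S: "magnetic_domain A S" and T: "open T"
    and \<psi>: "smooth_on UNIV (\<lambda>x. complex_of_real (\<psi> x))" and F: "compact F" "\<And>x. x \<notin> F \<Longrightarrow> \<psi> x = 0"
    and agree: "S \<inter> F = T \<inter> F" and fg: "(f, g) \<in> magnetic_pairs A S"
  shows "(\<lambda>x. of_real (\<psi> x) * f x,
      \<lambda>j x. of_real (\<psi> x) * g j x - \<i> * partial j (\<lambda>x. of_real (\<psi> x)) x * f x) \<in> magnetic_pairs A T"
proof -
  interpret S: magnetic_domain A S by fact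
  interpret T: magnetic_domain A T using S.continuous_potential T by unfold_locales
  let ?\<psi> = "\<lambda>x. complex_of_real (\<psi> x)"
  let ?f = "\<lambda>x. ?\<psi> x * f x" and ?g = "\<lambda>j x. ?\<psi> x * g j x - \<i> * partial j ?\<psi> x * f x"
  have f: "square_integrable S.M f" and g: "\<And>j. square_integrable S.M (g j)" and weak: "weak_mgrad A S f g"
    using fg by (auto simp: magnetic_pairs_def)
  have out: "partial j ?\<psi> x = 0" if "x \<notin> F" for x j
    by (rule partial_eq_0_outside[OF compact_imp_closed[OF F(1)] _ that]) (simp add: F(2))
  have cont: "continuous_on UNIV ?\<psi>" "continuous_on UNIV (partial j ?\<psi>)" for j
    using smooth_on_imp_continuous[OF \<psi>] smooth_on_imp_continuous[OF smooth_on_partial[OF \<psi>]] by auto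
  have mult: "square_integrable S.M (\<lambda>x. h x * u x)"
    if "continuous_on UNIV h" "\<And>x. x \<notin> F \<Longrightarrow> h x = 0" "square_integrable S.M u" for h u
    using bounded_if_compact_support[OF that(1) F(1) that(2)]
      square_integrable_bounded_mult[OF that(3) measurable_lebesgue_on_continuous[OF that(1)]] by metis
  have fS: "square_integrable S.M ?f" by (rule mult[OF cont(1) _ f]) (simp add: F(2))
  have gS: "square_integrable S.M (?g j)" for j
    using square_integrable_add[OF mult[OF cont(1) _ g[of j]]
        square_integrable_cmult[OF mult[OF cont(2)[of j] out f], of "-\<i>"]] F(2)
    by (simp add: mult.assoc)
  have zero: "?f x = 0" "?g j x = 0" "?\<psi> x = 0" "partial j ?\<psi> x = 0" if "x \<in> S - T \<union> (T - S)" for x j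
  proof -
    have "x \<notin> F" using that agree by blast
    then show "?f x = 0" "?g j x = 0" "?\<psi> x = 0" "partial j ?\<psi> x = 0" using F(2) out by auto
  qed
  note tr = square_integrable_transfer[OF S.domain_lebesgue T.domain_lebesgue]
  have "weak_mgrad A T ?f ?g"
    unfolding weak_mgrad_def
  proof (intro ballI allI)
    fix \<phi> j assume \<phi>: "\<phi> \<in> test_functions T"
    have s: "smooth_on UNIV \<phi>" using \<phi> by (auto simp: test_functions_def)
    have \<psi>\<phi>: "(\<lambda>x. ?\<psi> x * \<phi> x) \<in> test_functions S"
      using agree F(2) by (intro test_functions_mult[OF \<phi> \<psi> compact_imp_closed[OF F(1)]]) auto
    have i1: "integrable S.M (\<lambda>x. f x * S.adj (\<lambda>x. ?\<psi> x * \<phi> x) j x)"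
      by (intro square_integrable_mult f S.square_integrable_test \<psi>\<phi>)
    have i2: "integrable S.M (\<lambda>x. g j x * (?\<psi> x * \<phi> x))"
      by (intro square_integrable_mult g S.square_integrable_test \<psi>\<phi>)
    have i3: "integrable S.M (\<lambda>x. \<i> * (f x * (partial j ?\<psi> x * \<phi> x)))"
    proof (intro integrable_mult_right square_integrable_mult f)
      have "(\<lambda>x. partial j ?\<psi> x * \<phi> x) \<in> test_functions S"
        using agree out by (intro test_functions_mult[OF \<phi> smooth_on_partial[OF \<psi>] compact_imp_closed[OF F(1)]]) auto
      then show "square_integrable S.M (\<lambda>x. partial j ?\<psi> x * \<phi> x)"
        by (rule S.square_integrable_test)
    qed
    have "(LINT x|T.M. ?f x * T.adj \<phi> j x) = (LINT x|S.M. ?f x * T.adj \<phi> j x)"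
      by (rule integral_transfer[OF T.domain_lebesgue S.domain_lebesgue]) (use zero(1) in auto)
    also have "\<dots> = (LINT x|S.M. f x * S.adj (\<lambda>x. ?\<psi> x * \<phi> x) j x - \<i> * (f x * (partial j ?\<psi> x * \<phi> x)))"
      by (intro Bochner_Integration.integral_cong refl)
        (simp only: S.adj_def T.adj_def partial_mult[OF smooth_on_imp_differentiable[OF \<psi>] smooth_on_imp_differentiable[OF s]],
         simp add: algebra_simps)
    also have "\<dots> = (LINT x|S.M. f x * S.adj (\<lambda>x. ?\<psi> x * \<phi> x) j x) - (LINT x|S.M. \<i> * (f x * (partial j ?\<psi> x * \<phi> x)))"
      by (rule Bochner_Integration.integral_diff[OF i1 i3])
    also have "(LINT x|S.M. f x * S.adj (\<lambda>x. ?\<psi> x * \<phi> x) j x) = (LINT x|S.M. g j x * (?\<psi> x * \<phi> x))"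
      using weak \<psi>\<phi> by (auto simp: weak_mgrad_def S.adj_def)
    also have "\<dots> - (LINT x|S.M. \<i> * (f x * (partial j ?\<psi> x * \<phi> x)))
        = (LINT x|S.M. g j x * (?\<psi> x * \<phi> x) - \<i> * (f x * (partial j ?\<psi> x * \<phi> x)))"
      by (rule Bochner_Integration.integral_diff[OF i2 i3, symmetric])
    also have "\<dots> = (LINT x|S.M. ?g j x * \<phi> x)"
      by (intro Bochner_Integration.integral_cong refl) (simp add: algebra_simps)
    also have "\<dots> = (LINT x|T.M. ?g j x * \<phi> x)"
      by (rule integral_transfer[OF S.domain_lebesgue T.domain_lebesgue]) (use zero(2) in auto)
    finally show "(LINT x|T.M. ?f x * (\<i> * partial j \<phi> x + of_real (A x $ j) * \<phi> x)) = (LINT x|T.M. ?g j x * \<phi> x)"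
      by (simp add: T.adj_def)
  qed
  then show ?thesis
    by (intro T.pairsI tr[OF zero(1) fS] tr[OF zero(2) gS])
qed

text \<open>Conjugation with the phase exp(-i \<eta>) turns -i \<nabla> + A into -i \<nabla> + A +
  \<nabla>\<eta>. Moduli are unchanged, hence so are the norm and the energy.\<close>

lemma magnetic_pairs_gauge:
  fixes \<eta> :: "real^3 \<Rightarrow> real"
  assumes S: "magnetic_domain A S" and \<eta>: "smooth_on UNIV \<eta>"
    and fg: "(f, g) \<in> magnetic_pairs A S" and A': "\<And>x j. A' x $ j = A x $ j + partial j \<eta> x"
  shows "(\<lambda>x. cis (- \<eta> x) * f x, \<lambda>j x. cis (- \<eta> x) * g j x) \<in> magnetic_pairs A' S"
proof -
  interpret S: magnetic_domain A S by fact
  let ?c = "\<lambda>x. cis (- \<eta> x)"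
  have f: "square_integrable S.M f" and g: "\<And>j. square_integrable S.M (g j)" and weak: "weak_mgrad A S f g"
    using fg by (auto simp: magnetic_pairs_def)
  have sc: "smooth_on UNIV ?c"
    unfolding smooth_on_def
    by (intro allI Ck_on_cis Ck_on_bounded_linear[OF _ bounded_linear_minus[OF bounded_linear_ident]])
      (use \<eta> in \<open>auto simp: smooth_on_def\<close>)
  have dc: "partial j ?c x = - \<i> * of_real (partial j \<eta> x) * ?c x" for j x
  proof -
    have 1: "((\<lambda>x. - \<eta> x) has_derivative (\<lambda>v. - frechet_derivative \<eta> (at x) v)) (at x)"
      using smooth_on_imp_differentiable[OF \<eta>]
      by (auto intro!: derivative_eq_intros simp: frechet_derivative_works)
    from frechet_derivative_at[OF diff_chain_at[OF 1 cis_has_derivative], symmetric]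
    show ?thesis unfolding partial_def by (simp add: o_def scaleR_conv_of_real)
  qed
  have mult: "square_integrable S.M (\<lambda>x. ?c x * u x)" if "square_integrable S.M u" for u
    by (rule square_integrable_bounded_mult[OF that measurable_lebesgue_on_continuous[OF smooth_on_imp_continuous[OF sc]], of 1])
      simp
  have "weak_mgrad A' S (\<lambda>x. ?c x * f x) (\<lambda>j x. ?c x * g j x)"
    unfolding weak_mgrad_def
  proof (intro ballI allI)
    fix \<phi> j assume \<phi>: "\<phi> \<in> test_functions S"
    then have s: "smooth_on UNIV \<phi>" by (auto simp: test_functions_def)
    have c\<phi>: "(\<lambda>x. ?c x * \<phi> x) \<in> test_functions S"
      by (rule test_functions_mult[OF \<phi> sc closed_UNIV]) auto
    have "?c x * f x * (\<i> * partial j \<phi> x + of_real (A' x $ j) * \<phi> x)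
        = f x * (\<i> * partial j (\<lambda>x. ?c x * \<phi> x) x + of_real (A x $ j) * (?c x * \<phi> x))" for x
      unfolding partial_mult[OF smooth_on_imp_differentiable[OF sc] smooth_on_imp_differentiable[OF s]] dc A'
      by (simp add: algebra_simps)
    then have "(LINT x|S.M. ?c x * f x * (\<i> * partial j \<phi> x + of_real (A' x $ j) * \<phi> x))
        = (LINT x|S.M. f x * (\<i> * partial j (\<lambda>x. ?c x * \<phi> x) x + of_real (A x $ j) * (?c x * \<phi> x)))"
      by (simp only:)
    also have "\<dots> = (LINT x|S.M. g j x * (?c x * \<phi> x))"
      using weak c\<phi> unfolding weak_mgrad_def by blast
    also have "\<dots> = (LINT x|S.M. ?c x * g j x * \<phi> x)" by (simp add: mult_ac)
    finally show "(LINT x|S.M. ?c x * f x * (\<i> * partial j \<phi> x + of_real (A' x $ j) * \<phi> x))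
        = (LINT x|S.M. ?c x * g j x * \<phi> x)" .
  qed
  then show ?thesis
    unfolding magnetic_pairs_def using mult[OF f] mult[OF g] by simp
qed

text \<open>The change W of the potential may be unbounded on S; the compact support of f makes the
  added term W f square integrable.\<close>

lemma magnetic_pairs_perturb:
  assumes S: "magnetic_domain A S" and fg: "(f, g) \<in> magnetic_pairs A S"
    and W: "continuous_on UNIV W" and supp: "compact F" "\<And>x. x \<notin> F \<Longrightarrow> f x = 0"
  shows "(f, \<lambda>j x. g j x + of_real (W x $ j) * f x) \<in> magnetic_pairs (\<lambda>x. A x + W x) S"
proof -
  interpret S: magnetic_domain A S by fact
  have f: "square_integrable S.M f" and g: "\<And>j. square_integrable S.M (g j)" and weak: "weak_mgrad A S f g"
    using fg by (auto simp: magnetic_pairs_def)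
  have Wf: "square_integrable S.M (\<lambda>x. of_real (W x $ j) * f x)" for j
  proof -
    have cont: "continuous_on UNIV (\<lambda>x. complex_of_real (W x $ j))"
      by (intro continuous_intros W)
    obtain B where B: "\<And>x. x \<in> F \<Longrightarrow> cmod (of_real (W x $ j)) \<le> B"
      using compact_imp_bounded[OF compact_continuous_image[OF continuous_on_subset[OF cont] supp(1)]]
      by (auto simp: bounded_iff)
    let ?h = "\<lambda>x. of_real (W x $ j) * complex_of_real (indicator F x)"
    have [measurable]: "F \<in> sets borel" using supp(1) by (rule borel_compact)
    have "(\<lambda>x. complex_of_real (indicator F x)) \<in> borel_measurable S.M"
      by (intro measurable_restrict_space1 measurable_completion) simp
    then have "?h \<in> borel_measurable S.M"
      using measurable_lebesgue_on_continuous[OF cont] by simp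
    moreover have "cmod (?h x) \<le> max B 0" for x
      using B[of x] by (cases "x \<in> F") auto
    ultimately have "square_integrable S.M (\<lambda>x. ?h x * f x)"
      by (rule square_integrable_bounded_mult[OF f])
    moreover have "?h x * f x = of_real (W x $ j) * f x" for x
      using supp(2)[of x] by (auto simp: indicator_def)
    ultimately show ?thesis by simp
  qed
  have "weak_mgrad (\<lambda>x. A x + W x) S f (\<lambda>j x. g j x + of_real (W x $ j) * f x)"
    unfolding weak_mgrad_def
  proof (intro ballI allI)
    fix \<phi> j assume \<phi>: "\<phi> \<in> test_functions S"
    note t = S.square_integrable_test[OF \<phi>]
    have "(LINT x|S.M. f x * (\<i> * partial j \<phi> x + of_real ((A x + W x) $ j) * \<phi> x))
        = (LINT x|S.M. f x * S.adj \<phi> j x + of_real (W x $ j) * f x * \<phi> x)"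
      by (intro Bochner_Integration.integral_cong) (auto simp: S.adj_def algebra_simps)
    also have "\<dots> = (LINT x|S.M. f x * S.adj \<phi> j x) + (LINT x|S.M. of_real (W x $ j) * f x * \<phi> x)"
      by (intro Bochner_Integration.integral_add square_integrable_mult f t Wf)
    also have "(LINT x|S.M. f x * S.adj \<phi> j x) = (LINT x|S.M. g j x * \<phi> x)"
      using weak \<phi> unfolding weak_mgrad_def S.adj_def by blast
    also have "\<dots> + (LINT x|S.M. of_real (W x $ j) * f x * \<phi> x)
        = (LINT x|S.M. g j x * \<phi> x + of_real (W x $ j) * f x * \<phi> x)"
      by (intro Bochner_Integration.integral_add[symmetric] square_integrable_mult g t Wf)
    finally show "(LINT x|S.M. f x * (\<i> * partial j \<phi> x + of_real ((A x + W x) $ j) * \<phi> x))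
        = (LINT x|S.M. (g j x + of_real (W x $ j) * f x) * \<phi> x)" by (simp add: distrib_right)
  qed
  then show ?thesis
    unfolding magnetic_pairs_def using f square_integrable_add[OF g Wf] by simp
qed

section \<open>Affine changes of variables\<close>

lemma
  fixes f h :: "real^'n::{finite,wellorder} \<Rightarrow> real^'n::_" and c :: "real^'n::_"
  assumes lin: "linear f" "linear h" and inv: "\<And>x. f (h x) = x" "\<And>x. h (f x) = x"
  defines "T == \<lambda>x. f x + c" and "k == 1 / \<bar>det (matrix h)\<bar>"
  shows det_inverse_pos: "0 < k"
    and lborel_affine_linear: "lborel = density (distr lborel borel T) (\<lambda>_. ennreal k)"
    and lebesgue_affine_linear: "lebesgue = density (distr lebesgue lebesgue T) (\<lambda>_. ennreal k)"
    and measurable_affine_linear: "T \<in> lebesgue \<rightarrow>\<^sub>M lebesgue"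
proof -
  have "inj h" using inv(1) by (metis injI)
  then show k: "0 < k" using det_nz_iff_inj[OF lin(2)] by (simp add: k_def)
  have T_borel[measurable]: "T \<in> borel \<rightarrow>\<^sub>M borel"
    unfolding T_def
    using linear_continuous_on[OF linear_conv_bounded_linear[THEN iffD1, OF lin(1)], of UNIV]
    by (intro borel_measurable_continuous_onI continuous_intros) auto
  show lb: "lborel = density (distr lborel borel T) (\<lambda>_. ennreal k)"
  proof (rule lborel_eqI)
    fix l u :: "real^'n::_" assume le: "\<And>b. b \<in> Basis \<Longrightarrow> l \<bullet> b \<le> u \<bullet> b"
    \<comment> \<open>The preimage of a box under T is the image of a translated box under the
      inverse h, so its volume is read off the determinant of h.\<close>
    have "T -` box l u = h ` box (l - c) (u - c)"
    proof (intro set_eqI iffI)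
      fix x assume "x \<in> T -` box l u"
      then have "f x \<in> box (l - c) (u - c)" by (auto simp: T_def mem_box algebra_simps)
      then show "x \<in> h ` box (l - c) (u - c)" using inv(2) by (metis imageI)
    next
      fix x assume "x \<in> h ` box (l - c) (u - c)"
      then show "x \<in> T -` box l u" using inv(1) by (auto simp: T_def mem_box algebra_simps)
    qed
    moreover have "h ` box (l - c) (u - c) \<in> lmeasurable"
      by (rule measurable_linear_image[OF lin(2)]) simp
    moreover have "measure lebesgue (h ` box (l - c) (u - c)) = \<bar>det (matrix h)\<bar> * prod ((\<bullet>) (u - l)) Basis"
      using le by (subst measure_linear_image[OF lin(2)]) (auto simp: inner_diff_left)
    ultimately have "T -` box l u \<in> lmeasurable"
      and "measure lebesgue (T -` box l u) = \<bar>det (matrix h)\<bar> * prod ((\<bullet>) (u - l)) Basis"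
      by (simp_all only:)
    then have "emeasure lebesgue (T -` box l u) = ennreal (\<bar>det (matrix h)\<bar> * prod ((\<bullet>) (u - l)) Basis)"
      using emeasure_eq_measure2[of "T -` box l u" lebesgue] by simp
    moreover have "T -` box l u \<in> sets borel" using measurable_sets[OF T_borel, of "box l u"] by simp
    ultimately have "emeasure lborel (T -` box l u) = ennreal (\<bar>det (matrix h)\<bar> * prod ((\<bullet>) (u - l)) Basis)"
      by simp
    then show "emeasure (density (distr lborel borel T) (\<lambda>_. ennreal k)) (box l u) = ennreal (prod ((\<bullet>) (u - l)) Basis)"
      using k le by (simp add: emeasure_density nn_integral_cmult emeasure_distr ennreal_mult'[symmetric] k_def)
  qed simp
  \<comment> \<open>Passing to the completed measures requires both Borel measures to have the same
    null sets; a positive constant density preserves them.\<close>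
  have "emeasure lborel A = 0 \<longleftrightarrow> emeasure (distr lebesgue lborel T) A = 0" if A: "A \<in> sets borel" for A
  proof -
    have "emeasure lborel A = 0 \<longleftrightarrow> emeasure (density (distr lborel borel T) (\<lambda>_. ennreal k)) A = 0"
      by (subst lb) (rule refl)
    also have "\<dots> \<longleftrightarrow> emeasure (distr lebesgue lborel T) A = 0"
      using A k by (simp add: distr_completion emeasure_density nn_integral_cmult cong: distr_cong)
    finally show ?thesis .
  qed
  then have eq: "null_sets lborel = null_sets (distr lebesgue lborel T)"
    by (auto simp: null_sets_def)
  show "T \<in> lebesgue \<rightarrow>\<^sub>M lebesgue"
    by (simp add: completion.measurable_completion2 eq measurable_completion)
  have "lebesgue = completion (density (distr lborel borel T) (\<lambda>_. ennreal k))"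
    by (subst lb) simp
  also have "\<dots> = density (completion (distr lebesgue lborel T)) (\<lambda>_. ennreal k)"
    using k by (auto intro!: always_eventually completion_density_eq simp: distr_completion cong: distr_cong)
  also have "\<dots> = density (distr lebesgue lebesgue T) (\<lambda>_. ennreal k)"
    by (subst completion.completion_distr_eq) (auto simp: eq measurable_completion)
  finally show "lebesgue = density (distr lebesgue lebesgue T) (\<lambda>_. ennreal k)" .
qed

locale affine_change =
  fixes P Q :: "real^3^3" and c :: "real^3"
  assumes PQ: "P ** Q = mat 1" and QP: "Q ** P = mat 1"
begin

definition T :: "real^3 \<Rightarrow> real^3" where "T z = P *v z + c"

definition T' :: "real^3 \<Rightarrow> real^3" where "T' x = Q *v x + - (Q *v c)"

text \<open>This is |det P|, because P and Q are inverse to each other.\<close>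

definition jac :: real where "jac = 1 / \<bar>det Q\<bar>"

lemma T_T' [simp]: "T (T' x) = x"
  by (simp add: T_def T'_def matrix_vector_right_distrib matrix_vector_mul_assoc PQ
      matrix_vector_mult_diff_distrib)

lemma T'_T [simp]: "T' (T z) = z"
  by (simp add: T_def T'_def matrix_vector_right_distrib matrix_vector_mul_assoc QP)

lemma jac_pos: "0 < jac"
  and lebesgue_eq: "lebesgue = density (distr lebesgue lebesgue T) (\<lambda>_. ennreal jac)"
  and T_measurable [measurable]: "T \<in> lebesgue \<rightarrow>\<^sub>M lebesgue"
proof -
  have *: "linear ((*v) P)" "linear ((*v) Q)" "\<And>x. P *v (Q *v x) = x" "\<And>x. Q *v (P *v x) = x"
    by (auto simp: matrix_vector_mul_assoc PQ QP)
  have m: "matrix ((*v) Q) = Q" by (simp add: matrix_of_matrix_vector_mul)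
  show "0 < jac" using det_inverse_pos[OF *] by (simp add: jac_def m)
  show "lebesgue = density (distr lebesgue lebesgue T) (\<lambda>_. ennreal jac)"
    using lebesgue_affine_linear[OF *, of c] by (simp add: jac_def m T_def[abs_def])
  show "T \<in> lebesgue \<rightarrow>\<^sub>M lebesgue"
    using measurable_affine_linear[OF *, of c] by (simp add: T_def[abs_def])
qed

lemma T_continuous: "continuous_on UNIV T"
  unfolding T_def by (intro continuous_intros matrix_vector_mult_linear_continuous_on)

lemma vimage_lebesgue: "S \<in> sets lebesgue \<Longrightarrow> T -` S \<in> sets lebesgue"
  using measurable_sets[OF T_measurable] by simp

lemma T_measurable_on: "T \<in> lebesgue_on (T -` S) \<rightarrow>\<^sub>M lebesgue_on S"
  by (rule measurable_restrict_space3[OF T_measurable]) auto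

lemma integrable_lebesgue_iff:
  fixes F :: "real^3 \<Rightarrow> 'b::{banach, second_countable_topology}"
  assumes [measurable]: "F \<in> borel_measurable lebesgue"
  shows "integrable lebesgue F \<longleftrightarrow> integrable lebesgue (\<lambda>z. F (T z))"
proof -
  have "integrable lebesgue F \<longleftrightarrow> integrable (density (distr lebesgue lebesgue T) (\<lambda>_. ennreal jac)) F"
    by (rule arg_cong[OF lebesgue_eq, of "\<lambda>M. integrable M F"])
  also have "\<dots> \<longleftrightarrow> integrable (distr lebesgue lebesgue T) (\<lambda>x. jac *\<^sub>R F x)"
    using jac_pos by (intro integrable_density) auto
  also have "\<dots> \<longleftrightarrow> integrable lebesgue (\<lambda>z. jac *\<^sub>R F (T z))"
    by (intro integrable_distr_eq) auto
  also have "\<dots> \<longleftrightarrow> integrable lebesgue (\<lambda>z. F (T z))"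
    using jac_pos integrable_scaleR_right[of jac lebesgue "\<lambda>z. F (T z)"]
      integrable_scaleR_right[of "1 / jac" lebesgue "\<lambda>z. jac *\<^sub>R F (T z)"] by auto
  finally show ?thesis .
qed

lemma integral_lebesgue_eq:
  fixes F :: "real^3 \<Rightarrow> 'b::{banach, second_countable_topology}"
  assumes [measurable]: "F \<in> borel_measurable lebesgue"
  shows "integral\<^sup>L lebesgue F = jac *\<^sub>R (LINT z|lebesgue. F (T z))"
proof -
  have "integral\<^sup>L lebesgue F = integral\<^sup>L (density (distr lebesgue lebesgue T) (\<lambda>_. ennreal jac)) F"
    by (rule arg_cong[OF lebesgue_eq, of "\<lambda>M. integral\<^sup>L M F"])
  also have "\<dots> = (LINT x|distr lebesgue lebesgue T. jac *\<^sub>R F x)"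
    using jac_pos by (intro integral_density) auto
  also have "\<dots> = (LINT z|lebesgue. jac *\<^sub>R F (T z))"
    by (intro integral_distr) auto
  finally show ?thesis by simp
qed

lemma indicator_vimage: "indicator S (T z) = (indicator (T -` S) z :: real)"
  by (simp add: indicator_def)

lemma integral_vimage:
  fixes f :: "real^3 \<Rightarrow> 'b::{banach, second_countable_topology}"
  assumes "S \<in> sets lebesgue" "f \<in> borel_measurable (lebesgue_on S)"
  shows "integral\<^sup>L (lebesgue_on S) f = jac *\<^sub>R (LINT z|lebesgue_on (T -` S). f (T z))"
  using assms vimage_lebesgue[OF assms(1)]
    integral_lebesgue_eq[of "\<lambda>x. indicator S x *\<^sub>R f x"]
  by (simp add: integral_restrict_space borel_measurable_restrict_space_iff indicator_vimage)

lemma square_integrable_vimage: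
  assumes S: "S \<in> sets lebesgue" and f: "square_integrable (lebesgue_on S) f"
  shows "square_integrable (lebesgue_on (T -` S)) (\<lambda>z. f (T z))"
proof -
  have "(\<lambda>z. f (T z)) \<in> borel_measurable (lebesgue_on (T -` S))"
    using measurable_compose[OF T_measurable_on square_integrable_measurable[OF f]] .
  moreover have "integrable lebesgue (\<lambda>x. indicator S x *\<^sub>R (cmod (f x))\<^sup>2)"
    using f S integrable_restrict_space[of S lebesgue "\<lambda>x. (cmod (f x))\<^sup>2"]
    by (simp add: square_integrable_def)
  then have "integrable lebesgue (\<lambda>z. indicator (T -` S) z *\<^sub>R (cmod (f (T z)))\<^sup>2)"
    using integrable_lebesgue_iff[of "\<lambda>x. indicator S x *\<^sub>R (cmod (f x))\<^sup>2"]
    by (simp add: indicator_vimage borel_measurable_integrable del: real_scaleR_def)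
  ultimately show ?thesis
    using vimage_lebesgue[OF S] integrable_restrict_space[of "T -` S" lebesgue "\<lambda>z. (cmod (f (T z)))\<^sup>2"]
    by (simp add: square_integrable_def)
qed

lemma sqnorm_vimage:
  assumes "S \<in> sets lebesgue" "square_integrable (lebesgue_on S) f"
  shows "sqnorm (lebesgue_on S) f = jac * sqnorm (lebesgue_on (T -` S)) (\<lambda>z. f (T z))"
  unfolding sqnorm_def using integral_vimage[OF assms(1), of "\<lambda>x. (cmod (f x))\<^sup>2"] assms(2)
  by (simp add: square_integrable_def borel_measurable_integrable)

lemma test_function_pushforward:
  assumes "\<phi> \<in> test_functions (T -` S)"
  shows "(\<lambda>x. \<phi> (T' x)) \<in> test_functions S"
proof -
  obtain K where K: "compact K" "K \<subseteq> T -` S" "\<And>x. x \<notin> K \<Longrightarrow> \<phi> x = 0" and s: "smooth_on UNIV \<phi>"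
    using assms by (auto simp: test_functions_def)
  have "smooth_on UNIV (\<lambda>x. \<phi> (T' x))"
    using s unfolding smooth_on_def T'_def
    by (intro allI Ck_on_compose_affine[OF matrix_vector_mul_bounded_linear]) auto
  moreover have "compact (T ` K)"
    by (rule compact_continuous_image[OF continuous_on_subset[OF T_continuous] K(1)]) simp
  moreover have "T ` K \<subseteq> S" using K(2) by auto
  moreover have "\<phi> (T' x) = 0" if "x \<notin> T ` K" for x
    using K(3)[of "T' x"] that by (metis T_T' imageI)
  ultimately show ?thesis by (auto simp: test_functions_def)
qed

lemma partial_pullback:
  fixes \<phi> :: "real^3 \<Rightarrow> complex"
  assumes "\<phi> differentiable (at (T z))"
  shows "partial j (\<lambda>z. \<phi> (T z)) z = (\<Sum>k\<in>UNIV. of_real (P $ k $ j) * partial k \<phi> (T z))"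
proof -
  have 1: "(T has_derivative (*v) P) (at z)"
    unfolding T_def[abs_def]
    by (auto intro!: derivative_eq_intros bounded_linear_imp_has_derivative)
  have 2: "(\<phi> has_derivative frechet_derivative \<phi> (at (T z))) (at (T z))"
    using assms by (simp add: frechet_derivative_works)
  have lin: "linear (frechet_derivative \<phi> (at (T z)))" using 2 has_derivative_linear by blast
  have "P *v axis j 1 = (\<Sum>k\<in>UNIV. P $ k $ j *\<^sub>R axis k 1)"
    unfolding matrix_vector_mult_basis
    by (simp add: vec_eq_iff column_def axis_def if_distrib cong: if_cong)
  moreover have "partial j (\<lambda>z. \<phi> (T z)) z = frechet_derivative \<phi> (at (T z)) (P *v axis j 1)"
    using frechet_derivative_at[OF diff_chain_at[OF 1 2], symmetric] by (simp add: partial_def o_def)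
  ultimately have "partial j (\<lambda>z. \<phi> (T z)) z = (\<Sum>k\<in>UNIV. P $ k $ j *\<^sub>R partial k \<phi> (T z))"
    using lin by (simp add: linear_sum linear_cmul partial_def)
  then show ?thesis by (simp add: scaleR_conv_of_real)
qed

text \<open>A potential transforms like a gradient, as a covector: both are pulled back by the
  transpose of P. The test function is pushed forward by the inverse map, so the chain rule is
  applied to a smooth function and not to f.\<close>

lemma magnetic_pairs_affine:
  assumes S: "magnetic_domain A S" and fg: "(f, g) \<in> magnetic_pairs A S"
  shows "(\<lambda>z. f (T z), \<lambda>j z. \<Sum>k\<in>UNIV. of_real (P $ k $ j) * g k (T z))
    \<in> magnetic_pairs (\<lambda>z. transpose P *v A (T z)) (T -` S)"
proof -
  interpret S: magnetic_domain A S by fact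
  let ?M = "lebesgue_on (T -` S)" and ?A = "\<lambda>z. transpose P *v A (T z)"
  have f: "square_integrable S.M f" and g: "\<And>j. square_integrable S.M (g j)" and weak: "weak_mgrad A S f g"
    using fg by (auto simp: magnetic_pairs_def)
  have A: "?A z $ j = (\<Sum>k\<in>UNIV. P $ k $ j * A (T z) $ k)" for z j
    by (simp add: matrix_vector_mult_def transpose_def)
  have "weak_mgrad ?A (T -` S) (\<lambda>z. f (T z)) (\<lambda>j z. \<Sum>k\<in>UNIV. of_real (P $ k $ j) * g k (T z))"
    unfolding weak_mgrad_def
  proof (intro ballI allI)
    fix \<phi> j assume \<phi>: "\<phi> \<in> test_functions (T -` S)"
    let ?\<phi> = "\<lambda>x. \<phi> (T' x)"
    have \<phi>': "?\<phi> \<in> test_functions S" by (rule test_function_pushforward[OF \<phi>])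
    then have s: "smooth_on UNIV ?\<phi>" by (auto simp: test_functions_def)
    note t = S.square_integrable_test[OF \<phi>']
    have d: "partial j \<phi> z = (\<Sum>k\<in>UNIV. of_real (P $ k $ j) * partial k ?\<phi> (T z))" for z
      using partial_pullback[OF smooth_on_imp_differentiable[OF s], of j z] by simp
    have i: "integrable S.M (\<lambda>x. of_real (P $ k $ j) * (f x * S.adj ?\<phi> k x))"
      "integrable S.M (\<lambda>x. of_real (P $ k $ j) * g k x * ?\<phi> x)" for k
      by (intro square_integrable_mult square_integrable_cmult integrable_mult_right f g t)+
    have "f (T z) * (\<i> * partial j \<phi> z + of_real (?A z $ j) * \<phi> z)
        = (\<Sum>k\<in>UNIV. of_real (P $ k $ j) * (f (T z) * S.adj ?\<phi> k (T z)))" for z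
      unfolding d A by (simp add: S.adj_def sum_distrib_left sum_distrib_right algebra_simps sum.distrib)
    then have "jac *\<^sub>R (LINT z|?M. f (T z) * (\<i> * partial j \<phi> z + of_real (?A z $ j) * \<phi> z))
        = jac *\<^sub>R (LINT z|?M. (\<Sum>k\<in>UNIV. of_real (P $ k $ j) * (f (T z) * S.adj ?\<phi> k (T z))))"
      by (simp only:)
    also have "\<dots> = (LINT x|S.M. (\<Sum>k\<in>UNIV. of_real (P $ k $ j) * (f x * S.adj ?\<phi> k x)))"
      by (rule integral_vimage[OF S.domain_lebesgue, symmetric])
        (intro borel_measurable_sum borel_measurable_integrable i)
    also have "\<dots> = (\<Sum>k\<in>UNIV. of_real (P $ k $ j) * (LINT x|S.M. f x * S.adj ?\<phi> k x))"
      using i(1) by (subst Bochner_Integration.integral_sum) auto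
    also have "\<dots> = (\<Sum>k\<in>UNIV. of_real (P $ k $ j) * (LINT x|S.M. g k x * ?\<phi> x))"
      using weak \<phi>' unfolding weak_mgrad_def S.adj_def by (intro sum.cong refl) auto
    also have "\<dots> = (LINT x|S.M. (\<Sum>k\<in>UNIV. of_real (P $ k $ j) * g k x * ?\<phi> x))"
      using i(2) by (subst Bochner_Integration.integral_sum) (auto simp: mult.assoc)
    also have "\<dots> = jac *\<^sub>R (LINT z|?M. (\<Sum>k\<in>UNIV. of_real (P $ k $ j) * g k (T z) * ?\<phi> (T z)))"
      by (rule integral_vimage[OF S.domain_lebesgue])
        (intro borel_measurable_sum borel_measurable_integrable i)
    also have "\<dots> = jac *\<^sub>R (LINT z|?M. (\<Sum>k\<in>UNIV. of_real (P $ k $ j) * g k (T z)) * \<phi> z)"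
      by (simp add: sum_distrib_right)
    finally show "(LINT z|?M. f (T z) * (\<i> * partial j \<phi> z + of_real (?A z $ j) * \<phi> z))
        = (LINT z|?M. (\<Sum>k\<in>UNIV. of_real (P $ k $ j) * g k (T z)) * \<phi> z)"
      using jac_pos by simp
  qed
  then show ?thesis
    unfolding magnetic_pairs_def
    using square_integrable_vimage[OF S.domain_lebesgue] f g
    by (auto intro!: square_integrable_sum square_integrable_cmult)
qed

end

section \<open>Averaging over window positions\<close>

lemma nn_integral_reflect_translate:
  fixes h :: "'a::euclidean_space \<Rightarrow> ennreal"
  assumes [measurable]: "h \<in> borel_measurable borel"
  shows "(\<integral>\<^sup>+p. h (x - p) \<partial>lborel) = (\<integral>\<^sup>+p. h p \<partial>lborel)"
proof -
  have "(\<integral>\<^sup>+p. h p \<partial>lborel) = (\<integral>\<^sup>+p. h p \<partial>distr lborel borel (\<lambda>p. x + (-1) *\<^sub>R p))"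
    using lborel_affine[of "-1" x] by (simp add: density_1)
  also have "\<dots> = (\<integral>\<^sup>+p. h (x - p) \<partial>lborel)"
    by (subst nn_integral_distr) auto
  finally show ?thesis by simp
qed

text \<open>Tonelli: integrating over the position p first yields the full integral of h, whatever x
  is.\<close>

lemma nn_integral_moving_window:
  fixes h F :: "'a::euclidean_space \<Rightarrow> ennreal"
  assumes [measurable]: "h \<in> borel_measurable borel" "F \<in> borel_measurable borel"
  shows "(\<integral>\<^sup>+p. (\<integral>\<^sup>+x. h (x - p) * F x \<partial>lborel) \<partial>lborel) = (\<integral>\<^sup>+x. h x \<partial>lborel) * (\<integral>\<^sup>+x. F x \<partial>lborel)"
proof -
  have "(\<integral>\<^sup>+p. (\<integral>\<^sup>+x. h (x - p) * F x \<partial>lborel) \<partial>lborel) = (\<integral>\<^sup>+x. (\<integral>\<^sup>+p. h (x - p) * F x \<partial>lborel) \<partial>lborel)"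
    by (rule lborel_pair.Fubini') simp
  also have "\<dots> = (\<integral>\<^sup>+x. (\<integral>\<^sup>+x. h x \<partial>lborel) * F x \<partial>lborel)"
    by (simp add: nn_integral_multc nn_integral_reflect_translate)
  finally show ?thesis by (simp add: nn_integral_cmult)
qed

text \<open>Averaging over all positions of the window: some position does at least as well as the mean.\<close>

lemma good_window_exists:
  fixes h k F G :: "'a::euclidean_space \<Rightarrow> ennreal"
  assumes [measurable]: "h \<in> borel_measurable borel" "k \<in> borel_measurable borel"
      "F \<in> borel_measurable borel" "G \<in> borel_measurable borel"
    and less: "(\<integral>\<^sup>+x. h x \<partial>lborel) * (\<integral>\<^sup>+x. G x \<partial>lborel) + (\<integral>\<^sup>+x. k x \<partial>lborel) * (\<integral>\<^sup>+x. F x \<partial>lborel)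
      < K * ((\<integral>\<^sup>+x. h x \<partial>lborel) * (\<integral>\<^sup>+x. F x \<partial>lborel))"
  shows "\<exists>p. (\<integral>\<^sup>+x. h (x - p) * G x + k (x - p) * F x \<partial>lborel) < K * (\<integral>\<^sup>+x. h (x - p) * F x \<partial>lborel)"
proof (rule ccontr)
  assume "\<not> ?thesis"
  then have "(\<integral>\<^sup>+p. K * (\<integral>\<^sup>+x. h (x - p) * F x \<partial>lborel) \<partial>lborel)
      \<le> (\<integral>\<^sup>+p. (\<integral>\<^sup>+x. h (x - p) * G x + k (x - p) * F x \<partial>lborel) \<partial>lborel)"
    by (intro nn_integral_mono) (simp add: not_less)
  also have "\<dots> = (\<integral>\<^sup>+p. (\<integral>\<^sup>+x. h (x - p) * G x \<partial>lborel) + (\<integral>\<^sup>+x. k (x - p) * F x \<partial>lborel) \<partial>lborel)"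
    by (simp add: nn_integral_add)
  also have "\<dots> = (\<integral>\<^sup>+x. h x \<partial>lborel) * (\<integral>\<^sup>+x. G x \<partial>lborel) + (\<integral>\<^sup>+x. k x \<partial>lborel) * (\<integral>\<^sup>+x. F x \<partial>lborel)"
    by (subst nn_integral_add) (auto simp: nn_integral_moving_window intro!: lborel.borel_measurable_nn_integral)
  finally show False
    using less by (simp add: nn_integral_cmult nn_integral_moving_window lborel.borel_measurable_nn_integral)
qed

section \<open>Localization\<close>

text \<open>Young's inequality with weight \<delta>: the first term keeps a factor close to 1, and
  the second pays with 1/\<delta>.\<close>

lemma cmod_add_squared_weighted:
  assumes "\<delta> > 0"
  shows "(cmod (a + b))\<^sup>2 \<le> (1 + \<delta>) * (cmod a)\<^sup>2 + (1 + 1 / \<delta>) * (cmod b)\<^sup>2"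
proof -
  have "0 \<le> (\<delta> * cmod a - cmod b)\<^sup>2 / \<delta>" using assms by simp
  also have "\<dots> = \<delta> * (cmod a)\<^sup>2 - 2 * cmod a * cmod b + (cmod b)\<^sup>2 / \<delta>"
    using assms by (simp add: power2_diff field_simps power2_eq_square)
  finally have "(cmod a + cmod b)\<^sup>2 \<le> (1 + \<delta>) * (cmod a)\<^sup>2 + (1 + 1 / \<delta>) * (cmod b)\<^sup>2"
    by (simp add: power2_sum algebra_simps)
  moreover have "(cmod (a + b))\<^sup>2 \<le> (cmod a + cmod b)\<^sup>2"
    by (intro power_mono norm_triangle_ineq norm_ge_zero)
  ultimately show ?thesis by linarith
qed

text \<open>Tonelli is applied to Borel densities on the whole space, while u is only Lebesgue
  measurable on S. Extension by zero and a Borel version provide one density U that serves all Borel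
  weights w at once.\<close>

lemma ex_borel_version:
  fixes u :: "'a::euclidean_space \<Rightarrow> ennreal"
  assumes S: "S \<in> sets lebesgue" and u: "u \<in> borel_measurable (lebesgue_on S)"
  shows "\<exists>U\<in>borel_measurable borel. \<forall>w\<in>borel_measurable borel.
    (\<integral>\<^sup>+x. w x * u x \<partial>lebesgue_on S) = (\<integral>\<^sup>+x. w x * U x \<partial>lborel)"
proof -
  have "(\<lambda>x. u x * indicator S x) \<in> borel_measurable lebesgue"
    using u S by (simp add: borel_measurable_restrict_space_iff_ennreal)
  then obtain U where U: "U \<in> borel_measurable lborel" "AE x in lborel. u x * indicator S x = U x"
    using completion_ex_borel_measurable by blast
  have "(\<integral>\<^sup>+x. w x * u x \<partial>lebesgue_on S) = (\<integral>\<^sup>+x. w x * U x \<partial>lborel)"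
    if w[measurable]: "w \<in> borel_measurable borel" for w
  proof -
    have "(\<integral>\<^sup>+x. w x * u x \<partial>lebesgue_on S) = (\<integral>\<^sup>+x. w x * (u x * indicator S x) \<partial>lebesgue)"
      using S by (simp add: nn_integral_restrict_space mult.assoc)
    also have "\<dots> = (\<integral>\<^sup>+x. w x * U x \<partial>lebesgue)"
    proof (rule nn_integral_cong_AE)
      show "AE x in lebesgue. w x * (u x * indicator S x) = w x * U x"
        using AE_completion[OF U(2)] by eventually_elim simp
    qed
    also have "\<dots> = (\<integral>\<^sup>+x. w x * U x \<partial>lborel)"
      using U(1) by (intro nn_integral_completion)
    finally show ?thesis .
  qed
  then show ?thesis using U(1) by auto
qed

lemma nn_integral_dilate:
  fixes h :: "'a::euclidean_space \<Rightarrow> ennreal"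
  assumes [measurable]: "h \<in> borel_measurable borel" and R: "R > 0"
  shows "(\<integral>\<^sup>+x. h ((1 / R) *\<^sub>R x) \<partial>lborel) = ennreal (R ^ DIM('a)) * (\<integral>\<^sup>+x. h x \<partial>lborel)"
proof -
  have "(\<integral>\<^sup>+x. h ((1 / R) *\<^sub>R x) \<partial>lborel)
      = (\<integral>\<^sup>+x. h ((1 / R) *\<^sub>R x) \<partial>density (distr lborel borel (\<lambda>x. 0 + R *\<^sub>R x)) (\<lambda>_. ennreal (R ^ DIM('a))))"
    using lborel_affine[of R "0::'a"] R by simp
  also have "\<dots> = (\<integral>\<^sup>+x. ennreal (R ^ DIM('a)) * h ((1 / R) *\<^sub>R (R *\<^sub>R x)) \<partial>lborel)"
    by (simp add: nn_integral_density nn_integral_distr)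
  also have "\<dots> = ennreal (R ^ DIM('a)) * (\<integral>\<^sup>+x. h x \<partial>lborel)"
    using R by (simp add: nn_integral_cmult)
  finally show ?thesis .
qed

definition window :: "real^3 \<Rightarrow> real" where "window = box_bump 1 (vec (-1)) (vec 1)"

definition window_at :: "real \<Rightarrow> real^3 \<Rightarrow> real^3 \<Rightarrow> real" where
  "window_at R p x = window ((1 / R) *\<^sub>R (x - p))"

lemma smooth_window: "smooth_on UNIV window"
  by (simp add: smooth_on_def window_def Ck_on_box_bump)

lemma smooth_window_at: "smooth_on UNIV (\<lambda>x. complex_of_real (window_at R p x))"
proof -
  have "Ck_on k UNIV (\<lambda>x. window ((1 / R) *\<^sub>R x + (- (1 / R)) *\<^sub>R p))" for k
    using smooth_window
    by (intro Ck_on_compose_affine bounded_linear_scaleR_right) (auto simp: smooth_on_def)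
  then have "Ck_on k UNIV (window_at R p)" for k
    unfolding window_at_def by (simp add: scaleR_diff_right)
  then show ?thesis
    unfolding smooth_on_def by (intro allI Ck_on_bounded_linear[OF _ bounded_linear_of_real]) auto
qed

lemma partial_window_at:
  assumes "R > 0"
  shows "partial j (\<lambda>x. complex_of_real (window_at R p x)) x
    = of_real ((1 / R) * partial j window ((1 / R) *\<^sub>R (x - p)))"
proof -
  have 1: "((\<lambda>x. (1 / R) *\<^sub>R (x - p)) has_derivative (\<lambda>v. (1 / R) *\<^sub>R v)) (at x)"
    by (auto intro!: derivative_eq_intros)
  let ?y = "(1 / R) *\<^sub>R (x - p)"
  have 2: "(window has_derivative frechet_derivative window (at ?y)) (at ?y)"
    using smooth_on_imp_differentiable[OF smooth_window] by (simp add: frechet_derivative_works)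
  have lin: "linear (frechet_derivative window (at ?y))" using 2 has_derivative_linear by blast
  have "((\<lambda>x. complex_of_real (window_at R p x)) has_derivative
      (\<lambda>v. of_real (frechet_derivative window (at ?y) ((1 / R) *\<^sub>R v)))) (at x)"
    using bounded_linear.has_derivative[OF bounded_linear_of_real diff_chain_at[OF 1 2]]
    by (simp add: o_def window_at_def)
  from frechet_derivative_at[OF this, symmetric] show ?thesis
    using lin by (simp add: partial_def linear_cmul)
qed

lemma window_outside: "x \<notin> cbox (vec (-1)) (vec 1) \<Longrightarrow> window x = 0"
  unfolding window_def using box_subset_cbox by (intro box_bump_eq_0) auto

lemma window_at_support:
  assumes "R > 0" "x \<notin> cball p (2 * R)"
  shows "window_at R p x = 0"
proof -
  have "(1 / R) *\<^sub>R (x - p) \<notin> cbox (vec (-1)) (vec 1)"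
  proof
    assume "(1 / R) *\<^sub>R (x - p) \<in> cbox (vec (-1)) (vec 1)"
    then have *: "\<bar>x $ i - p $ i\<bar> \<le> R" for i
      using assms(1) by (auto simp: mem_box_cart abs_le_iff field_simps dest!: spec[of _ i])
    have "(norm (x - p))\<^sup>2 = (\<Sum>i\<in>UNIV. (x $ i - p $ i)\<^sup>2)"
      by (simp add: norm_vec_def L2_set_def sum_nonneg)
    also have "\<dots> \<le> (\<Sum>i\<in>(UNIV::3 set). R\<^sup>2)"
    proof (rule sum_mono)
      fix i show "(x $ i - p $ i)\<^sup>2 \<le> R\<^sup>2" using power_mono[OF *[of i] abs_ge_zero, of 2] by simp
    qed
    \<comment> \<open>Three coordinates give the diagonal factor sqrt 3 < 2, whence the radius 2
      R.\<close>
    also have "\<dots> \<le> (2 * R)\<^sup>2" by (simp add: power_mult_distrib)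
    finally have "norm (x - p) \<le> 2 * R" by (rule power2_le_imp_le) (use assms(1) in simp)
    then show False using assms(2) by (simp add: dist_norm norm_minus_commute)
  qed
  then show ?thesis by (simp add: window_at_def window_outside)
qed

lemma window_integrals:
  obtains \<alpha> \<beta> where "0 < \<alpha>" "0 \<le> \<beta>" "(\<integral>\<^sup>+x. ennreal ((window x)\<^sup>2) \<partial>lborel) = ennreal \<alpha>"
    "(\<integral>\<^sup>+x. ennreal (\<Sum>j\<in>UNIV. (partial j window x)\<^sup>2) \<partial>lborel) = ennreal \<beta>"
proof -
  let ?K = "cbox (vec (-1)) (vec 1) :: (real^3) set"
  have fin: "\<exists>c\<ge>0. (\<integral>\<^sup>+x. ennreal (u x) \<partial>lborel) = ennreal c"
    if "continuous_on UNIV u" "\<And>x. 0 \<le> u x" "\<And>x. x \<notin> ?K \<Longrightarrow> u x = 0" for u :: "real^3 \<Rightarrow> real"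
  proof -
    have "integrable lborel (\<lambda>x. indicator ?K x *\<^sub>R u x)"
      by (rule borel_integrable_compact[OF compact_cbox continuous_on_subset[OF that(1)]]) simp
    moreover have "(\<lambda>x. indicator ?K x *\<^sub>R u x) = u" using that(3) by (force simp: indicator_def)
    ultimately have "integrable lborel u" by (simp only:)
    then show ?thesis
      using that(2) by (intro exI[of _ "integral\<^sup>L lborel u"]) (auto intro: nn_integral_eq_integral)
  qed
  have c: "continuous_on UNIV window" "continuous_on UNIV (partial j window)" for j
    using smooth_on_imp_continuous smooth_window smooth_on_partial by auto
  have out: "partial j window x = 0" if "x \<notin> ?K" for j x
    by (rule partial_eq_0_outside[OF closed_cbox window_outside that])
  obtain \<alpha> where a: "0 \<le> \<alpha>" "(\<integral>\<^sup>+x. ennreal ((window x)\<^sup>2) \<partial>lborel) = ennreal \<alpha>"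
    using fin[of "\<lambda>x. (window x)\<^sup>2"] c window_outside by (auto intro: continuous_intros)
  obtain \<beta> where b: "0 \<le> \<beta>" "(\<integral>\<^sup>+x. ennreal (\<Sum>j\<in>UNIV. (partial j window x)\<^sup>2) \<partial>lborel) = ennreal \<beta>"
  proof -
    have "\<exists>c\<ge>0. (\<integral>\<^sup>+x. ennreal (\<Sum>j\<in>UNIV. (partial j window x)\<^sup>2) \<partial>lborel) = ennreal c"
      by (rule fin) (use c out in \<open>auto intro!: continuous_intros sum_nonneg\<close>)
    then show ?thesis using that by blast
  qed
  \<comment> \<open>The window is positive on a nonempty open box, which is not negligible. The
    constant in \<open>localization\<close> has this mass as its denominator.\<close>
  have "\<alpha> \<noteq> 0"
  proof
    assume "\<alpha> = 0"
    then have "AE x in lborel. ennreal ((window x)\<^sup>2) = 0"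
      using a(2) borel_measurable_continuous_onI[OF c(1)]
      by (intro nn_integral_0_iff_AE[THEN iffD1]) auto
    then have "AE x in lborel. x \<notin> box (vec (-1)) (vec 1 :: real^3)"
      by eventually_elim (use box_bump_pos[of 1 "vec (-1)" "vec 1"] in \<open>force simp: window_def\<close>)
    then have "negligible (box (vec (-1)) (vec 1 :: real^3))"
      by (simp add: negligible_iff_null_sets AE_iff_null_sets[symmetric] null_sets_completionI)
    moreover have "(0::real^3) \<in> box (vec (-1)) (vec 1)" by (simp add: mem_box_cart)
    ultimately show False by (metis all_not_in_conv negligible_interval(2))
  qed
  then show ?thesis using that a b by simp
qed

text \<open>Integrated over all positions, the mass of the window scales like R^3 and its Dirichlet
  energy like R^3/R^2, so on average a cutoff costs c/R^2. The constant c is quantified outermost: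
  it depends on the window alone, which lets R be fixed before the cone.\<close>

lemma localization:
  "\<exists>c\<ge>0. \<forall>A S f g m \<delta> R. magnetic_domain A S \<longrightarrow> (f, g) \<in> magnetic_pairs A S \<longrightarrow>
      sqnorm (lebesgue_on S) f = 1 \<longrightarrow> energy S g < m \<longrightarrow> \<delta> > 0 \<longrightarrow> R > 0 \<longrightarrow>
      (\<exists>p. energy S (\<lambda>j x. of_real (window_at R p x) * g j x
              - \<i> * partial j (\<lambda>x. of_real (window_at R p x)) x * f x)
          < ((1 + \<delta>) * m + (1 + 1 / \<delta>) * (c / R\<^sup>2))
            * sqnorm (lebesgue_on S) (\<lambda>x. of_real (window_at R p x) * f x))"
proof -
  obtain \<alpha> \<beta> where ab: "0 < \<alpha>" "0 \<le> \<beta>" "(\<integral>\<^sup>+x. ennreal ((window x)\<^sup>2) \<partial>lborel) = ennreal \<alpha>"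
    "(\<integral>\<^sup>+x. ennreal (\<Sum>j\<in>UNIV. (partial j window x)\<^sup>2) \<partial>lborel) = ennreal \<beta>"
    by (rule window_integrals)
  have cont: "continuous_on UNIV window" "continuous_on UNIV (partial j window)" for j
    using smooth_on_imp_continuous smooth_window smooth_on_partial by auto
  have [measurable]: "window \<in> borel_measurable borel" "partial j window \<in> borel_measurable borel" for j
    using cont by (auto intro: borel_measurable_continuous_onI)
  show ?thesis
  \<comment> \<open>Dirichlet energy of the window divided by its mass.\<close>
  proof (intro exI[of _ "\<beta> / \<alpha>"] conjI allI impI)
    show "0 \<le> \<beta> / \<alpha>" using ab by simp
    fix A S f g and m \<delta> R :: real
    assume S: "magnetic_domain A S" and fg: "(f, g) \<in> magnetic_pairs A S"
      and one: "sqnorm (lebesgue_on S) f = 1" and less: "energy S g < m" and \<delta>: "\<delta> > 0" and R: "R > 0"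
    interpret S: magnetic_domain A S by fact
    have f: "square_integrable S.M f" and g: "square_integrable S.M (g j)" for j
      using fg by (auto simp: magnetic_pairs_def)
    have m: "0 < m" using less energy_nonneg[of S g] by linarith
    let ?K = "(1 + \<delta>) * m + (1 + 1 / \<delta>) * (\<beta> / \<alpha> / R\<^sup>2)"
    \<comment> \<open>The weight \<open>h\<close> goes with the energy density of the given pair,
      the weight \<open>k\<close> with the part created by differentiating the cutoff. Young's
      factor 1 + \<delta> sits in \<open>?G\<close>, the factor 1 + 1/\<delta> in
      \<open>k\<close>.\<close>
    define h where "h x = ennreal ((window ((1 / R) *\<^sub>R x))\<^sup>2)" for x
    define k where "k x = ennreal ((1 + 1 / \<delta>) * (1 / R\<^sup>2) * (\<Sum>j\<in>UNIV. (partial j window ((1 / R) *\<^sub>R x))\<^sup>2))" for x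
    have meas[measurable]: "h \<in> borel_measurable borel" "k \<in> borel_measurable borel"
      unfolding h_def k_def by measurable
    have fm[measurable]: "f \<in> borel_measurable S.M" "g j \<in> borel_measurable S.M" for j
      using f g square_integrable_measurable by auto
    let ?F = "\<lambda>x. ennreal ((cmod (f x))\<^sup>2)"
    let ?G = "\<lambda>x. ennreal ((1 + \<delta>) * (\<Sum>j\<in>UNIV. (cmod (g j x))\<^sup>2))"
    obtain F where F[measurable]: "F \<in> borel_measurable borel"
      and F_eq: "\<And>w. w \<in> borel_measurable borel \<Longrightarrow> (\<integral>\<^sup>+x. w x * ?F x \<partial>S.M) = (\<integral>\<^sup>+x. w x * F x \<partial>lborel)"
      using ex_borel_version[OF S.domain_lebesgue, of ?F] by auto
    obtain G where G[measurable]: "G \<in> borel_measurable borel"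
      and G_eq: "\<And>w. w \<in> borel_measurable borel \<Longrightarrow> (\<integral>\<^sup>+x. w x * ?G x \<partial>S.M) = (\<integral>\<^sup>+x. w x * G x \<partial>lborel)"
      using ex_borel_version[OF S.domain_lebesgue, of ?G] by auto
    have nn_sq: "(\<integral>\<^sup>+x. ennreal ((cmod (u x))\<^sup>2) \<partial>S.M) = ennreal (sqnorm S.M u)" if "square_integrable S.M u" for u
      unfolding sqnorm_def using that by (intro nn_integral_eq_integral) (auto simp: square_integrable_def)
    have intF: "(\<integral>\<^sup>+x. F x \<partial>lborel) = 1"
      using F_eq[of "\<lambda>_. 1"] nn_sq[OF f] one by simp
    have nn_energy: "(\<integral>\<^sup>+x. ennreal (\<Sum>j\<in>UNIV. (cmod (u j x))\<^sup>2) \<partial>S.M) = ennreal (energy S u)"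
      if "\<And>j. square_integrable S.M (u j)" for u
    proof -
      have [measurable]: "u j \<in> borel_measurable S.M" for j using that square_integrable_measurable by auto
      have "(\<integral>\<^sup>+x. ennreal (\<Sum>j\<in>UNIV. (cmod (u j x))\<^sup>2) \<partial>S.M) = (\<Sum>j\<in>UNIV. ennreal (sqnorm S.M (u j)))"
        by (subst sum_ennreal[symmetric], simp, subst nn_integral_sum) (simp_all add: nn_sq[OF that] del: sum_ennreal)
      then show ?thesis by (simp add: energy_def sum_ennreal sqnorm_nonneg)
    qed
    have intG: "(\<integral>\<^sup>+x. G x \<partial>lborel) = ennreal ((1 + \<delta>) * energy S g)"
    proof -
      have "(\<integral>\<^sup>+x. G x \<partial>lborel) = (\<integral>\<^sup>+x. ?G x \<partial>S.M)" using G_eq[of "\<lambda>_. 1"] by simp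
      also have "\<dots> = (\<integral>\<^sup>+x. ennreal (1 + \<delta>) * ennreal (\<Sum>j\<in>UNIV. (cmod (g j x))\<^sup>2) \<partial>S.M)"
        using \<delta> by (intro nn_integral_cong ennreal_mult') simp
      also have "\<dots> = ennreal (1 + \<delta>) * ennreal (energy S g)"
        by (simp add: nn_integral_cmult nn_energy[OF g])
      finally show ?thesis using \<delta> by (simp add: ennreal_mult')
    qed
    have inth: "(\<integral>\<^sup>+x. h x \<partial>lborel) = ennreal (R ^ 3 * \<alpha>)"
      unfolding h_def using nn_integral_dilate[of "\<lambda>x. ennreal ((window x)\<^sup>2)" R] R ab
      by (simp add: ennreal_mult')
    have intk: "(\<integral>\<^sup>+x. k x \<partial>lborel) = ennreal ((1 + 1 / \<delta>) * (1 / R\<^sup>2) * (R ^ 3 * \<beta>))"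
    proof -
      have "(\<integral>\<^sup>+x. k x \<partial>lborel) = ennreal ((1 + 1 / \<delta>) * (1 / R\<^sup>2))
          * (\<integral>\<^sup>+x. ennreal (\<Sum>j\<in>UNIV. (partial j window ((1 / R) *\<^sub>R x))\<^sup>2) \<partial>lborel)"
      proof (subst nn_integral_cmult[symmetric])
        show "(\<integral>\<^sup>+x. k x \<partial>lborel) = (\<integral>\<^sup>+x. ennreal ((1 + 1 / \<delta>) * (1 / R\<^sup>2))
            * ennreal (\<Sum>j\<in>UNIV. (partial j window ((1 / R) *\<^sub>R x))\<^sup>2) \<partial>lborel)"
          unfolding k_def using \<delta> by (intro nn_integral_cong ennreal_mult') simp
      qed measurable
      also have "(\<integral>\<^sup>+x. ennreal (\<Sum>j\<in>UNIV. (partial j window ((1 / R) *\<^sub>R x))\<^sup>2) \<partial>lborel) = ennreal (R ^ 3 * \<beta>)"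
        using nn_integral_dilate[of "\<lambda>x. ennreal (\<Sum>j\<in>UNIV. (partial j window x)\<^sup>2)" R] R ab
        by (simp add: ennreal_mult')
      also have "ennreal ((1 + 1 / \<delta>) * (1 / R\<^sup>2)) * ennreal (R ^ 3 * \<beta>)
          = ennreal ((1 + 1 / \<delta>) * (1 / R\<^sup>2) * (R ^ 3 * \<beta>))"
        using \<delta> by (intro ennreal_mult'[symmetric]) simp
      finally show ?thesis .
    qed
    have "\<exists>p. (\<integral>\<^sup>+x. h (x - p) * G x + k (x - p) * F x \<partial>lborel) < ennreal ?K * (\<integral>\<^sup>+x. h (x - p) * F x \<partial>lborel)"
    proof (rule good_window_exists)
      have "R ^ 3 * \<alpha> * ((1 + \<delta>) * energy S g) < R ^ 3 * \<alpha> * ((1 + \<delta>) * m)"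
        using R ab \<delta> less by (intro mult_strict_left_mono) auto
      moreover have "(1 + 1 / \<delta>) * (1 / R\<^sup>2) * (R ^ 3 * \<beta>) = R ^ 3 * \<alpha> * ((1 + 1 / \<delta>) * (\<beta> / \<alpha> / R\<^sup>2))"
        using ab by simp
      ultimately have "R ^ 3 * \<alpha> * ((1 + \<delta>) * energy S g) + (1 + 1 / \<delta>) * (1 / R\<^sup>2) * (R ^ 3 * \<beta>)
          < ?K * (R ^ 3 * \<alpha>)"
        by (simp only: distrib_left mult.commute)
      then show "(\<integral>\<^sup>+x. h x \<partial>lborel) * (\<integral>\<^sup>+x. G x \<partial>lborel) + (\<integral>\<^sup>+x. k x \<partial>lborel) * (\<integral>\<^sup>+x. F x \<partial>lborel)
          < ennreal ?K * ((\<integral>\<^sup>+x. h x \<partial>lborel) * (\<integral>\<^sup>+x. F x \<partial>lborel))"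
        unfolding inth intG intk intF mult_1_right
        using R ab \<delta> m energy_nonneg[of S g]
        by (simp add: ennreal_mult'[symmetric] ennreal_plus[symmetric] ennreal_less_iff del: ennreal_plus)
    qed auto
    then obtain p where p: "(\<integral>\<^sup>+x. h (x - p) * G x + k (x - p) * F x \<partial>lborel)
        < ennreal ?K * (\<integral>\<^sup>+x. h (x - p) * F x \<partial>lborel)" by blast
    let ?\<psi> = "\<lambda>x. complex_of_real (window_at R p x)"
    let ?f = "\<lambda>x. ?\<psi> x * f x" and ?g = "\<lambda>j x. ?\<psi> x * g j x - \<i> * partial j ?\<psi> x * f x"
    have "(?f, ?g) \<in> magnetic_pairs A S"
      using R by (intro magnetic_pairs_cutoff[OF S S.open_domain smooth_window_at compact_cball[of p "2 * R"] _ refl fg]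
          window_at_support) auto
    then have f': "square_integrable S.M ?f" and g': "square_integrable S.M (?g j)" for j
      by (auto simp: magnetic_pairs_def)
    have "ennreal (energy S ?g) = (\<integral>\<^sup>+x. ennreal (\<Sum>j\<in>UNIV. (cmod (?g j x))\<^sup>2) \<partial>S.M)"
      by (rule nn_energy[OF g', symmetric])
    also have "\<dots> \<le> (\<integral>\<^sup>+x. h (x - p) * ?G x + k (x - p) * ?F x \<partial>S.M)"
    proof (rule nn_integral_mono)
      fix x
      have "(\<Sum>j\<in>UNIV. (cmod (?g j x))\<^sup>2)
          \<le> (\<Sum>j\<in>UNIV. (1 + \<delta>) * (window ((1 / R) *\<^sub>R (x - p)))\<^sup>2 * (cmod (g j x))\<^sup>2
             + (1 + 1 / \<delta>) * (1 / R\<^sup>2) * (partial j window ((1 / R) *\<^sub>R (x - p)))\<^sup>2 * (cmod (f x))\<^sup>2)"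
      proof (rule sum_mono)
        fix j
        have n1: "(cmod (?\<psi> x * g j x))\<^sup>2 = (window ((1 / R) *\<^sub>R (x - p)))\<^sup>2 * (cmod (g j x))\<^sup>2"
          by (simp add: norm_mult power_mult_distrib window_at_def)
        have n2: "(cmod (- (\<i> * partial j ?\<psi> x * f x)))\<^sup>2
            = (1 / R\<^sup>2) * (partial j window ((1 / R) *\<^sub>R (x - p)))\<^sup>2 * (cmod (f x))\<^sup>2"
          unfolding partial_window_at[OF R] norm_minus_cancel norm_mult power_mult_distrib norm_of_real
          by (simp add: power_divide power_mult_distrib)
        show "(cmod (?g j x))\<^sup>2 \<le> (1 + \<delta>) * (window ((1 / R) *\<^sub>R (x - p)))\<^sup>2 * (cmod (g j x))\<^sup>2
             + (1 + 1 / \<delta>) * (1 / R\<^sup>2) * (partial j window ((1 / R) *\<^sub>R (x - p)))\<^sup>2 * (cmod (f x))\<^sup>2"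
          using cmod_add_squared_weighted[OF \<delta>, of "?\<psi> x * g j x" "- (\<i> * partial j ?\<psi> x * f x)"]
          unfolding n1 n2 by (simp add: mult.assoc)
      qed
      also have "\<dots> = (window ((1 / R) *\<^sub>R (x - p)))\<^sup>2 * ((1 + \<delta>) * (\<Sum>j\<in>UNIV. (cmod (g j x))\<^sup>2))
          + (1 + 1 / \<delta>) * (1 / R\<^sup>2) * (\<Sum>j\<in>UNIV. (partial j window ((1 / R) *\<^sub>R (x - p)))\<^sup>2) * (cmod (f x))\<^sup>2"
        by (simp add: sum.distrib sum_distrib_left sum_distrib_right mult_ac)
      finally have le: "(\<Sum>j\<in>UNIV. (cmod (?g j x))\<^sup>2)
          \<le> (window ((1 / R) *\<^sub>R (x - p)))\<^sup>2 * ((1 + \<delta>) * (\<Sum>j\<in>UNIV. (cmod (g j x))\<^sup>2))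
          + (1 + 1 / \<delta>) * (1 / R\<^sup>2) * (\<Sum>j\<in>UNIV. (partial j window ((1 / R) *\<^sub>R (x - p)))\<^sup>2) * (cmod (f x))\<^sup>2"
        (is "_ \<le> ?a + ?b") .
      have nn: "0 \<le> (1 + \<delta>) * (\<Sum>j\<in>UNIV. (cmod (g j x))\<^sup>2)"
        "0 \<le> (1 + 1 / \<delta>) * (1 / R\<^sup>2) * (\<Sum>j\<in>UNIV. (partial j window ((1 / R) *\<^sub>R (x - p)))\<^sup>2)"
        using \<delta> by (intro mult_nonneg_nonneg sum_nonneg; simp)+
      have "h (x - p) * ?G x = ennreal ?a"
        unfolding h_def by (rule ennreal_mult'[symmetric]) simp
      moreover have "k (x - p) * ?F x = ennreal ?b"
        unfolding k_def by (rule ennreal_mult'[symmetric]) (rule nn)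
      moreover have "0 \<le> ?a" "0 \<le> ?b"
        by (rule mult_nonneg_nonneg[OF zero_le_power2 nn(1)], rule mult_nonneg_nonneg[OF nn(2) zero_le_power2])
      ultimately have "h (x - p) * ?G x + k (x - p) * ?F x = ennreal (?a + ?b)"
        by (simp only: ennreal_plus)
      then show "ennreal (\<Sum>j\<in>UNIV. (cmod (?g j x))\<^sup>2) \<le> h (x - p) * ?G x + k (x - p) * ?F x"
        using le by (simp only: ennreal_leI)
    qed
    also have "\<dots> = (\<integral>\<^sup>+x. h (x - p) * ?G x \<partial>S.M) + (\<integral>\<^sup>+x. k (x - p) * ?F x \<partial>S.M)"
    proof (rule nn_integral_add)
      have "(\<lambda>x. h (x - p)) \<in> borel_measurable S.M" "(\<lambda>x. k (x - p)) \<in> borel_measurable S.M"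
        by (intro measurable_restrict_space1 measurable_completion; simp)+
      then show "(\<lambda>x. h (x - p) * ?G x) \<in> borel_measurable S.M" "(\<lambda>x. k (x - p) * ?F x) \<in> borel_measurable S.M"
        by measurable
    qed
    also have "\<dots> = (\<integral>\<^sup>+x. h (x - p) * G x + k (x - p) * F x \<partial>lborel)"
      by (simp add: G_eq F_eq nn_integral_add)
    also have "\<dots> < ennreal ?K * (\<integral>\<^sup>+x. h (x - p) * F x \<partial>lborel)" by (rule p)
    also have "(\<integral>\<^sup>+x. h (x - p) * F x \<partial>lborel) = (\<integral>\<^sup>+x. h (x - p) * ?F x \<partial>S.M)"
      by (simp add: F_eq)
    also have "\<dots> = (\<integral>\<^sup>+x. ennreal ((cmod (?f x))\<^sup>2) \<partial>S.M)"
      by (simp add: h_def window_at_def norm_mult power_mult_distrib ennreal_mult')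
    also have "\<dots> = ennreal (sqnorm S.M ?f)" by (rule nn_sq[OF f'])
    also have "ennreal ?K * ennreal (sqnorm S.M ?f) = ennreal (?K * sqnorm S.M ?f)"
      using m \<delta> ab by (simp add: ennreal_mult')
    finally have "energy S ?g < ?K * sqnorm S.M ?f"
      by (simp add: ennreal_less_iff energy_nonneg)
    then show "\<exists>p. energy S (\<lambda>j x. of_real (window_at R p x) * g j x
              - \<i> * partial j (\<lambda>x. of_real (window_at R p x)) x * f x)
          < ?K * sqnorm S.M (\<lambda>x. of_real (window_at R p x) * f x)" by blast
  qed
qed

section \<open>Transplantation between cones\<close>

text \<open>The norm of a nested vector is the Frobenius norm: it dominates the operator norm and
  can be summed over rows or over columns.\<close>

lemma norm_matrix_squared: "(norm M)\<^sup>2 = (\<Sum>j\<in>UNIV. (norm (M $ j))\<^sup>2)" for M :: "real^'n^'m"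
  by (simp add: norm_vec_def L2_set_def sum_nonneg)

lemma norm_vector_squared: "(norm v)\<^sup>2 = (\<Sum>j\<in>UNIV. (v $ j)\<^sup>2)" for v :: "real^'n"
  by (simp add: norm_vec_def L2_set_def sum_nonneg)

lemma norm_matrix_vector_mult_squared_le:
  fixes M :: "real^'n^'m"
  shows "(norm (M *v x))\<^sup>2 \<le> (norm M)\<^sup>2 * (norm x)\<^sup>2"
proof -
  have "((M *v x) $ j)\<^sup>2 \<le> (norm (M $ j))\<^sup>2 * (norm x)\<^sup>2" for j
    using power_mono[OF Cauchy_Schwarz_ineq2[of "M $ j" x] abs_ge_zero, of 2]
    by (simp add: matrix_mult_dot row_def power_mult_distrib)
  then show ?thesis
    unfolding norm_vector_squared[of "M *v x"] norm_matrix_squared sum_distrib_right by (rule sum_mono)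
qed

lemma cmod_sum_cauchy_schwarz:
  fixes a :: "'n::finite \<Rightarrow> real" and g :: "'n \<Rightarrow> complex"
  shows "(cmod (\<Sum>k\<in>UNIV. of_real (a k) * g k))\<^sup>2 \<le> (\<Sum>k\<in>UNIV. (a k)\<^sup>2) * (\<Sum>k\<in>UNIV. (cmod (g k))\<^sup>2)"
proof -
  have "cmod (\<Sum>k\<in>UNIV. of_real (a k) * g k) \<le> (\<Sum>k\<in>UNIV. \<bar>a k\<bar> * \<bar>cmod (g k)\<bar>)"
    by (rule order_trans[OF norm_sum]) (simp add: norm_mult)
  also have "\<dots> \<le> L2_set a UNIV * L2_set (\<lambda>k. cmod (g k)) UNIV"
    by (rule L2_set_mult_ineq)
  finally have "(cmod (\<Sum>k\<in>UNIV. of_real (a k) * g k))\<^sup>2 \<le> (L2_set a UNIV * L2_set (\<lambda>k. cmod (g k)) UNIV)\<^sup>2"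
    by (rule power_mono) simp
  then show ?thesis by (simp add: power_mult_distrib L2_set_def sum_nonneg)
qed

lemma energy_eq_integral:
  assumes "\<And>j. square_integrable (lebesgue_on S) (g j)"
  shows "energy S g = (LINT x|lebesgue_on S. (\<Sum>j\<in>UNIV. (cmod (g j x))\<^sup>2))"
  unfolding energy_def sqnorm_def
  using assms by (subst Bochner_Integration.integral_sum) (auto simp: square_integrable_def)

lemma (in affine_change) energy_vimage:
  assumes "S \<in> sets lebesgue" "\<And>j. square_integrable (lebesgue_on S) (g j)"
  shows "energy S g = jac * energy (T -` S) (\<lambda>j z. g j (T z))"
  unfolding energy_def sum_distrib_left using sqnorm_vimage[OF assms(1) assms(2)] by simp

text \<open>With P = 1 + E the main term is g itself. The remainder, E transposed applied to g plus
  v f, is split off by Young's inequality and estimated in the Frobenius norm.\<close>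

lemma gradient_perturbation_bound:
  fixes P :: "real^3^3" and v :: "real^3" and g :: "3 \<Rightarrow> complex" and f :: complex
  assumes \<delta>: "\<delta> > 0"
  shows "(\<Sum>j\<in>UNIV. (cmod ((\<Sum>k\<in>UNIV. of_real (P $ k $ j) * g k) + of_real (v $ j) * f))\<^sup>2)
    \<le> ((1 + \<delta>) + (1 + 1 / \<delta>) * 2 * (norm (P - mat 1))\<^sup>2) * (\<Sum>k\<in>UNIV. (cmod (g k))\<^sup>2)
      + (1 + 1 / \<delta>) * 2 * (norm v)\<^sup>2 * (cmod f)\<^sup>2"
proof -
  let ?E = "P - mat 1" and ?G = "\<Sum>k\<in>UNIV. (cmod (g k))\<^sup>2" and ?d = "1 + 1 / \<delta>"
  have d: "0 \<le> ?d" using \<delta> by simp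
  have termwise: "(cmod ((\<Sum>k\<in>UNIV. of_real (P $ k $ j) * g k) + of_real (v $ j) * f))\<^sup>2
      \<le> (1 + \<delta>) * (cmod (g j))\<^sup>2 + ?d * (2 * ((\<Sum>k\<in>UNIV. (?E $ k $ j)\<^sup>2) * ?G) + 2 * ((v $ j)\<^sup>2 * (cmod f)\<^sup>2))" for j
  proof -
    have "(\<Sum>k\<in>UNIV. complex_of_real (P $ k $ j) * g k) = (\<Sum>k\<in>UNIV. of_real (?E $ k $ j) * g k + (if k = j then g k else 0))"
      by (intro sum.cong refl) (simp add: mat_def algebra_simps)
    also have "\<dots> = g j + (\<Sum>k\<in>UNIV. of_real (?E $ k $ j) * g k)"
      by (simp add: sum.distrib)
    finally have "(\<Sum>k\<in>UNIV. of_real (P $ k $ j) * g k) + of_real (v $ j) * f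
        = g j + ((\<Sum>k\<in>UNIV. of_real (?E $ k $ j) * g k) + of_real (v $ j) * f)" by simp
    then have "(cmod ((\<Sum>k\<in>UNIV. of_real (P $ k $ j) * g k) + of_real (v $ j) * f))\<^sup>2
        \<le> (1 + \<delta>) * (cmod (g j))\<^sup>2 + ?d * (cmod ((\<Sum>k\<in>UNIV. of_real (?E $ k $ j) * g k) + of_real (v $ j) * f))\<^sup>2"
      using cmod_add_squared_weighted[OF \<delta>, of "g j" "(\<Sum>k\<in>UNIV. of_real (?E $ k $ j) * g k) + of_real (v $ j) * f"]
      by (simp only:)
    also have "(cmod ((\<Sum>k\<in>UNIV. of_real (?E $ k $ j) * g k) + of_real (v $ j) * f))\<^sup>2
        \<le> 2 * (cmod (\<Sum>k\<in>UNIV. of_real (?E $ k $ j) * g k))\<^sup>2 + 2 * (cmod (of_real (v $ j) * f))\<^sup>2"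
      by (rule cmod_add_squared_le)
    also have "\<dots> \<le> 2 * ((\<Sum>k\<in>UNIV. (?E $ k $ j)\<^sup>2) * ?G) + 2 * ((v $ j)\<^sup>2 * (cmod f)\<^sup>2)"
      using cmod_sum_cauchy_schwarz[of "\<lambda>k. ?E $ k $ j" g] by (simp add: norm_mult power_mult_distrib)
    finally show ?thesis using d by (simp add: mult_left_mono)
  qed
  have "(\<Sum>j\<in>UNIV. \<Sum>k\<in>UNIV. (?E $ k $ j)\<^sup>2) = (norm ?E)\<^sup>2"
    unfolding norm_matrix_squared norm_vector_squared by (rule sum.swap)
  moreover have "(\<Sum>j\<in>UNIV. (1 + \<delta>) * (cmod (g j))\<^sup>2 + ?d * (2 * ((\<Sum>k\<in>UNIV. (?E $ k $ j)\<^sup>2) * ?G) + 2 * ((v $ j)\<^sup>2 * (cmod f)\<^sup>2)))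
      = (1 + \<delta>) * ?G + ?d * (2 * ((\<Sum>j\<in>UNIV. \<Sum>k\<in>UNIV. (?E $ k $ j)\<^sup>2) * ?G) + 2 * ((\<Sum>j\<in>UNIV. (v $ j)\<^sup>2) * (cmod f)\<^sup>2))"
    by (simp only: sum.distrib sum_distrib_left[symmetric] sum_distrib_right[symmetric])
  moreover have "(\<Sum>j\<in>UNIV. (v $ j)\<^sup>2) = (norm v)\<^sup>2" by (rule norm_vector_squared[symmetric])
  moreover have "(\<Sum>j\<in>UNIV. (cmod ((\<Sum>k\<in>UNIV. of_real (P $ k $ j) * g k) + of_real (v $ j) * f))\<^sup>2)
    \<le> (\<Sum>j\<in>UNIV. (1 + \<delta>) * (cmod (g j))\<^sup>2 + ?d * (2 * ((\<Sum>k\<in>UNIV. (?E $ k $ j)\<^sup>2) * ?G) + 2 * ((v $ j)\<^sup>2 * (cmod f)\<^sup>2)))"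
    by (rule sum_mono) (rule termwise)
  ultimately have "(\<Sum>j\<in>UNIV. (cmod ((\<Sum>k\<in>UNIV. of_real (P $ k $ j) * g k) + of_real (v $ j) * f))\<^sup>2)
    \<le> (1 + \<delta>) * ?G + ?d * (2 * ((norm ?E)\<^sup>2 * ?G) + 2 * ((norm v)\<^sup>2 * (cmod f)\<^sup>2))"
    by simp
  also have "\<dots> = ((1 + \<delta>) + ?d * 2 * (norm ?E)\<^sup>2) * ?G + ?d * 2 * (norm v)\<^sup>2 * (cmod f)\<^sup>2"
    by (simp only: distrib_left distrib_right mult.assoc)
  finally show ?thesis .
qed

lemma continuous_matrix_vector: "continuous_on UNIV (\<lambda>x. (M :: real^3^3) *v x)"
  by (intro linear_continuous_on matrix_vector_mul_bounded_linear)

lemma magnetic_domain_matrix: "open S \<Longrightarrow> magnetic_domain (\<lambda>x. (M :: real^3^3) *v x) S"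
  by unfold_locales (auto intro: continuous_matrix_vector)

text \<open>The pair on C is cut off near p, moved to C0 by an affine map and multiplied by a linear
  phase. What remains of the difference of the potentials is D (z - zp), of size at most |D Q| 2 R
  on the support, where D = N0 - P^T N1 P compares the matrix of the potential on C0 with the pulled
  back one. The bound therefore keeps no trace of p or of the translation.\<close>

lemma transplanted_bound:
  fixes P Q N0 N1 :: "real^3^3" and C C0 :: "(real^3) set"
  assumes PQ: "P ** Q = mat 1" "Q ** P = mat 1" and C: "open C" and C0: "open C0"
    and agree: "\<And>r. \<exists>z0. \<forall>z. norm (P *v (z - z0)) \<le> r \<longrightarrow> (z \<in> C0 \<longleftrightarrow> P *v (z - z0) \<in> C)"
    and bound: "\<And>p. p \<in> magnetic_pairs (\<lambda>x. N0 *v x) C0 \<Longrightarrow>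
        m0 * sqnorm (lebesgue_on C0) (fst p) \<le> energy C0 (snd p)"
    and fg: "(f, g) \<in> magnetic_pairs (\<lambda>x. N1 *v x) C" and \<delta>: "\<delta> > 0" and R: "R > 0"
    and loc: "energy C (\<lambda>j x. of_real (window_at R p x) * g j x
              - \<i> * partial j (\<lambda>x. of_real (window_at R p x)) x * f x)
          < K * sqnorm (lebesgue_on C) (\<lambda>x. of_real (window_at R p x) * f x)"
  shows "m0 \<le> ((1 + \<delta>) + (1 + 1 / \<delta>) * 2 * (norm (P - mat 1))\<^sup>2) * K
    + (1 + 1 / \<delta>) * 2 * ((norm ((N0 - transpose P ** N1 ** P) ** Q))\<^sup>2 * (2 * R)\<^sup>2)"
proof -
  let ?\<psi> = "\<lambda>x. complex_of_real (window_at R p x)"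
  define f1 where "f1 x = ?\<psi> x * f x" for x
  define g1 where "g1 j x = ?\<psi> x * g j x - \<i> * partial j ?\<psi> x * f x" for j x
  \<comment> \<open>The ball of radius 2 R about p lies in the ball of this radius about 0. Since p
    is not controlled, agreement is required on balls of every radius.\<close>
  obtain z0 where z0: "\<And>z. norm (P *v (z - z0)) \<le> norm p + 2 * R \<Longrightarrow> z \<in> C0 \<longleftrightarrow> P *v (z - z0) \<in> C"
    using agree[of "norm p + 2 * R"] by blast
  define c where "c = - (P *v z0)"
  interpret affine_change P Q c by unfold_locales (use PQ in auto)
  \<comment> \<open>S is the image of C0 under T: it coincides with C on the support of the cutoff,
    and its preimage under T is exactly C0.\<close>
  define S where "S = T' -` C0"
  have "continuous_on UNIV T'"
    unfolding T'_def by (intro continuous_intros continuous_matrix_vector)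
  then have S: "open S" unfolding S_def using C0 by (simp add: open_vimage)
  have TS: "T -` S = C0" by (auto simp: S_def)
  have agree': "C \<inter> cball p (2 * R) = S \<inter> cball p (2 * R)"
  proof -
    have "x \<in> C \<longleftrightarrow> T' x \<in> C0" if "x \<in> cball p (2 * R)" for x
    proof -
      have "P *v (T' x - z0) = x"
      proof -
        have "P *v (u - z0) = P *v u + c" for u by (simp add: c_def matrix_vector_mult_diff_distrib)
        then show ?thesis using T_T'[of x] unfolding T_def by simp
      qed
      moreover have "norm x \<le> norm p + 2 * R"
        using that norm_triangle_ineq2[of x p] by (simp add: dist_norm norm_minus_commute)
      ultimately show ?thesis using z0[of "T' x"] by simp
    qed
    then show ?thesis by (auto simp: S_def)
  qed
  let ?A1 = "\<lambda>x. N1 *v x"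
  interpret C: magnetic_domain ?A1 C by (rule magnetic_domain_matrix[OF C])
  interpret S: magnetic_domain ?A1 S by (rule magnetic_domain_matrix[OF S])
  have supp: "window_at R p x = 0" if "x \<notin> cball p (2 * R)" for x
    by (rule window_at_support[OF R that])
  have fg1: "(f1, g1) \<in> magnetic_pairs ?A1 S"
    using magnetic_pairs_cutoff[OF C.magnetic_domain_axioms S smooth_window_at compact_cball supp agree' fg]
    by (simp add: f1_def[abs_def] g1_def[abs_def])
  have f1: "square_integrable S.M f1" and g1: "\<And>j. square_integrable S.M (g1 j)"
    using fg1 by (auto simp: magnetic_pairs_def)
  have out: "f1 x = 0" "g1 j x = 0" if "x \<notin> cball p (2 * R)" for x j
  proof -
    have "partial j ?\<psi> x = 0"
      by (rule partial_eq_0_outside[OF closed_cball _ that]) (simp add: supp)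
    then show "f1 x = 0" "g1 j x = 0" by (simp_all add: f1_def g1_def supp[OF that])
  qed
  have sqS: "sqnorm S.M u = sqnorm C.M u" if "\<And>x. x \<notin> cball p (2 * R) \<Longrightarrow> u x = 0" for u
    unfolding sqnorm_def
  proof (rule integral_transfer[OF S.domain_lebesgue C.domain_lebesgue])
    fix x assume "x \<in> S - C \<union> (C - S)"
    then have "x \<notin> cball p (2 * R)" using agree' by blast
    then show "(cmod (u x))\<^sup>2 = 0" by (simp add: that)
  qed
  have loc': "energy S g1 < K * sqnorm S.M f1"
    using loc sqS[OF out(1)] sqS[OF out(2)]
    by (simp add: energy_def f1_def[abs_def] g1_def[abs_def])
  define f2 where "f2 z = f1 (T z)" for z
  define g2 where "g2 j z = (\<Sum>k\<in>UNIV. of_real (P $ k $ j) * g1 k (T z))" for j z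
  let ?A2 = "\<lambda>z. transpose P *v (N1 *v T z)"
  have fg2: "(f2, g2) \<in> magnetic_pairs ?A2 C0"
    using magnetic_pairs_affine[OF S.magnetic_domain_axioms fg1]
    by (simp add: TS f2_def[abs_def] g2_def[abs_def])
  define D where "D = N0 - transpose P ** N1 ** P"
  define zp where "zp = T' p"
  \<comment> \<open>The affine difference of the potentials is recentred at \<open>zp\<close>, the
    preimage of p; its constant part \<open>v\<close> is the gradient of the linear phase used
    below.\<close>
  define v where "v = D *v zp - transpose P *v (N1 *v c)"
  have A0: "N0 *v z = (?A2 z + v) + D *v (z - zp)" for z
    by (simp add: v_def T_def D_def matrix_vector_mult_diff_distrib matrix_vector_right_distrib
        matrix_vector_mult_diff_rdistrib matrix_vector_mul_assoc matrix_mul_assoc algebra_simps)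
  have contA2: "continuous_on UNIV ?A2"
    using continuous_on_compose2[OF continuous_matrix_vector continuous_on_compose2[OF continuous_matrix_vector T_continuous]]
    by (simp del: transpose_matrix_vector)
  then interpret D2: magnetic_domain ?A2 C0 using C0 by unfold_locales
  let ?\<eta> = "\<lambda>z. v \<bullet> z"
  have \<eta>: "smooth_on UNIV ?\<eta>" "partial j ?\<eta> z = v $ j" for j z
  proof -
    show "smooth_on UNIV ?\<eta>"
      unfolding smooth_on_def by (intro allI Ck_on_linear bounded_linear_inner_right) simp
    have "(?\<eta> has_derivative (\<lambda>h. v \<bullet> h)) (at z)"
      by (intro bounded_linear_imp_has_derivative bounded_linear_inner_right)
    from frechet_derivative_at[OF this, symmetric] show "partial j ?\<eta> z = v $ j"
      by (simp add: partial_def inner_axis)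
  qed
  let ?e = "\<lambda>z. cis (- (v \<bullet> z))"
  have fg3: "(\<lambda>z. ?e z * f2 z, \<lambda>j z. ?e z * g2 j z) \<in> magnetic_pairs (\<lambda>z. ?A2 z + v) C0"
    by (rule magnetic_pairs_gauge[OF D2.magnetic_domain_axioms \<eta>(1) fg2]) (simp add: \<eta>(2))
  have D3: "magnetic_domain (\<lambda>z. ?A2 z + v) C0"
    by unfold_locales (use C0 contA2 in \<open>auto intro: continuous_intros\<close>)
  define W where "W z = D *v (z - zp)" for z
  have contW: "continuous_on UNIV W"
    unfolding W_def by (intro continuous_on_compose2[OF continuous_matrix_vector] continuous_intros) simp
  have "continuous_on UNIV T'"
    unfolding T'_def by (intro continuous_intros continuous_matrix_vector)
  then have comp: "compact (T' ` cball p (2 * R))"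
    by (intro compact_continuous_image) (auto intro: continuous_on_subset)
  have out2: "?e z * f2 z = 0" if "z \<notin> T' ` cball p (2 * R)" for z
  proof -
    have "T z \<notin> cball p (2 * R)" using that T'_T[of z] by (metis imageI)
    then show ?thesis by (simp add: f2_def out)
  qed
  define f4 where "f4 z = ?e z * f2 z" for z
  define g4 where "g4 j z = ?e z * g2 j z + of_real (W z $ j) * (?e z * f2 z)" for j z
  have "(f4, g4) \<in> magnetic_pairs (\<lambda>z. (?A2 z + v) + W z) C0"
    using magnetic_pairs_perturb[OF D3 fg3 contW comp out2] by (simp add: f4_def[abs_def] g4_def[abs_def])
  then have fg4: "(f4, g4) \<in> magnetic_pairs (\<lambda>x. N0 *v x) C0"
    by (simp add: A0 W_def)
  have f4: "square_integrable (lebesgue_on C0) f4" and g4: "\<And>j. square_integrable (lebesgue_on C0) (g4 j)"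
    using fg4 by (auto simp: magnetic_pairs_def)
  let ?w = "(norm (D ** Q))\<^sup>2 * (2 * R)\<^sup>2"
  let ?a = "(1 + \<delta>) + (1 + 1 / \<delta>) * 2 * (norm (P - mat 1))\<^sup>2" and ?b = "(1 + 1 / \<delta>) * 2 * ?w"
  have point: "(\<Sum>j\<in>UNIV. (cmod (g4 j z))\<^sup>2)
      \<le> ?a * (\<Sum>j\<in>UNIV. (cmod (g1 j (T z)))\<^sup>2) + ?b * (cmod (f1 (T z)))\<^sup>2" for z
  proof -
    have "cmod (g4 j z) = cmod ((\<Sum>k\<in>UNIV. of_real (P $ k $ j) * g1 k (T z)) + of_real (W z $ j) * f1 (T z))" for j
    proof -
      have "g4 j z = ?e z * ((\<Sum>k\<in>UNIV. of_real (P $ k $ j) * g1 k (T z)) + of_real (W z $ j) * f1 (T z))"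
        by (simp add: g4_def g2_def f2_def algebra_simps)
      then show ?thesis by (simp add: norm_mult)
    qed
    then have "(\<Sum>j\<in>UNIV. (cmod (g4 j z))\<^sup>2)
        \<le> ?a * (\<Sum>j\<in>UNIV. (cmod (g1 j (T z)))\<^sup>2) + (1 + 1 / \<delta>) * 2 * (norm (W z))\<^sup>2 * (cmod (f1 (T z)))\<^sup>2"
      using gradient_perturbation_bound[OF \<delta>, of P "\<lambda>k. g1 k (T z)" "W z" "f1 (T z)"] by simp
    also have "(1 + 1 / \<delta>) * 2 * (norm (W z))\<^sup>2 * (cmod (f1 (T z)))\<^sup>2 \<le> ?b * (cmod (f1 (T z)))\<^sup>2"
    proof (cases "T z \<in> cball p (2 * R)")
      case True
      \<comment> \<open>The support is a ball in the coordinate T z and not in z, which is how Q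
        enters the bound.\<close>
      have "z - zp = Q *v (T z - p)"
        using T'_T[of z] by (simp add: zp_def T'_def matrix_vector_mult_diff_distrib algebra_simps)
      then have "W z = (D ** Q) *v (T z - p)" by (simp add: W_def matrix_vector_mul_assoc)
      then have "(norm (W z))\<^sup>2 \<le> (norm (D ** Q))\<^sup>2 * (norm (T z - p))\<^sup>2"
        using norm_matrix_vector_mult_squared_le by metis
      also have "\<dots> \<le> ?w"
        using True by (intro mult_left_mono power_mono) (auto simp: dist_norm norm_minus_commute)
      finally show ?thesis using \<delta> by (intro mult_right_mono mult_left_mono) auto
    next
      case False
      then show ?thesis by (simp add: out)
    qed
    finally show ?thesis by simp
  qed
  have f1T: "square_integrable (lebesgue_on C0) (\<lambda>z. f1 (T z))"
    and g1T: "\<And>j. square_integrable (lebesgue_on C0) (\<lambda>z. g1 j (T z))"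
    using square_integrable_vimage[OF S.domain_lebesgue f1] square_integrable_vimage[OF S.domain_lebesgue g1]
    by (auto simp: TS)
  have "energy C0 g4 = (LINT z|lebesgue_on C0. (\<Sum>j\<in>UNIV. (cmod (g4 j z))\<^sup>2))"
    by (rule energy_eq_integral[OF g4])
  also have "\<dots> \<le> (LINT z|lebesgue_on C0. ?a * (\<Sum>j\<in>UNIV. (cmod (g1 j (T z)))\<^sup>2) + ?b * (cmod (f1 (T z)))\<^sup>2)"
    using g4 g1T f1T point
    by (intro integral_mono Bochner_Integration.integrable_add integrable_mult_right Bochner_Integration.integrable_sum)
      (auto simp: square_integrable_def)
  also have "\<dots> = ?a * energy C0 (\<lambda>j z. g1 j (T z)) + ?b * sqnorm (lebesgue_on C0) (\<lambda>z. f1 (T z))"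
    unfolding energy_eq_integral[OF g1T] sqnorm_def
    using g1T f1T by (subst Bochner_Integration.integral_add) (auto simp: square_integrable_def)
  finally have up: "energy C0 g4 \<le> ?a * energy C0 (\<lambda>j z. g1 j (T z)) + ?b * sqnorm (lebesgue_on C0) (\<lambda>z. f1 (T z))" .
  have "sqnorm (lebesgue_on C0) f4 = sqnorm (lebesgue_on C0) (\<lambda>z. f1 (T z))"
    by (simp add: sqnorm_def f4_def f2_def norm_mult)
  then have "m0 * sqnorm (lebesgue_on C0) (\<lambda>z. f1 (T z))
      \<le> ?a * energy C0 (\<lambda>j z. g1 j (T z)) + ?b * sqnorm (lebesgue_on C0) (\<lambda>z. f1 (T z))"
    using bound[OF fg4] up by simp
  \<comment> \<open>Masses and energies on C0 and on S differ by the same Jacobian factor.\<close>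
  then have "jac * (m0 * sqnorm (lebesgue_on C0) (\<lambda>z. f1 (T z)))
      \<le> jac * (?a * energy C0 (\<lambda>j z. g1 j (T z)) + ?b * sqnorm (lebesgue_on C0) (\<lambda>z. f1 (T z)))"
    using jac_pos by (intro mult_left_mono) auto
  then have "m0 * sqnorm S.M f1 \<le> ?a * energy S g1 + ?b * sqnorm S.M f1"
    using sqnorm_vimage[OF S.domain_lebesgue f1] energy_vimage[OF S.domain_lebesgue g1]
    by (simp add: TS algebra_simps)
  also have "\<dots> \<le> ?a * (K * sqnorm S.M f1) + ?b * sqnorm S.M f1"
    using loc' \<delta> by (intro add_right_mono mult_left_mono) auto
  finally have "m0 * sqnorm S.M f1 \<le> (?a * K + ?b) * sqnorm S.M f1" by (simp add: distrib_right mult.assoc)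
  \<comment> \<open>The strict inequality in \<open>loc\<close> excludes a cutoff that annihilates
    f.\<close>
  moreover have "0 < sqnorm S.M f1"
    using loc' energy_nonneg[of S g1] sqnorm_nonneg[of S.M f1] by (cases "sqnorm S.M f1 = 0") auto
  ultimately show ?thesis unfolding D_def by simp
qed

section \<open>Potentials and regularity of corner domains\<close>

text \<open>The matrix of x \<mapsto> (b \<times> x)/2, the symmetric gauge. Its entries are linear
  in b, whereas the choice in \<open>linear_potential\<close> says nothing about continuity in
  b.\<close>

definition field_matrix :: "real^3 \<Rightarrow> real^3^3" where
  "field_matrix b = vector [vector [0, - (b $ 3) / 2, b $ 2 / 2],
                            vector [b $ 3 / 2, 0, - (b $ 1) / 2],
                            vector [- (b $ 2) / 2, b $ 1 / 2, 0]]"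

lemma partial_matrix: "partial j (\<lambda>x. (M :: real^3^3) *v x) x $ i = M $ i $ j"
proof -
  have "((\<lambda>x. M *v x) has_derivative (\<lambda>h. M *v h)) (at x)"
    by (intro bounded_linear_imp_has_derivative matrix_vector_mul_bounded_linear)
  from frechet_derivative_at[OF this, symmetric] show ?thesis
    by (simp add: partial_def matrix_vector_mult_basis column_def)
qed

text \<open>The curl of a linear field reads off exactly the antisymmetric part of its matrix, so
  the choice leaves only a symmetric matrix open.\<close>

lemma linear_potential_matrix:
  obtains M where "linear_potential b = (\<lambda>x. M *v x)" "\<forall>i j. (field_matrix b - M) $ i $ j = (field_matrix b - M) $ j $ i"
proof -
  have A: "linear (linear_potential b)" "\<And>x. curl (linear_potential b) x = b"
    using someI_ex[OF linear_potential_exists[of b]] unfolding linear_potential_def by auto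
  define M where "M = matrix (linear_potential b)"
  have M: "linear_potential b = (\<lambda>x. M *v x)"
    using matrix_works[OF A(1)[unfolded linear_matrix_vector_mul_eq[symmetric]]] A(1)
    by (simp add: M_def fun_eq_iff matrix_works)
  have "b = vector [M $ 3 $ 2 - M $ 2 $ 3, M $ 1 $ 3 - M $ 3 $ 1, M $ 2 $ 1 - M $ 1 $ 2]"
    using A(2)[of 0] unfolding M curl_def partial_matrix by simp
  then have b: "b $ 1 = M $ 3 $ 2 - M $ 2 $ 3" "b $ 2 = M $ 1 $ 3 - M $ 3 $ 1" "b $ 3 = M $ 2 $ 1 - M $ 1 $ 2"
    by (metis vector_3)+
  have "\<forall>i j. (field_matrix b - M) $ i $ j = (field_matrix b - M) $ j $ i"
    by (simp add: forall_3 field_matrix_def b field_simps)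
  then show ?thesis using that M by blast
qed

text \<open>For symmetric H the field H x is the gradient of (x \<bullet> H x)/2, so the change of
  potential is a gauge.\<close>

lemma magnetic_pairs_symmetric_gauge:
  fixes M N :: "real^3^3"
  assumes S: "open S" and sym: "\<And>i j. (N - M) $ i $ j = (N - M) $ j $ i"
    and p: "p \<in> magnetic_pairs (\<lambda>x. M *v x) S"
  shows "\<exists>q\<in>magnetic_pairs (\<lambda>x. N *v x) S. sqnorm (lebesgue_on S) (fst q) = sqnorm (lebesgue_on S) (fst p)
    \<and> energy S (snd q) = energy S (snd p)"
proof -
  define H where "H = N - M"
  define \<eta> where "\<eta> x = (1 / 2) * (x \<bullet> (H *v x))" for x
  have sm: "smooth_on UNIV \<eta>"
    unfolding smooth_on_def \<eta>_def
    by (intro allI Ck_on_bounded_linear[OF _ bounded_linear_mult_right] Ck_on_bilinear[OF _ bounded_bilinear_inner]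
        Ck_on_linear bounded_linear_ident matrix_vector_mul_bounded_linear) auto
  have H: "transpose H = H" using sym by (simp add: H_def transpose_def vec_eq_iff)
  have d: "partial j \<eta> x = (H *v x) $ j" for j x
  proof -
    have "(\<eta> has_derivative (\<lambda>h. (1 / 2) * (x \<bullet> (H *v h) + h \<bullet> (H *v x)))) (at x)"
      unfolding \<eta>_def
      by (intro derivative_intros has_derivative_inner bounded_linear_imp_has_derivative
          matrix_vector_mul_bounded_linear has_derivative_ident)
    from frechet_derivative_at[OF this, symmetric]
    have "partial j \<eta> x = (1 / 2) * (x \<bullet> (H *v axis j 1) + axis j 1 \<bullet> (H *v x))"
      by (simp add: partial_def)
    moreover have "x \<bullet> (H *v axis j 1) = (H *v x) \<bullet> axis j 1"
      using dot_lmul_matrix[of x H "axis j 1"] H transpose_matrix_vector[of H x] by metis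
    moreover have "axis j 1 \<bullet> (H *v x) = (H *v x) $ j" by (simp add: inner_axis')
    ultimately show ?thesis by (simp add: inner_commute)
  qed
  have D: "magnetic_domain (\<lambda>x. M *v x) S" by (rule magnetic_domain_matrix[OF S])
  have "(\<lambda>x. cis (- \<eta> x) * fst p x, \<lambda>j x. cis (- \<eta> x) * snd p j x) \<in> magnetic_pairs (\<lambda>x. N *v x) S"
  proof (rule magnetic_pairs_gauge[OF D sm])
    show "(fst p, snd p) \<in> magnetic_pairs ((*v) M) S" using p by simp
    show "(N *v x) $ j = (M *v x) $ j + partial j \<eta> x" for x j
      by (simp add: d H_def matrix_vector_mult_diff_rdistrib)
  qed
  then show ?thesis
    by (intro bexI[of _ "(\<lambda>x. cis (- \<eta> x) * fst p x, \<lambda>j x. cis (- \<eta> x) * snd p j x)"])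
      (simp_all add: sqnorm_def energy_def norm_mult)
qed

text \<open>The Rayleigh description is moved from the chosen potential to
  \<open>field_matrix b\<close>, so that energies of different fields can be compared.\<close>

lemma ground_energy_rayleigh:
  assumes C: "open C" "C \<noteq> {}"
  shows "p \<in> magnetic_pairs (\<lambda>x. field_matrix b *v x) C \<Longrightarrow>
      ground_energy b C * sqnorm (lebesgue_on C) (fst p) \<le> energy C (snd p)"
    and "e > 0 \<Longrightarrow> \<exists>p\<in>magnetic_pairs (\<lambda>x. field_matrix b *v x) C.
      sqnorm (lebesgue_on C) (fst p) = 1 \<and> energy C (snd p) < ground_energy b C + e"
proof -
  obtain M where M: "linear_potential b = (\<lambda>x. M *v x)"
    and sym0: "\<forall>i j. (field_matrix b - M) $ i $ j = (field_matrix b - M) $ j $ i"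
    by (rule linear_potential_matrix[of b])
  have sym: "(field_matrix b - M) $ i $ j = (field_matrix b - M) $ j $ i" for i j using sym0 by blast
  interpret D: magnetic_domain "\<lambda>x. M *v x" C by (rule magnetic_domain_matrix[OF C(1)])
  have E: "ground_energy b C = spectrum_bottom (\<lambda>x. M *v x) C" by (simp add: ground_energy_def M)
  have sym': "(M - field_matrix b) $ i $ j = (M - field_matrix b) $ j $ i" for i j
    using sym[of i j] by simp
  show "ground_energy b C * sqnorm (lebesgue_on C) (fst p) \<le> energy C (snd p)"
    if p: "p \<in> magnetic_pairs (\<lambda>x. field_matrix b *v x) C"
    using magnetic_pairs_symmetric_gauge[OF C(1) sym' p] D.spectrum_bottom_rayleigh(1)[OF C(2)]
    unfolding D.form_bound_def E by force
  show "\<exists>p\<in>magnetic_pairs (\<lambda>x. field_matrix b *v x) C.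
      sqnorm (lebesgue_on C) (fst p) = 1 \<and> energy C (snd p) < ground_energy b C + e" if e: "e > 0"
  proof -
    obtain p where "p \<in> D.pairs" "sqnorm D.M (fst p) = 1" "energy C (snd p) < spectrum_bottom (\<lambda>x. M *v x) C + e"
      using D.spectrum_bottom_rayleigh(2)[OF C(2) e] by blast
    then show ?thesis using magnetic_pairs_symmetric_gauge[OF C(1) sym, of p] unfolding E by force
  qed
qed

section \<open>Regular openness along the recursion\<close>

lemma open_cone_closure:
  assumes "open_cone C" "t > 0" "v \<in> closure C"
  shows "t *\<^sub>R v \<in> closure C"
proof -
  have "(*\<^sub>R) t ` C \<subseteq> C" using assms by (auto simp: open_cone_def)
  then have "(*\<^sub>R) t ` closure C \<subseteq> closure C"
    using closure_scaleR[of t C] closure_mono by metis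
  then show ?thesis using assms(3) by blast
qed

text \<open>Every vector is scaled into a small ball inside W, hence into the closure of C, and
  brought back by the inverse dilation.\<close>

lemma open_cone_dense_if:
  fixes C :: "'a::euclidean_space set"
  assumes C: "open_cone C" and W: "open W" "0 \<in> W" "W \<subseteq> closure C"
  shows "closure C = UNIV"
proof -
  obtain e where e: "e > 0" "ball 0 e \<subseteq> W" using W open_contains_ball by blast
  have "v \<in> closure C" for v
  proof -
    define t where "t = e / (2 * (norm v + 1))"
    have t: "t > 0" using e by (simp add: t_def add_nonneg_pos)
    have "norm (t *\<^sub>R v) = e / 2 * (norm v / (norm v + 1))" using e by (simp add: t_def)
    also have "\<dots> < e"
    proof -
      have "norm v / (norm v + 1) \<le> 1" by (simp add: divide_le_eq_1 add_nonneg_pos)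
      then have "e / 2 * (norm v / (norm v + 1)) \<le> e / 2 * 1" using e by (intro mult_left_mono) auto
      then show ?thesis by (rule order.strict_trans1) (use e in simp)
    qed
    finally have "t *\<^sub>R v \<in> ball 0 e" by simp
    then have "t *\<^sub>R v \<in> closure C" using e(2) W(3) by blast
    from open_cone_closure[OF C _ this, of "1 / t"] t have "(1 / t) *\<^sub>R (t *\<^sub>R v) \<in> closure C" by simp
    then show ?thesis using t by simp
  qed
  then show ?thesis by auto
qed

text \<open>This property excludes cracks. It is inherited along the recursion, and it makes every
  corner domain regular open.\<close>

definition dense_imp_full :: "'a::euclidean_space set set \<Rightarrow> bool" where
  "dense_imp_full \<PP> \<longleftrightarrow> (\<forall>C\<in>\<PP>. open_cone C \<and> (closure C = UNIV \<longrightarrow> C = UNIV))"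

lemma dense_imp_full_R1: "dense_imp_full cones_R1"
proof -
  have "closure {0::real<..} \<noteq> UNIV" "closure {..<0::real} \<noteq> UNIV"
    by (auto simp: set_eq_iff not_le intro: exI[of _ "-1"] exI[of _ 1])
  then show ?thesis
    by (auto simp: dense_imp_full_def cones_R1_eq open_cone_def mult_pos_neg)
qed

lemma is_tangent_coneE:
  assumes "is_tangent_cone M Fr \<PP> \<Omega> x C"
  obtains N V U U' D J where "C \<in> \<PP>" "openin (top_of_set M) N" "x \<in> N" "open V" "0 \<in> V"
    "diffeomorphism N V U U'" "U x = 0" "(U has_derivative D) (at x within N)" "J \<in> Fr x"
    "\<forall>v. D (J v) = v" "U ` (N \<inter> \<Omega>) = V \<inter> C"
  using assms unfolding is_tangent_cone_def by - (elim conjE exE, rule that; assumption)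

text \<open>Density of \<Omega> near x is carried by the chart to density of the tangent cone near
  its vertex, hence everywhere by dilation. The cone is then the whole space, so it contains its
  vertex, and \<Omega> contains x.\<close>

lemma corner_domain_regular:
  assumes full: "dense_imp_full \<PP>" and \<Omega>: "\<Omega> \<in> corner_domains M Fr \<PP>"
    and N': "openin (top_of_set M) N'" "x \<in> N'" "N' \<subseteq> top_of_set M closure_of \<Omega>"
  shows "x \<in> \<Omega>"
proof -
  obtain C where "is_tangent_cone M Fr \<PP> \<Omega> x C"
    using \<Omega> N' unfolding corner_domains_def by blast
  then obtain N V U U' where C: "C \<in> \<PP>" and N: "openin (top_of_set M) N" "x \<in> N" and V: "open V" "0 \<in> V"
    and hom: "homeomorphism N V U U'" and Ux: "U x = 0" and UN: "U ` (N \<inter> \<Omega>) = V \<inter> C"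
    by (rule is_tangent_coneE) (auto simp: diffeomorphism_def)
  have cone: "open_cone C" using full C by (auto simp: dense_imp_full_def)
  have "openin (top_of_set N) (N \<inter> N')"
    using N'(1) N(1) openin_subset[OF N(1)] by (metis openin_Int openin_subset_trans openin_imp_subset Int_lower1)
  then have "openin (top_of_set V) (U ` (N \<inter> N'))"
    using homeomorphism_imp_open_map[OF hom] by blast
  then have op: "open (U ` (N \<inter> N'))" using V(1) by (simp add: openin_open_eq)
  have "U ` (N \<inter> N') \<subseteq> closure C"
  proof
    fix u assume "u \<in> U ` (N \<inter> N')"
    then obtain w where w: "w \<in> N" "w \<in> N'" "u = U w" by blast
    show "u \<in> closure C"
      unfolding closure_iff_nhds_not_empty
    proof (intro allI impI)
      fix B O' assume O': "O' \<subseteq> B" "open O'" "u \<in> O'"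
      have "openin (top_of_set N) (N \<inter> U -` O')"
        using hom O'(2) by (intro continuous_openin_preimage_gen) (auto simp: homeomorphism_def)
      then have "openin (top_of_set M) (N \<inter> U -` O')" using N(1) openin_trans by blast
      moreover have "w \<in> N \<inter> U -` O'" using w O' by auto
      moreover have "w \<in> top_of_set M closure_of \<Omega>" using w N' by auto
      ultimately have "\<exists>y. y \<in> \<Omega> \<and> y \<in> N \<inter> U -` O'"
        by (intro in_closure_of[THEN iffD1, THEN conjunct2, rule_format]) auto
      then obtain y where "y \<in> \<Omega>" "y \<in> N" "U y \<in> O'" by blast
      then have "U y \<in> C \<inter> B" using UN O'(1) by blast
      then show "C \<inter> B \<noteq> {}" by blast
    qed
  qed
  moreover have "0 \<in> U ` (N \<inter> N')" using Ux N(2) N'(2) by (metis IntI imageI)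
  ultimately have "closure C = UNIV" using open_cone_dense_if[OF cone op] by blast
  then have "C = UNIV" using full C by (auto simp: dense_imp_full_def)
  then have "0 \<in> U ` (N \<inter> \<Omega>)" using UN V(2) by simp
  then obtain w where w: "w \<in> N" "w \<in> \<Omega>" "U w = 0" by auto
  then have "w = x" using homeomorphism_apply1[OF hom w(1)] homeomorphism_apply1[OF hom N(2)] Ux by simp
  then show ?thesis using w by simp
qed

text \<open>Radial projection turns density of the cone into density of its section in the sphere.
  By regularity of corner domains the section is then the full sphere, and the convention in
  \<open>cones_over\<close> excludes the punctured space.\<close>

lemma dense_imp_full_cones_over:
  fixes \<PP> :: "'n::euclidean_space set set" and Fr :: "'m::euclidean_space \<Rightarrow> ('n \<Rightarrow> 'm) set"
  assumes full: "dense_imp_full \<PP>"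
  shows "dense_imp_full (cones_over (corner_domains (sphere 0 1) Fr \<PP>))"
  unfolding dense_imp_full_def
proof (intro ballI conjI impI)
  fix C assume C: "C \<in> cones_over (corner_domains (sphere 0 1) Fr \<PP>)"
  then show cone: "open_cone C" by (auto simp: cones_over_def)
  assume dense: "closure C = UNIV"
  have "sphere 0 1 \<subseteq> C"
  proof
    fix x :: 'm assume x: "x \<in> sphere 0 1"
    have sub: "sphere 0 1 \<subseteq> top_of_set (sphere 0 1) closure_of (C \<inter> sphere 0 1)"
    proof
      fix y :: 'm assume y: "y \<in> sphere 0 1"
      obtain c where c: "\<And>n. c n \<in> C" "c \<longlonglongrightarrow> y"
        using dense closure_sequential[of y C] by auto
      \<comment> \<open>Radial projection breaks down at 0; the sequence avoids 0 eventually because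
        its limit y has norm 1.\<close>
      have "\<forall>\<^sub>F n in sequentially. c n \<in> - {0}"
        using y by (intro topological_tendstoD[OF c(2)]) auto
      then have "\<forall>\<^sub>F n in sequentially. sgn (c n) \<in> closure (C \<inter> sphere 0 1)"
      proof eventually_elim
        case (elim n)
        then have "inverse (norm (c n)) *\<^sub>R c n \<in> C"
          using cone c(1)[of n] by (simp add: open_cone_def)
        then have "sgn (c n) \<in> C \<inter> sphere 0 1" using elim by (simp add: norm_sgn) (simp add: sgn_div_norm)
        then show ?case by (rule subsetD[OF closure_subset])
      qed
      moreover have "(\<lambda>n. sgn (c n)) \<longlonglongrightarrow> sgn y" using y by (intro tendsto_sgn c) auto
      ultimately have "sgn y \<in> closure (C \<inter> sphere 0 1)"
        by (rule Lim_in_closed_set[OF closed_closure _ sequentially_bot])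
      moreover have "sgn y = y" using y by (simp add: sgn_div_norm)
      ultimately show "y \<in> top_of_set (sphere 0 1) closure_of (C \<inter> sphere 0 1)"
      proof -
        have "sphere 0 1 \<inter> (C \<inter> sphere 0 1) = C \<inter> sphere 0 1" by blast
        then show ?thesis using y \<open>sgn y \<in> closure (C \<inter> sphere 0 1)\<close> \<open>sgn y = y\<close>
          by (simp add: closure_of_subtopology)
      qed
    qed
    have "C \<inter> sphere 0 1 \<in> corner_domains (sphere 0 1) Fr \<PP>" using C by (auto simp: cones_over_def)
    then have "x \<in> C \<inter> sphere 0 1"
      by (rule corner_domain_regular[OF full _ _ x sub]) simp
    then show "x \<in> C" by blast
  qed
  then show "C = UNIV" using C by (auto simp: cones_over_def)
qed

lemma dense_imp_full_R3: "dense_imp_full cones_R3"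
  unfolding cones_R3_def corner_S2_def cones_R2_def corner_S1_def
  by (intro dense_imp_full_cones_over dense_imp_full_R1)

lemma corner_R3_regular:
  assumes "\<Omega> \<in> corner_R3"
  shows "interior (closure \<Omega>) \<subseteq> \<Omega>"
proof
  fix x assume "x \<in> interior (closure \<Omega>)"
  then show "x \<in> \<Omega>"
    using assms interior_subset[of "closure \<Omega>"] unfolding corner_R3_def
    by (intro corner_domain_regular[OF dense_imp_full_R3, of \<Omega> UNIV space_frames "interior (closure \<Omega>)"])
      (auto simp: subtopology_UNIV)
qed

lemma cones_R3_nonempty: "C \<in> cones_R3 \<Longrightarrow> C \<noteq> {}"
  by (auto simp: cones_R3_def cones_over_def corner_S2_def corner_domains_def)

section \<open>Local structure of polyhedral cones\<close>

text \<open>On an open set a local smooth extension agrees with \<open>f\<close> near each point, so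
  its derivatives are those of \<open>f\<close>.\<close>

lemma smooth_map_C1:
  assumes X: "open X" and f: "smooth_map X f"
  shows "x \<in> X \<Longrightarrow> f differentiable (at x)"
    and "continuous_on X (\<lambda>x. frechet_derivative f (at x) v)"
proof -
  have *: "f differentiable (at x) \<and> isCont (\<lambda>x. frechet_derivative f (at x) v) x" if x: "x \<in> X" for x
  proof -
    have "\<exists>N F. open N \<and> x \<in> N \<and> smooth_on N F \<and> (\<forall>y\<in>N \<inter> X. F y = f y)"
      using f x unfolding smooth_map_def by (rule bspec)
    then obtain N F where N: "open N" "x \<in> N" and F: "smooth_on N F" and eq0: "\<forall>y\<in>N \<inter> X. F y = f y"
      by (elim exE conjE)
    have eq: "F y = f y" if "y \<in> N \<inter> X" for y using eq0 that by (rule bspec)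
    have op: "open (N \<inter> X)" using N X by auto
    have "Ck_on (Suc 0) N F" using F unfolding smooth_on_def by blast
    then have "Ck_on (Suc 0) (N \<inter> X) F" by (rule Ck_on_subset) simp
    from Ck_on_cong[OF op eq this] have "Ck_on (Suc 0) (N \<inter> X) f" .
    then show ?thesis using x N op by (auto simp: continuous_on_eq_continuous_at)
  qed
  then show "x \<in> X \<Longrightarrow> f differentiable (at x)" by blast
  show "continuous_on X (\<lambda>x. frechet_derivative f (at x) v)"
    using * by (simp add: continuous_at_imp_continuous_on)
qed

lemma open_cone_interior_closure:
  assumes "open_cone C" "t > 0" "v \<in> interior (closure C)"
  shows "t *\<^sub>R v \<in> interior (closure C)"
proof -
  have "(*\<^sub>R) t ` interior (closure C) \<subseteq> interior (closure C)"
    using assms(1,2) interior_subset[of "closure C"]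
    by (intro interior_maximal open_scaling) (auto intro: open_cone_closure)
  then show ?thesis using assms(3) by blast
qed

lemma small_multiple:
  fixes v :: "'a::real_normed_vector"
  assumes "open V" "0 \<in> V"
  obtains t where "t > 0" "t *\<^sub>R v \<in> V"
proof -
  have "((\<lambda>t. t *\<^sub>R v) \<longlongrightarrow> 0 *\<^sub>R v) (at_right 0)" by (intro tendsto_intros)
  then have "\<forall>\<^sub>F t in at_right 0. t *\<^sub>R v \<in> V"
    using topological_tendstoD[OF _ assms(1), of "\<lambda>t. t *\<^sub>R v" 0] assms(2) by simp
  then have "\<forall>\<^sub>F t in at_right 0. t *\<^sub>R v \<in> V \<and> 0 < t"
    using eventually_at_right_less[of 0] by (rule eventually_conj)
  then obtain t where "t *\<^sub>R v \<in> V" "0 < t" using eventually_happens'[OF trivial_limit_at_right_real] by blast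
  then show ?thesis using that by blast
qed

text \<open>The inverse chart is continuous and carries the points of C in V to points of
  \<Omega>.\<close>

lemma chart_closure:
  assumes hom: "homeomorphism N V U U'" and "open N" "open V" and im: "U ` (N \<inter> \<Omega>) = V \<inter> C"
    and v: "v \<in> V" "v \<in> closure C"
  shows "U' v \<in> closure \<Omega>"
  unfolding closure_iff_nhds_not_empty
proof (intro allI impI)
  fix B O' assume O': "O' \<subseteq> B" "open O'" "U' v \<in> O'"
  have "openin (top_of_set V) (V \<inter> U' -` O')"
    using hom O'(2) by (intro continuous_openin_preimage_gen) (auto simp: homeomorphism_def)
  then have "open (V \<inter> U' -` O')" using assms(3) by (simp add: openin_open_eq)
  moreover have "v \<in> V \<inter> U' -` O'" using v O' by auto
  ultimately have "C \<inter> (V \<inter> U' -` O') \<noteq> {}" using v(2) unfolding closure_iff_nhds_not_empty by blast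
  then obtain c where c: "c \<in> C" "c \<in> V" "U' c \<in> O'" by blast
  then have "c \<in> U ` (N \<inter> \<Omega>)" using im by blast
  then obtain w where w: "w \<in> N" "w \<in> \<Omega>" "c = U w" by blast
  then have "U' c = w" using homeomorphism_apply1[OF hom w(1)] by simp
  then show "\<Omega> \<inter> B \<noteq> {}" using c(3) w(2) O'(1) by auto
qed

text \<open>An interior point of the closure of C is scaled into V and sent into \<Omega> by the
  inverse chart and regularity of \<Omega>; the chart brings it back into C, and the dilation is
  undone.\<close>

lemma tangent_cone_regular:
  assumes reg: "interior (closure \<Omega>) \<subseteq> \<Omega>" and cone: "open_cone C"
    and hom: "homeomorphism N V U U'" and N: "open N" and V: "open V" "0 \<in> V" and im: "U ` (N \<inter> \<Omega>) = V \<inter> C"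
  shows "interior (closure C) \<subseteq> C"
proof
  fix v assume v: "v \<in> interior (closure C)"
  obtain t where t: "t > 0" "t *\<^sub>R v \<in> V" using small_multiple[OF V] .
  define G where "G = V \<inter> interior (closure C)"
  have G: "open G" "t *\<^sub>R v \<in> G" "G \<subseteq> V" "G \<subseteq> closure C"
    using V(1) t open_cone_interior_closure[OF cone t(1) v] interior_subset[of "closure C"] by (auto simp: G_def)
  have "openin (top_of_set N) (U' ` G)"
    using homeomorphism_imp_open_map[OF homeomorphism_symD[OF hom], of G] G V(1) by (simp add: openin_open_eq)
  then have "open (U' ` G)" using N by (simp add: openin_open_eq)
  moreover have "U' ` G \<subseteq> closure \<Omega>" using chart_closure[OF hom N V(1) im] G by blast
  ultimately have "U' ` G \<subseteq> \<Omega>" using interior_maximal reg by blast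
  then have "U' (t *\<^sub>R v) \<in> N \<inter> \<Omega>" using G hom by (auto simp: homeomorphism_def)
  then have "U (U' (t *\<^sub>R v)) \<in> V \<inter> C" using im by blast
  then have "t *\<^sub>R v \<in> C" using homeomorphism_apply2[OF hom t(2)] by simp
  then have "(1 / t) *\<^sub>R (t *\<^sub>R v) \<in> C" using cone t(1) unfolding open_cone_def by (meson zero_less_divide_1_iff)
  then show "v \<in> C" using t(1) by simp
qed

text \<open>Blow-up at the vertex: \<Psi> (t v)/t stays in the cone K2 and tends to L v. Only
  membership in the closure survives the limit.\<close>

lemma cone_linearization:
  assumes der: "(\<Psi> has_derivative L) (at 0)" and zero: "\<Psi> 0 = 0" and K: "open_cone K1" "open_cone K2"
    and maps: "\<forall>\<^sub>F w in nhds 0. w \<in> K1 \<longrightarrow> \<Psi> w \<in> K2" and v: "v \<in> K1"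
  shows "L v \<in> closure K2"
proof -
  have 1: "((\<lambda>t. t *\<^sub>R v) has_derivative (\<lambda>t. t *\<^sub>R v)) (at 0)"
    by (auto intro!: derivative_eq_intros)
  have lin: "linear L" using der has_derivative_linear by blast
  have "((\<lambda>t. \<Psi> (t *\<^sub>R v)) has_vector_derivative L v) (at 0)"
    using diff_chain_at[OF 1, of \<Psi> L] der lin
    by (simp add: o_def has_vector_derivative_def linear_cmul)
  from has_vector_derivative_quotient[OF this]
  have "((\<lambda>t. \<Psi> (t *\<^sub>R v) /\<^sub>R t) \<longlongrightarrow> L v) (at_right 0)"
    by (simp add: zero tendsto_within_subset[of _ _ _ UNIV])
  moreover have "\<forall>\<^sub>F t in at_right 0. \<Psi> (t *\<^sub>R v) /\<^sub>R t \<in> closure K2"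
  proof -
    have "((\<lambda>t. t *\<^sub>R v) \<longlongrightarrow> 0 *\<^sub>R v) (at_right 0)" by (intro tendsto_intros)
    then have "\<forall>\<^sub>F t in at_right 0. t *\<^sub>R v \<in> K1 \<longrightarrow> \<Psi> (t *\<^sub>R v) \<in> K2"
      using eventually_compose_filterlim[OF maps] by simp
    then show ?thesis using eventually_at_right_less[of "0::real"]
    proof eventually_elim
      case (elim t)
      then have "t *\<^sub>R v \<in> K1" using K(1) v by (simp add: open_cone_def)
      then have "inverse t *\<^sub>R \<Psi> (t *\<^sub>R v) \<in> K2" using elim K(2) by (simp add: open_cone_def)
      then show ?case by (rule subsetD[OF closure_subset])
    qed
  qed
  ultimately show ?thesis
    by (intro Lim_in_closed_set[OF closed_closure _ trivial_limit_at_right_real])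
qed

text \<open>Hyperplanes that miss q stay off a small ball, and those through q are invariant under
  dilations about q. So a point off all hyperplanes slides along its ray without meeting the
  frontier; points on the hyperplanes are recovered by regular openness.\<close>

lemma polyhedral_locally_conic:
  fixes C :: "'a::euclidean_space set"
  assumes C: "open C" and reg: "interior (closure C) \<subseteq> C" and H: "finite H" "\<And>h. h \<in> H \<Longrightarrow> hyperplane h"
    and fr: "frontier C \<subseteq> \<Union>H"
  obtains r where "r > 0" "\<And>z t. t > 0 \<Longrightarrow> norm z < r \<Longrightarrow> norm (t *\<^sub>R z) < r \<Longrightarrow> q + z \<in> C \<Longrightarrow> q + t *\<^sub>R z \<in> C"
proof -
  have closed_h: "closed h" if "h \<in> H" for h
    using H(2)[OF that] closed_hyperplane by (auto simp: hyperplane_def)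
  have neg: "negligible (\<Union>H)"
    using H negligible_hyperplane by (intro negligible_Union) (auto simp: hyperplane_def)
  have "closed (\<Union>{h \<in> H. q \<notin> h})" using H(1) closed_h by (intro closed_Union) auto
  then obtain r where r: "r > 0" "ball q r \<subseteq> - \<Union>{h \<in> H. q \<notin> h}"
    by (rule openE[OF open_Compl, of _ q]) auto
  have through: "q \<in> h" if "h \<in> H" "q + z \<in> h" "norm z < r" for h z
    using r(2) that by (auto simp: subset_eq dist_norm)
  have ray: "q + z \<in> h" if "h \<in> H" "s > 0" "q + s *\<^sub>R z \<in> h" "norm (s *\<^sub>R z) < r" for h s z
  proof -
    obtain a b where h: "h = {x. a \<bullet> x = b}" using H(2)[OF \<open>h \<in> H\<close>] by (auto simp: hyperplane_def)
    have "q \<in> h" by (rule through[OF that(1,3,4)])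
    then show ?thesis using that(2,3) by (auto simp: h inner_add_right)
  qed
  \<comment> \<open>A frontier point on the segment would lie on a hyperplane through q; that
    hyperplane would contain the whole ray, in particular q + z.\<close>
  have off: "q + t *\<^sub>R z \<in> C"
    if t: "t > 0" and z: "norm z < r" "norm (t *\<^sub>R z) < r" "q + z \<in> C" and nz: "q + z \<notin> \<Union>H" for t z
  proof (rule ccontr)
    let ?S = "closed_segment (q + z) (q + t *\<^sub>R z)"
    assume "q + t *\<^sub>R z \<notin> C"
    then have "?S \<inter> frontier C \<noteq> {}"
      using z(3) by (intro connected_Int_frontier connected_segment) auto
    then obtain x h where x: "x \<in> ?S" "x \<in> h" "h \<in> H" using fr by blast
    have "?S \<subseteq> ball q r"
      by (intro closed_segment_subset convex_ball) (use z in \<open>auto simp: dist_norm\<close>)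
    then have xr: "dist q x < r" using x(1) by auto
    obtain u where u: "0 \<le> u" "u \<le> 1" "x = (1 - u) *\<^sub>R (q + z) + u *\<^sub>R (q + t *\<^sub>R z)"
      using x(1) by (auto simp: closed_segment_def)
    define s where "s = (1 - u) + u * t"
    have s: "s > 0" using u t by (cases "u = 0") (auto simp: s_def add_nonneg_pos)
    have xs: "x = q + s *\<^sub>R z" by (simp add: u s_def algebra_simps)
    then have "q + z \<in> h" using ray[OF x(3) s, of z] x(2) xr by (simp add: dist_norm)
    then show False using nz x(3) by blast
  qed
  show ?thesis
  proof (rule that[OF r(1)])
    fix z and t :: real assume t: "t > 0" and z: "norm z < r" "norm (t *\<^sub>R z) < r" "q + z \<in> C"
    define f where "f w = q + (1 / t) *\<^sub>R (w - q)" for w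
    have cf: "continuous_on UNIV f" unfolding f_def by (intro continuous_intros)
    \<comment> \<open>G is an open neighbourhood of the target point. Its points off the hyperplanes
      lie in C by \<open>off\<close>, and they are dense in G because hyperplanes are negligible, so
      G lies in the closure of C.\<close>
    define G where "G = f -` (C \<inter> ball q r) \<inter> ball q r"
    have G: "open G" unfolding G_def using C cf by (intro open_Int open_vimage) auto
    have "G \<subseteq> closure C"
    proof
      fix w assume w: "w \<in> G"
      show "w \<in> closure C"
        unfolding closure_iff_nhds_not_empty
      proof (intro allI impI)
        fix B O' assume O': "O' \<subseteq> B" "open O'" "w \<in> O'"
        then have "\<not> negligible (O' \<inter> G)" using G w by (intro open_not_negligible) auto
        then obtain w' where w': "w' \<in> O'" "w' \<in> G" "w' \<notin> \<Union>H"
          using negligible_subset[OF neg, of "O' \<inter> G"] by blast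
        define z' where "z' = (1 / t) *\<^sub>R (w' - q)"
        have w'z: "w' = q + t *\<^sub>R z'" using t by (simp add: z'_def)
        have z': "norm z' < r" "norm (t *\<^sub>R z') < r" "q + z' \<in> C"
          using w'(2) t by (auto simp: G_def f_def z'_def[symmetric] dist_norm w'z)
        have "q + z' \<notin> \<Union>H"
        proof
          assume "q + z' \<in> \<Union>H"
          then obtain h where h: "h \<in> H" "q + z' \<in> h" by blast
          have "q + t *\<^sub>R z' \<in> h"
            by (rule ray[OF h(1), of "1 / t"]) (use t h z' in auto)
          then show False using w' w'z h(1) by blast
        qed
        then have "w' \<in> C" using off[OF t z'] w'z by simp
        then show "C \<inter> B \<noteq> {}" using w'(1) O'(1) by blast
      qed
    qed
    then have "G \<subseteq> C" using interior_maximal[OF _ G] reg by blast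
    moreover have "q + t *\<^sub>R z \<in> G" using t z by (auto simp: G_def f_def dist_norm)
    ultimately show "q + t *\<^sub>R z \<in> C" by blast
  qed
qed

lemma derivatives_inverse:
  assumes hom: "homeomorphism N V U U'" and N: "open N" "y \<in> N"
    and D: "(U has_derivative L) (at y)" "(U' has_derivative P) (at (U y))"
  shows "P (L v) = v"
proof -
  have "((\<lambda>x. x) has_derivative P \<circ> L) (at y)"
  proof (rule has_derivative_transform_within_open[OF diff_chain_at[OF D] N])
    show "(U' \<circ> U) x = x" if "x \<in> N" for x using homeomorphism_apply1[OF hom that] by simp
  qed
  then have "P \<circ> L = (\<lambda>h. h)" using has_derivative_unique has_derivative_ident by blast
  then show ?thesis by (simp add: fun_eq_iff)
qed

text \<open>The transition map W after U' has derivative P at q, and its inverse U after W' has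
  derivative L at 0. Linearizing both compares the tangent cone K of C at q with C': each inclusion
  holds up to closure, and regular openness makes it exact. Any admissible cone at y is thus the
  image of K under P.\<close>

lemma local_model:
  fixes \<Omega> :: "'a::euclidean_space set" and U U' W W' :: "'a \<Rightarrow> 'a"
  assumes \<Omega>: "interior (closure \<Omega>) \<subseteq> \<Omega>"
    and hom: "homeomorphism N V U U'" and N: "open N" "y \<in> N" and V: "open V" "0 \<in> V" and im: "U ` (N \<inter> \<Omega>) = V \<inter> C"
    and der: "(U has_derivative L) (at y)" "(U' has_derivative P) (at (U y))"
    and C: "open_cone C" "finite H" "\<And>h. h \<in> H \<Longrightarrow> hyperplane h" "frontier C \<subseteq> \<Union>H"
    and hom': "homeomorphism N' V' W W'" and N': "open N'" "y \<in> N'" and V': "open V'" "0 \<in> V'"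
    and im': "W ` (N' \<inter> \<Omega>) = V' \<inter> C'" and W: "W y = 0"
    and der': "(W has_derivative (\<lambda>v. v)) (at y)" "W' differentiable (at 0)" and C': "open_cone C'"
  shows "\<exists>r>0. \<forall>z. norm z < r \<longrightarrow> (U y + z \<in> C \<longleftrightarrow> P z \<in> C')"
proof -
  let ?q = "U y"
  have qV: "?q \<in> V" using hom N(2) by (auto simp: homeomorphism_def)
  have U'q: "U' ?q = y" by (rule homeomorphism_apply1[OF hom N(2)])
  have W'0: "W' 0 = y" using homeomorphism_apply1[OF hom' N'(2)] W by simp
  have regC: "interior (closure C) \<subseteq> C"
    by (rule tangent_cone_regular[OF \<Omega> C(1) hom N(1) V im])
  have regC': "interior (closure C') \<subseteq> C'"
    by (rule tangent_cone_regular[OF \<Omega> C' hom' N'(1) V' im'])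
  have oC: "open C" "open C'" using C(1) C' by (auto simp: open_cone_def)
  have PL: "P (L v) = v" for v by (rule derivatives_inverse[OF hom N der])
  have LP: "L (P v) = v" for v
    using derivatives_inverse[OF homeomorphism_symD[OF hom] V(1) qV der(2)] der(1) U'q by simp
  have linP: "linear P" using der(2) has_derivative_linear by blast
  \<comment> \<open>The derivative of W' at 0 inverts that of W at y, which is the identity.\<close>
  have der'': "(W' has_derivative (\<lambda>v. v)) (at 0)"
  proof -
    obtain D where D: "(W' has_derivative D) (at 0)" using der'(2) by (auto simp: differentiable_def)
    have "D v = v" for v
      using derivatives_inverse[OF hom' N' der'(1), of D v] D W by simp
    then have "D = (\<lambda>v. v)" by auto
    then show ?thesis using D by simp
  qed
  obtain r where r: "r > 0" and conic: "\<And>z t. t > 0 \<Longrightarrow> norm z < r \<Longrightarrow> norm (t *\<^sub>R z) < r \<Longrightarrow>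
      ?q + z \<in> C \<Longrightarrow> ?q + t *\<^sub>R z \<in> C"
    using polyhedral_locally_conic[OF oC(1) regC C(2-4)] by metis
  \<comment> \<open>K is the tangent cone of C at q: all dilates of the part of C - q near 0, which
    by local conicity coincides with C - q near 0.\<close>
  define K where "K = {z. \<exists>t>0. norm (t *\<^sub>R z) < r \<and> ?q + t *\<^sub>R z \<in> C}"
  have K_iff: "z \<in> K \<longleftrightarrow> ?q + z \<in> C" if "norm z < r" for z
  proof
    assume "z \<in> K"
    then obtain t where t: "t > 0" "norm (t *\<^sub>R z) < r" "?q + t *\<^sub>R z \<in> C" unfolding K_def by blast
    have "?q + (1 / t) *\<^sub>R (t *\<^sub>R z) \<in> C" by (rule conic) (use t that in auto)
    then show "?q + z \<in> C" using t(1) by simp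
  qed (use that in \<open>auto simp: K_def intro!: exI[of _ 1]\<close>)
  have K: "open_cone K"
    unfolding open_cone_def
  proof (intro conjI allI impI ballI)
    have "K = (\<Union>t\<in>{0<..}. {z. norm (t *\<^sub>R z) < r} \<inter> (\<lambda>z. ?q + t *\<^sub>R z) -` C)"
      by (auto simp: K_def)
    also have "open \<dots>"
      using oC(1) by (intro open_UN ballI open_Int open_Collect_less open_vimage continuous_intros)
    finally show "open K" .
    fix \<rho> :: real and x assume \<rho>: "0 < \<rho>" and "x \<in> K"
    then obtain t where t: "t > 0" "norm (t *\<^sub>R x) < r" "?q + t *\<^sub>R x \<in> C" unfolding K_def by blast
    then show "\<rho> *\<^sub>R x \<in> K" unfolding K_def using \<rho> by (intro CollectI exI[of _ "t / \<rho>"]) auto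
  qed
  have small: "\<forall>\<^sub>F w in nhds (0::'a). norm w < r"
    using eventually_nhds_in_open[of "ball 0 r" "0::'a"] r by (simp add: dist_norm)
  have to_C': "P z \<in> C'" if "z \<in> K" for z
  proof -
    have cl: "P z \<in> closure C'" if "z \<in> K" for z
    proof (rule cone_linearization[where \<Psi> = "\<lambda>w. W (U' (?q + w))" and ?K1.0 = K and L = P and v = z])
      have 1: "((\<lambda>w. ?q + w) has_derivative (\<lambda>v. v)) (at 0)" by (auto intro!: derivative_eq_intros)
      have 2: "((\<lambda>w. U' (?q + w)) has_derivative P) (at 0)"
        using diff_chain_at[OF 1, of U' P] der(2) by (simp add: o_def)
      have 3: "(W has_derivative (\<lambda>v. v)) (at (U' (?q + 0)))" using der'(1) U'q by simp
      show "((\<lambda>w. W (U' (?q + w))) has_derivative P) (at 0)"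
        using diff_chain_at[OF 2 3] by (simp add: o_def)
      show "W (U' (?q + 0)) = 0" using U'q W by simp
      have "isCont (\<lambda>w. U' (?q + w)) 0" using has_derivative_continuous[OF 2] .
      then have "\<forall>\<^sub>F w in nhds 0. U' (?q + w) \<in> N'"
        using N' U'q by (auto simp: continuous_at_open eventually_nhds)
      moreover have "\<forall>\<^sub>F w in nhds 0. ?q + w \<in> V"
      proof -
        have "open ((\<lambda>w. ?q + w) -` V)" using V(1) by (intro open_vimage continuous_intros)
        then show ?thesis using eventually_nhds_in_open[of "(\<lambda>w. ?q + w) -` V" 0] qV by simp
      qed
      ultimately show "\<forall>\<^sub>F w in nhds 0. w \<in> K \<longrightarrow> W (U' (?q + w)) \<in> C'"
        using small
      proof eventually_elim
        case (elim w)
        show ?case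
        proof
          assume "w \<in> K"
          then have "?q + w \<in> V \<inter> C" using elim K_iff by simp
          then obtain x where x: "x \<in> N" "x \<in> \<Omega>" "?q + w = U x" using im by blast
          then have "U' (?q + w) \<in> \<Omega>" using homeomorphism_apply1[OF hom x(1)] by simp
          then show "W (U' (?q + w)) \<in> C'" using elim(1) im' by blast
        qed
      qed
    qed (use K C' that in auto)
    \<comment> \<open>As P is onto, the image of K is open; an open subset of the closure of C' lies
      in C' by regularity.\<close>
    have "surj P" using PL by (metis surjI)
    then have "open (P ` K)" using K linP by (intro open_surjective_linear_image) (auto simp: open_cone_def)
    then have "P ` K \<subseteq> C'" using cl regC' interior_maximal[of "P ` K" "closure C'"] by blast
    then show ?thesis using that by blast
  qed
  have from_C': "z \<in> K" if "P z \<in> C'" for z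
  proof -
    have cl: "z \<in> closure K" if "P z \<in> C'" for z
    proof -
      have "L (P z) \<in> closure K"
      proof (rule cone_linearization[where \<Psi> = "\<lambda>w. U (W' w) - ?q" and ?K1.0 = C' and L = L and v = "P z"])
        have 1: "(U has_derivative L) (at (W' 0))" using der(1) W'0 by simp
        have 2: "((\<lambda>w. U (W' w)) has_derivative L) (at 0)"
          using diff_chain_at[OF der'' 1] by (simp add: o_def)
        then show 3: "((\<lambda>w. U (W' w) - ?q) has_derivative L) (at 0)"
          by (auto intro!: derivative_eq_intros)
        show "U (W' 0) - ?q = 0" using W'0 by simp
        have "isCont (\<lambda>w. U (W' w) - ?q) 0" using has_derivative_continuous[OF 3] .
        then have "\<forall>\<^sub>F w in nhds 0. U (W' w) - ?q \<in> ball 0 r"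
          using r W'0 unfolding continuous_at_open eventually_nhds by (elim allE[of _ "ball 0 r"]) auto
        moreover have "\<forall>\<^sub>F w in nhds 0. W' w \<in> N"
          using has_derivative_continuous[OF der''] N W'0
          by (auto simp: continuous_at_open eventually_nhds)
        moreover have "\<forall>\<^sub>F w in nhds 0. w \<in> V'" using eventually_nhds_in_open[OF V'] .
        ultimately show "\<forall>\<^sub>F w in nhds 0. w \<in> C' \<longrightarrow> U (W' w) - ?q \<in> K"
        proof eventually_elim
          case (elim w)
          show ?case
          proof
            assume "w \<in> C'"
            then obtain x where x: "x \<in> N'" "x \<in> \<Omega>" "w = W x" using im' elim(3) by blast
            then have "W' w \<in> \<Omega>" using homeomorphism_apply1[OF hom' x(1)] by simp
            then have "U (W' w) \<in> C" using elim(2) im by blast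
            then show "U (W' w) - ?q \<in> K" using K_iff[of "U (W' w) - ?q"] elim(1) by simp
          qed
        qed
      qed (use K C' that in auto)
      then show ?thesis using LP by simp
    qed
    have "open (P -` C')"
      using oC(2) linear_continuous_on[OF linear_conv_bounded_linear[THEN iffD1, OF linP]] by (intro open_vimage)
    then have zi: "z \<in> interior (closure K)"
      using cl that interior_maximal[of "P -` C'" "closure K"] by blast
    obtain t where t: "t > 0" "t *\<^sub>R z \<in> ball 0 r" using small_multiple[of "ball 0 r"] r by auto
    \<comment> \<open>Regularity is available for C rather than for K. Near 0 the two agree up to
      the translation by q, so z is first scaled into the ball and the closure argument is made for
      the translate of G.\<close>
    define G where "G = ball 0 r \<inter> interior (closure K)"
    have "(\<lambda>z. ?q + z) ` G \<subseteq> closure C"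
    proof
      fix x assume "x \<in> (\<lambda>z. ?q + z) ` G"
      then obtain g where g: "x = ?q + g" "g \<in> ball 0 r" "g \<in> closure K"
        using interior_subset[of "closure K"] by (auto simp: G_def)
      then have "g \<in> closure (ball 0 r \<inter> K)" using open_Int_closure_subset[of "ball 0 r" K] by auto
      then have "x \<in> closure ((\<lambda>z. ?q + z) ` (ball 0 r \<inter> K))"
        unfolding g(1) closure_translation by blast
      moreover have "(\<lambda>z. ?q + z) ` (ball 0 r \<inter> K) \<subseteq> C" using K_iff by auto
      ultimately show "x \<in> closure C" using closure_mono by blast
    qed
    moreover have "open ((\<lambda>z. ?q + z) ` G)" unfolding G_def by (intro open_translation open_Int) auto
    ultimately have "(\<lambda>z. ?q + z) ` G \<subseteq> C" using interior_maximal regC by blast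
    then have "?q + t *\<^sub>R z \<in> C" using t open_cone_interior_closure[OF K t(1) zi] by (auto simp: G_def)
    then show "z \<in> K" unfolding K_def using t by auto
  qed
  show ?thesis using r K_iff to_C' from_C' by blast
qed

section \<open>Lower semicontinuity\<close>

lemma tendsto_matrix_mult:
  fixes A :: "'a \<Rightarrow> real^'n^'m" and B :: "'a \<Rightarrow> real^'p^'n"
  assumes "(A \<longlongrightarrow> a) F" "(B \<longlongrightarrow> b) F"
  shows "((\<lambda>x. A x ** B x) \<longlongrightarrow> a ** b) F"
  using assms unfolding matrix_matrix_mult_def
  by (intro vec_tendstoI) (auto intro!: tendsto_sum tendsto_mult tendsto_vec_nth)

lemma tendsto_transpose:
  fixes A :: "'a \<Rightarrow> real^'n^'m"
  assumes "(A \<longlongrightarrow> a) F"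
  shows "((\<lambda>x. transpose (A x)) \<longlongrightarrow> transpose a) F"
  using assms unfolding transpose_def
  by (intro vec_tendstoI) (auto intro!: tendsto_vec_nth)

lemma tendsto_field_matrix:
  assumes "(b \<longlongrightarrow> b0) F"
  shows "((\<lambda>x. field_matrix (b x)) \<longlongrightarrow> field_matrix b0) F"
proof -
  have "((\<lambda>x. field_matrix (b x) $ i $ j) \<longlongrightarrow> field_matrix b0 $ i $ j) F" for i j
  proof -
    have *: "((\<lambda>x. b x $ k) \<longlongrightarrow> b0 $ k) F" for k by (intro tendsto_vec_nth assms)
    have "\<forall>i j. ((\<lambda>x. field_matrix (b x) $ i $ j) \<longlongrightarrow> field_matrix b0 $ i $ j) F"
      unfolding forall_3 field_matrix_def vector_3
      by (intro conjI tendsto_divide tendsto_minus * tendsto_const) auto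
    then show ?thesis by blast
  qed
  then show ?thesis by (intro vec_tendstoI)
qed

text \<open>In flat space the identity is the only admissible frame, so the differential of the
  chart at x is the identity itself.\<close>

lemma tangent_chart:
  assumes "tangent_cone_R3 \<Omega> x C"
  obtains N V U U' where "C \<in> cones_R3" "open N" "x \<in> N" "open V" "0 \<in> V" "homeomorphism N V U U'"
    "smooth_map N U" "smooth_map V U'" "U x = 0" "(U has_derivative (\<lambda>v. v)) (at x)" "U ` (N \<inter> \<Omega>) = V \<inter> C"
proof -
  obtain N V U U' D J where *: "C \<in> cones_R3" "openin (top_of_set UNIV) N" "x \<in> N" "open V" "0 \<in> V"
    "diffeomorphism N V U U'" "U x = 0" "(U has_derivative D) (at x within N)" "J \<in> space_frames x"
    "\<forall>v. D (J v) = v" "U ` (N \<inter> \<Omega>) = V \<inter> C"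
    using assms by (rule is_tangent_coneE)
  have N: "open N" using *(2) by (simp add: subtopology_UNIV)
  have "D = (\<lambda>v. v)" using *(9,10) by (auto simp: space_frames_def)
  then have "(U has_derivative (\<lambda>v. v)) (at x)" using *(8) at_within_open[OF *(3) N] by simp
  moreover have "homeomorphism N V U U'" "smooth_map N U" "smooth_map V U'"
    using *(6) by (simp_all add: diffeomorphism_def)
  ultimately show ?thesis using that[OF *(1) N *(3-5) _ _ _ *(7) _ *(11)] by (simp only:)
qed

text \<open>The parameter \<delta> is fixed before R: it brings (1 + \<delta>)^2 close to 1, and the
  resulting factor 1/\<delta> in the localization error is then beaten by R.\<close>

lemma small_parameters:
  fixes m m0 c :: real
  assumes "m < m0"
  obtains \<delta> R where "\<delta> > 0" "R > 0" "(1 + \<delta>) * ((1 + \<delta>) * m + (1 + 1 / \<delta>) * (c / R\<^sup>2)) < m0"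
proof -
  have "((\<lambda>\<delta>. (1 + \<delta>) * ((1 + \<delta>) * m)) \<longlongrightarrow> (1 + 0) * ((1 + 0) * m)) (at_right 0)"
    by (intro tendsto_intros)
  then have "\<forall>\<^sub>F \<delta> in at_right 0. (1 + \<delta>) * ((1 + \<delta>) * m) < m0"
    using assms by (intro order_tendstoD(2)) auto
  then have "\<forall>\<^sub>F \<delta> in at_right 0. (1 + \<delta>) * ((1 + \<delta>) * m) < m0 \<and> 0 < \<delta>"
    using eventually_at_right_less[of "0::real"] by (rule eventually_conj)
  then obtain \<delta> where \<delta>: "(1 + \<delta>) * ((1 + \<delta>) * m) < m0" "0 < \<delta>"
    using eventually_happens'[OF trivial_limit_at_right_real] by blast
  have "((\<lambda>R. (1 + \<delta>) * ((1 + \<delta>) * m + (1 + 1 / \<delta>) * (c * (inverse R)\<^sup>2)))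
      \<longlongrightarrow> (1 + \<delta>) * ((1 + \<delta>) * m + (1 + 1 / \<delta>) * (c * 0\<^sup>2))) at_top"
    by (intro tendsto_intros tendsto_inverse_0_at_top filterlim_ident)
  then have "\<forall>\<^sub>F R in at_top. (1 + \<delta>) * ((1 + \<delta>) * m + (1 + 1 / \<delta>) * (c * (inverse R)\<^sup>2)) < m0"
    using \<delta> by (intro order_tendstoD(2)) auto
  then have "\<forall>\<^sub>F R in at_top. (1 + \<delta>) * ((1 + \<delta>) * m + (1 + 1 / \<delta>) * (c * (inverse R)\<^sup>2)) < m0 \<and> 0 < R"
    using eventually_gt_at_top[of "0::real"] by (rule eventually_conj)
  then obtain R where "(1 + \<delta>) * ((1 + \<delta>) * m + (1 + 1 / \<delta>) * (c * (inverse R)\<^sup>2)) < m0" "0 < R"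
    using eventually_happens'[OF trivial_limit_at_top_linorder] by blast
  then show ?thesis using that \<delta>(2) by (simp add: divide_inverse power_inverse)
qed

text \<open>Dilating by a large factor moves the point \<open>q\<close> away from the vertex, so that
  the cone looks like its local model on an arbitrarily large ball.\<close>

lemma dilated_agreement:
  fixes P L :: "'a::euclidean_space \<Rightarrow> 'a"
  assumes C: "open_cone C" "open_cone C'" and r: "r > 0" and model: "\<And>z. norm z < r \<Longrightarrow> q + z \<in> C \<longleftrightarrow> P z \<in> C'"
    and lin: "linear P" "linear L" and LP: "\<And>z. L (P z) = z"
  shows "\<exists>z0. \<forall>z. norm (P (z - z0)) \<le> s \<longrightarrow> (z \<in> C \<longleftrightarrow> P (z - z0) \<in> C')"
proof -
  have scale: "\<rho> *\<^sub>R x \<in> D \<longleftrightarrow> x \<in> D" if "\<rho> > 0" "open_cone D" for \<rho> x and D :: "'a set"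
  proof
    assume "\<rho> *\<^sub>R x \<in> D"
    then have "(1 / \<rho>) *\<^sub>R (\<rho> *\<^sub>R x) \<in> D" using that unfolding open_cone_def by (meson zero_less_divide_1_iff)
    then show "x \<in> D" using that(1) by simp
  qed (use that in \<open>simp add: open_cone_def\<close>)
  obtain B where B: "B > 0" "\<And>u. norm (L u) \<le> B * norm u" using linear_bounded_pos[OF lin(2)] by blast
  \<comment> \<open>Chosen so that a displacement z - \<kappa> q with |P (z - \<kappa> q)| \<le> s
    shrinks, after division by \<kappa>, into the ball of radius r of the local model; the summand 1
    makes the estimate strict.\<close>
  define \<kappa> where "\<kappa> = (B * \<bar>s\<bar> + 1) / r"
  have \<kappa>: "\<kappa> > 0" using B r by (simp add: \<kappa>_def add_nonneg_pos)
  show ?thesis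
  proof (intro exI[of _ "\<kappa> *\<^sub>R q"] allI impI)
    fix z assume z: "norm (P (z - \<kappa> *\<^sub>R q)) \<le> s"
    define w where "w = (1 / \<kappa>) *\<^sub>R (z - \<kappa> *\<^sub>R q)"
    have zw: "z - \<kappa> *\<^sub>R q = \<kappa> *\<^sub>R w" "z = \<kappa> *\<^sub>R (q + w)"
      using \<kappa> by (auto simp: w_def scaleR_add_right)
    have "norm (z - \<kappa> *\<^sub>R q) \<le> B * norm (P (z - \<kappa> *\<^sub>R q))" using B(2)[of "P (z - \<kappa> *\<^sub>R q)"] LP by simp
    also have "\<dots> \<le> B * \<bar>s\<bar>" using z B(1) by (intro mult_left_mono) auto
    also have "\<dots> < \<kappa> * r" using r by (simp add: \<kappa>_def)
    finally have "\<kappa> * norm w < \<kappa> * r" using \<kappa> zw(1) by simp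
    then have "norm w < r" using \<kappa> by simp
    then have "q + w \<in> C \<longleftrightarrow> P w \<in> C'" by (rule model)
    moreover have "P (z - \<kappa> *\<^sub>R q) = \<kappa> *\<^sub>R P w" using zw(1) lin(1) by (simp add: linear_cmul)
    ultimately show "z \<in> C \<longleftrightarrow> P (z - \<kappa> *\<^sub>R q) \<in> C'"
      using scale[OF \<kappa> C(1), of "q + w"] scale[OF \<kappa> C(2), of "P w"] zw(2) by simp
  qed
qed

theorem theorem5p2:
  fixes \<Omega> :: "(real^3) set" and B :: "real^3 \<Rightarrow> real^3" and C :: "real^3 \<Rightarrow> (real^3) set"
  assumes "\<Omega> \<in> polyhedral_domains_R3"
    and "continuous_on (closure \<Omega>) B"
    and "\<And>x. x \<in> closure \<Omega> \<Longrightarrow> tangent_cone_R3 \<Omega> x (C x)"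
  shows "lower_semicontinuous_on (closure \<Omega>) (\<lambda>x. ground_energy (B x) (C x))"
  unfolding lower_semicontinuous_on_def
proof (intro ballI allI impI)
  fix x a assume x: "x \<in> closure \<Omega>" and a: "a < ground_energy (B x) (C x)"
  let ?m0 = "ground_energy (B x) (C x)" and ?F = "at x within closure \<Omega>"
  have corner: "\<Omega> \<in> corner_R3" using assms(1) by (simp add: polyhedral_domains_R3_def)
  note reg = corner_R3_regular[OF corner]
  have cones: "C y \<in> cones_R3" if "y \<in> closure \<Omega>" for y
    using assms(3)[OF that] by (simp add: is_tangent_cone_def)
  have cone: "open_cone (C y)" "open (C y)" "C y \<noteq> {}" if "y \<in> closure \<Omega>" for y
    using dense_imp_full_R3 cones_R3_nonempty cones[OF that]
    by (auto simp: dense_imp_full_def open_cone_def)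
  have "\<forall>y\<in>closure \<Omega>. \<forall>D. tangent_cone_R3 \<Omega> y D \<longrightarrow> D \<in> polyhedral_cones_R3"
    using assms(1) by (simp add: polyhedral_domains_R3_def)
  then have "C x \<in> polyhedral_cones_R3" using x assms(3)[OF x] by (elim ballE[of _ _ x] allE[of _ "C x"]) auto
  then obtain H where H0: "finite H" "\<forall>h\<in>H. hyperplane h" "frontier (C x) \<subseteq> \<Union>H"
    unfolding polyhedral_cones_R3_def by blast
  have H: "finite H" "\<And>h. h \<in> H \<Longrightarrow> hyperplane h" "frontier (C x) \<subseteq> \<Union>H"
    using H0 by auto
  obtain N V U U' where "C x \<in> cones_R3" and N: "open N" "x \<in> N" and V: "open V" "0 \<in> V" and hom: "homeomorphism N V U U'"
    and sm: "smooth_map N U" "smooth_map V U'" and Ux: "U x = 0" and dU: "(U has_derivative (\<lambda>v. v)) (at x)"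
    and im: "U ` (N \<inter> \<Omega>) = V \<inter> C x"
    using assms(3)[OF x] by (rule tangent_chart)
  \<comment> \<open>Derivatives at y of the chart based at x, and of its inverse at the image point.
    They are inverse to each other and tend to the identity as y tends to x.\<close>
  define L where "L y = frechet_derivative U (at y)" for y
  define P where "P y = frechet_derivative U' (at (U y))" for y
  have UV: "U y \<in> V" if "y \<in> N" for y using hom that by (auto simp: homeomorphism_def)
  have dL: "(U has_derivative L y) (at y)" if "y \<in> N" for y
    using smooth_map_C1(1)[OF N(1) sm(1) that] by (simp add: L_def frechet_derivative_works)
  have dP: "(U' has_derivative P y) (at (U y))" if "y \<in> N" for y
    using smooth_map_C1(1)[OF V(1) sm(2) UV[OF that]] by (simp add: P_def frechet_derivative_works)
  have lin: "linear (L y)" "linear (P y)" if "y \<in> N" for y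
    using dL[OF that] dP[OF that] has_derivative_linear by auto
  have PL: "P y (L y v) = v" if "y \<in> N" for y v
    by (rule derivatives_inverse[OF hom N(1) that dL[OF that] dP[OF that]])
  have LP: "L y (P y v) = v" if "y \<in> N" for y v
    using derivatives_inverse[OF homeomorphism_symD[OF hom] V(1) UV[OF that] dP[OF that], of "L y" v]
      dL[OF that] homeomorphism_apply1[OF hom that] by simp
  let ?P = "\<lambda>y. matrix (P y)" and ?Q = "\<lambda>y. matrix (L y)"
  have P_matrix: "?P y *v v = P y v" if "y \<in> N" for y v
    using matrix_works[of "P y" v] lin(2)[OF that] by (simp add: linear_matrix_vector_mul_eq)
  have PQ: "?P y ** ?Q y = mat 1" "?Q y ** ?P y = mat 1" if "y \<in> N" for y
  proof -
    have "P y \<circ> L y = id" "L y \<circ> P y = id" using PL[OF that] LP[OF that] by auto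
    then show "?P y ** ?Q y = mat 1" "?Q y ** ?P y = mat 1"
      using matrix_compose[OF lin(1)[OF that] lin(2)[OF that]] matrix_compose[OF lin(2)[OF that] lin(1)[OF that]]
      by (simp_all add: matrix_id_mat_1)
  qed
  have Lx: "L x v = v" for v using frechet_derivative_at[OF dU] by (metis L_def)
  have Px: "P x v = v" for v using PL[OF N(2), of v] Lx by simp
  have limQ: "(?Q \<longlongrightarrow> mat 1) ?F"
  proof -
    have "((\<lambda>y. L y v) \<longlongrightarrow> L x v) (at x)" for v
      using smooth_map_C1(2)[OF N(1) sm(1), of v] N
      by (auto simp: L_def continuous_on_eq_continuous_at isCont_def)
    then have "((\<lambda>y. L y v) \<longlongrightarrow> L x v) ?F" for v by (rule tendsto_within_subset) simp
    then have "(?Q \<longlongrightarrow> ?Q x) ?F"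
      unfolding matrix_def by (intro vec_tendstoI) (auto intro: tendsto_vec_nth)
    moreover have "L x = id" using Lx by auto
    ultimately show ?thesis by (simp add: matrix_id_mat_1)
  qed
  have limP: "(?P \<longlongrightarrow> mat 1) ?F"
  proof -
    have "((\<lambda>y. P y v) \<longlongrightarrow> P x v) (at x)" for v
    proof -
      have "isCont (\<lambda>q. frechet_derivative U' (at q) v) (U x)"
        using smooth_map_C1(2)[OF V(1) sm(2), of v] UV[OF N(2)] V(1)
        by (simp add: continuous_on_eq_continuous_at)
      moreover have "isCont U x" using has_derivative_continuous[OF dU] .
      ultimately show ?thesis
        unfolding P_def using isCont_o2[of x U "\<lambda>q. frechet_derivative U' (at q) v"] by (simp add: isCont_def)
    qed
    then have "((\<lambda>y. P y v) \<longlongrightarrow> P x v) ?F" for v by (rule tendsto_within_subset) simp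
    then have "(?P \<longlongrightarrow> ?P x) ?F"
      unfolding matrix_def by (intro vec_tendstoI) (auto intro: tendsto_vec_nth)
    moreover have "P x = id" using Px by auto
    ultimately show ?thesis by (simp add: matrix_id_mat_1)
  qed
  have limB: "((\<lambda>y. field_matrix (B y)) \<longlongrightarrow> field_matrix (B x)) ?F"
    using assms(2) x by (intro tendsto_field_matrix) (simp add: continuous_on_def)
  \<comment> \<open>The midpoint leaves room on both sides: below for near minimizers at y, above
    for the errors of localization and transplantation.\<close>
  define m where "m = (a + ?m0) / 2"
  have m: "m < ?m0" "0 < m - a" using a by (auto simp: m_def field_simps)
  obtain c where c: "\<forall>A S f g m \<delta> R. magnetic_domain A S \<longrightarrow> (f, g) \<in> magnetic_pairs A S \<longrightarrow>
      sqnorm (lebesgue_on S) f = 1 \<longrightarrow> energy S g < m \<longrightarrow> \<delta> > 0 \<longrightarrow> R > 0 \<longrightarrow>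
      (\<exists>p. energy S (\<lambda>j x. of_real (window_at R p x) * g j x
              - \<i> * partial j (\<lambda>x. of_real (window_at R p x)) x * f x)
          < ((1 + \<delta>) * m + (1 + 1 / \<delta>) * (c / R\<^sup>2))
            * sqnorm (lebesgue_on S) (\<lambda>x. of_real (window_at R p x) * f x))"
    using localization by (elim exE conjE)
  obtain \<delta> R where \<delta>: "\<delta> > 0" and R: "R > 0"
    and K: "(1 + \<delta>) * ((1 + \<delta>) * m + (1 + 1 / \<delta>) * (c / R\<^sup>2)) < ?m0"
    using small_parameters[OF m(1)] by metis
  let ?K = "(1 + \<delta>) * m + (1 + 1 / \<delta>) * (c / R\<^sup>2)"
  let ?N = "\<lambda>y. field_matrix (B y)"
  \<comment> \<open>The right-hand side of \<open>transplanted_bound\<close> for the fields at x and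
    y. Its limit is (1 + \<delta>) times \<open>?K\<close>, which lies below the energy at x by the
    choice of \<delta> and R.\<close>
  let ?G = "\<lambda>y. ((1 + \<delta>) + (1 + 1 / \<delta>) * 2 * (norm (?P y - mat 1))\<^sup>2) * ?K
    + (1 + 1 / \<delta>) * 2 * ((norm ((?N x - transpose (?P y) ** ?N y ** ?P y) ** ?Q y))\<^sup>2 * (2 * R)\<^sup>2)"
  have "(?G \<longlongrightarrow> ((1 + \<delta>) + (1 + 1 / \<delta>) * 2 * (norm (mat 1 - mat 1 :: real^3^3))\<^sup>2) * ?K
      + (1 + 1 / \<delta>) * 2 * ((norm ((?N x - transpose (mat 1) ** ?N x ** mat 1) ** mat 1))\<^sup>2 * (2 * R)\<^sup>2)) ?F"
    by (intro tendsto_intros tendsto_matrix_mult tendsto_transpose limP limQ limB)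
  then have "(?G \<longlongrightarrow> (1 + \<delta>) * ?K) ?F" by (simp add: transpose_mat)
  then have "\<forall>\<^sub>F y in ?F. ?G y < ?m0" using K by (rule order_tendstoD(2))
  moreover have "\<forall>\<^sub>F y in ?F. y \<in> N"
    using eventually_at_topological N by blast
  moreover have "\<forall>\<^sub>F y in ?F. y \<in> closure \<Omega>" by (simp add: eventually_at_filter)
  ultimately show "\<forall>\<^sub>F y in ?F. a < ground_energy (B y) (C y)"
  proof eventually_elim
    case (elim y)
    show ?case
    proof (rule ccontr)
      assume "\<not> a < ground_energy (B y) (C y)"
      then have le: "ground_energy (B y) (C y) + (m - a) \<le> m" by simp
      obtain N' V' W W' where "C y \<in> cones_R3" and N': "open N'" "y \<in> N'" and V': "open V'" "0 \<in> V'"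
        and hom': "homeomorphism N' V' W W'" and "smooth_map N' W" and sm': "smooth_map V' W'" and W: "W y = 0"
        and dW: "(W has_derivative (\<lambda>v. v)) (at y)" and im': "W ` (N' \<inter> \<Omega>) = V' \<inter> C y"
        using assms(3)[OF elim(3)] by (rule tangent_chart)
      \<comment> \<open>The cone \<open>C y\<close> is whatever tangent cone was selected at y;
        comparing its chart with the chart at x ties it to \<open>C x\<close>.\<close>
      obtain r where r: "r > 0" "\<And>z. norm z < r \<Longrightarrow> U y + z \<in> C x \<longleftrightarrow> P y z \<in> C y"
        using local_model[OF reg hom N(1) elim(2) V im dL[OF elim(2)] dP[OF elim(2)] cone(1)[OF x] H
            hom' N' V' im' W dW smooth_map_C1(1)[OF V'(1) sm' V'(2)] cone(1)[OF elim(3)]] by blast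
      have agree: "\<exists>z0. \<forall>z. norm (?P y *v (z - z0)) \<le> s \<longrightarrow> (z \<in> C x \<longleftrightarrow> ?P y *v (z - z0) \<in> C y)" for s
        unfolding P_matrix[OF elim(2)]
        by (rule dilated_agreement[OF cone(1)[OF x] cone(1)[OF elim(3)] r lin(2)[OF elim(2)] lin(1)[OF elim(2)]
            LP[OF elim(2)]])
      obtain fg where "fg \<in> magnetic_pairs (\<lambda>x. ?N y *v x) (C y)" "sqnorm (lebesgue_on (C y)) (fst fg) = 1"
        "energy (C y) (snd fg) < ground_energy (B y) (C y) + (m - a)"
        using ground_energy_rayleigh(2)[OF cone(2,3)[OF elim(3)] m(2)] by blast
      then obtain f g where fg: "(f, g) \<in> magnetic_pairs (\<lambda>x. ?N y *v x) (C y)" "sqnorm (lebesgue_on (C y)) f = 1"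
        "energy (C y) g < m"
        using le by (cases fg) auto
      obtain p where p: "energy (C y) (\<lambda>j x. of_real (window_at R p x) * g j x
              - \<i> * partial j (\<lambda>x. of_real (window_at R p x)) x * f x)
          < ?K * sqnorm (lebesgue_on (C y)) (\<lambda>x. of_real (window_at R p x) * f x)"
        using c[rule_format, OF magnetic_domain_matrix[OF cone(2)[OF elim(3)]] fg \<delta> R] by (elim exE)
      \<comment> \<open>The bound \<open>?G y\<close> does not depend on f, g or p, so the closeness
        of y to x could be fixed before they were chosen.\<close>
      have "?m0 \<le> ?G y"
        by (rule transplanted_bound[OF PQ[OF elim(2)] cone(2)[OF elim(3)] cone(2)[OF x] agree
            ground_energy_rayleigh(1)[OF cone(2,3)[OF x]] fg(1) \<delta> R p])
      then show False using elim(1) by simp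
    qed
  qed
qed

end
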